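(* Let $G$ be a countable group. Let $T_1,T_2$ be two minimal irreducible $\mathbb{R}$-trees with isometric actions of $G$, with length functions $\ell_1,\ell_2$. Then $T_1$ and $T_2$ are compatible if and only if $\ell_1+\ell_2$ is the length function of an $\mathbb{R}$-tree with an isometric action of $G$.
   Context: An $\mathbb{R}$-tree is a geodesic metric space in which any two distinct points are joined by a unique topological arc. All $\mathbb{R}$-trees carry an isometric action of $G$. The length function of an $\mathbb{R}$-tree $T$ is $\ell:G\to\mathbb{R}$, $\ell(g)=\min_{x\in T}d(x,gx)$. An element $g$ is hyperbolic if it fixes no point of $T$; it then has an axis, a line on which it acts as a non-trivial translation. The action is minimal if there is no proper $G$-invariant subtree, and irreducible if there exist hyperbolic elements $g,h$ whose axes have compact (possibly empty) intersection. A $G$-equivariant map $f:T\to T'$ between $\mathbb{R}$-trees preserves alignment, or is a collapse map, if the image of any arc $[x,y]$ is a point or the arc $[f(x),f(y)]$; equivalently, the preimage of every subtree is a subtree. Two $\mathbb{R}$-trees $T_1,T_2$ are compatible if they have a common refinement: an $\mathbb{R}$-tree $\hat T$ with an isometric action of $G$ and equivariant collapse maps $\hat T\to T_1$, $\hat T\to T_2$. *)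

theory Defs
  imports "HOL-Analysis.Analysis" "HOL-Algebra.Group_Action" "HOL-Library.Equipollence"
begin

definition arc_between :: "'a set \<Rightarrow> ('a \<Rightarrow> 'a \<Rightarrow> real) \<Rightarrow> 'a set \<Rightarrow> 'a \<Rightarrow> 'a \<Rightarrow> bool" where
  "arc_between T d A x y \<longleftrightarrow>
    (\<exists>\<gamma>. embedding_map (top_of_set {0..1::real}) (Metric_space.mtopology T d) \<gamma> \<and>
         \<gamma> 0 = x \<and> \<gamma> 1 = y \<and> A = \<gamma> ` {0..1})"

definition geodesic_segment ::
    "'a set \<Rightarrow> ('a \<Rightarrow> 'a \<Rightarrow> real) \<Rightarrow> (real \<Rightarrow> 'a) \<Rightarrow> 'a \<Rightarrow> 'a \<Rightarrow> bool" where
  "geodesic_segment T d \<gamma> x y \<longleftrightarrow>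
    \<gamma> ` {0..d x y} \<subseteq> T \<and> \<gamma> 0 = x \<and> \<gamma> (d x y) = y \<and>
    (\<forall>s\<in>{0..d x y}. \<forall>t\<in>{0..d x y}. d (\<gamma> s) (\<gamma> t) = \<bar>s - t\<bar>)"

text \<open>Real trees are nonempty by convention; otherwise the empty space would be a common
  refinement of any two trees, and no action would be minimal.\<close>

locale real_tree = Metric_space T d for T :: "'a set" and d :: "'a \<Rightarrow> 'a \<Rightarrow> real" +
  assumes nonempty: "T \<noteq> {}"
    and geodesic: "\<And>x y. \<lbrakk>x \<in> T; y \<in> T\<rbrakk> \<Longrightarrow> \<exists>\<gamma>. geodesic_segment T d \<gamma> x y"
    and unique_arc: "\<And>x y. \<lbrakk>x \<in> T; y \<in> T; x \<noteq> y\<rbrakk> \<Longrightarrow> \<exists>!A. arc_between T d A x y"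

locale real_tree_action = real_tree T d + group_action G T \<phi>
  for G :: "('g, 'm) monoid_scheme" (structure) and T :: "'a set"
    and d :: "'a \<Rightarrow> 'a \<Rightarrow> real" and \<phi> :: "'g \<Rightarrow> 'a \<Rightarrow> 'a" +
  assumes isometric: "\<And>g x y. \<lbrakk>g \<in> carrier G; x \<in> T; y \<in> T\<rbrakk> \<Longrightarrow> d (\<phi> g x) (\<phi> g y) = d x y"

text \<open>The minimum of the displacement, which is attained for every isometry of a real tree.\<close>

definition tree_length ::
    "'a set \<Rightarrow> ('a \<Rightarrow> 'a \<Rightarrow> real) \<Rightarrow> ('g \<Rightarrow> 'a \<Rightarrow> 'a) \<Rightarrow> 'g \<Rightarrow> real" where
  "tree_length T d \<phi> g = (LEAST r. r \<in> (\<lambda>x. d x (\<phi> g x)) ` T)"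

definition hyperbolic :: "'a set \<Rightarrow> ('g \<Rightarrow> 'a \<Rightarrow> 'a) \<Rightarrow> 'g \<Rightarrow> bool" where
  "hyperbolic T \<phi> g \<longleftrightarrow> (\<forall>x\<in>T. \<phi> g x \<noteq> x)"

definition is_axis ::
    "'a set \<Rightarrow> ('a \<Rightarrow> 'a \<Rightarrow> real) \<Rightarrow> ('g \<Rightarrow> 'a \<Rightarrow> 'a) \<Rightarrow> 'g \<Rightarrow> 'a set \<Rightarrow> bool" where
  "is_axis T d \<phi> g A \<longleftrightarrow>
    (\<exists>(\<gamma> :: real \<Rightarrow> 'a) c. A = range \<gamma> \<and> A \<subseteq> T \<and> (\<forall>s t. d (\<gamma> s) (\<gamma> t) = \<bar>s - t\<bar>) \<and>
        c \<noteq> 0 \<and> (\<forall>t. \<phi> g (\<gamma> t) = \<gamma> (t + c)))"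

text \<open>A subtree is a subset that is itself a real tree for the restricted metric.\<close>

definition minimal_action ::
    "('g, 'm) monoid_scheme \<Rightarrow> 'a set \<Rightarrow> ('a \<Rightarrow> 'a \<Rightarrow> real) \<Rightarrow> ('g \<Rightarrow> 'a \<Rightarrow> 'a) \<Rightarrow> bool" where
  "minimal_action G T d \<phi> \<longleftrightarrow>
    (\<forall>S. S \<subseteq> T \<and> real_tree S d \<and> (\<forall>g\<in>carrier G. \<phi> g ` S = S) \<longrightarrow> S = T)"

definition irreducible_action ::
    "('g, 'm) monoid_scheme \<Rightarrow> 'a set \<Rightarrow> ('a \<Rightarrow> 'a \<Rightarrow> real) \<Rightarrow> ('g \<Rightarrow> 'a \<Rightarrow> 'a) \<Rightarrow> bool" where
  "irreducible_action G T d \<phi> \<longleftrightarrow>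
    (\<exists>g\<in>carrier G. \<exists>h\<in>carrier G. hyperbolic T \<phi> g \<and> hyperbolic T \<phi> h \<and>
      (\<exists>A B. is_axis T d \<phi> g A \<and> is_axis T d \<phi> h B \<and>
             compactin (Metric_space.mtopology T d) (A \<inter> B)))"

definition preserves_alignment ::
    "'a set \<Rightarrow> ('a \<Rightarrow> 'a \<Rightarrow> real) \<Rightarrow> 'b set \<Rightarrow> ('b \<Rightarrow> 'b \<Rightarrow> real) \<Rightarrow> ('a \<Rightarrow> 'b) \<Rightarrow> bool" where
  "preserves_alignment T d T' d' f \<longleftrightarrow>
    (\<forall>x\<in>T. \<forall>y\<in>T. \<forall>A. arc_between T d A x y \<longrightarrow>
        (\<exists>p. f ` A = {p}) \<or> arc_between T' d' (f ` A) (f x) (f y))"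

definition collapse_map ::
    "('g, 'm) monoid_scheme \<Rightarrow> 'a set \<Rightarrow> ('a \<Rightarrow> 'a \<Rightarrow> real) \<Rightarrow> ('g \<Rightarrow> 'a \<Rightarrow> 'a) \<Rightarrow>
     'b set \<Rightarrow> ('b \<Rightarrow> 'b \<Rightarrow> real) \<Rightarrow> ('g \<Rightarrow> 'b \<Rightarrow> 'b) \<Rightarrow> ('a \<Rightarrow> 'b) \<Rightarrow> bool" where
  "collapse_map G T d \<phi> T' d' \<phi>' f \<longleftrightarrow>
    f \<in> T \<rightarrow> T' \<and> (\<forall>g\<in>carrier G. \<forall>x\<in>T. f (\<phi> g x) = \<phi>' g (f x)) \<and>
    preserves_alignment T d T' d' f"

text \<open>HOL cannot quantify existentially over types, so the two notions below, which assert that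
  some real tree exists, carry a type argument: the tree sought is an arbitrary subset of that
  type. A theorem that is polymorphic in this type, subject only to the type being
  at least as large as the reals, loses no generality: any type embeds into such a type, for
  example into its disjoint sum with the reals.\<close>

definition compatible ::
    "'c itself \<Rightarrow> ('g, 'm) monoid_scheme \<Rightarrow>
     'a set \<Rightarrow> ('a \<Rightarrow> 'a \<Rightarrow> real) \<Rightarrow> ('g \<Rightarrow> 'a \<Rightarrow> 'a) \<Rightarrow>
     'b set \<Rightarrow> ('b \<Rightarrow> 'b \<Rightarrow> real) \<Rightarrow> ('g \<Rightarrow> 'b \<Rightarrow> 'b) \<Rightarrow> bool" where
  "compatible (_ :: 'c itself) G T\<^sub>1 d\<^sub>1 \<phi>\<^sub>1 T\<^sub>2 d\<^sub>2 \<phi>\<^sub>2 \<longleftrightarrow>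
    (\<exists>(T :: 'c set) d \<phi> f\<^sub>1 f\<^sub>2. real_tree_action G T d \<phi> \<and>
       collapse_map G T d \<phi> T\<^sub>1 d\<^sub>1 \<phi>\<^sub>1 f\<^sub>1 \<and> collapse_map G T d \<phi> T\<^sub>2 d\<^sub>2 \<phi>\<^sub>2 f\<^sub>2)"

definition is_length_function ::
    "'c itself \<Rightarrow> ('g, 'm) monoid_scheme \<Rightarrow> ('g \<Rightarrow> real) \<Rightarrow> bool" where
  "is_length_function (_ :: 'c itself) G l \<longleftrightarrow>
    (\<exists>(T :: 'c set) d \<phi>. real_tree_action G T d \<phi> \<and>
       (\<forall>g\<in>carrier G. l g = tree_length T d \<phi> g))"

end

theory Submission
  imports Defs
begin

text \<open>
  A geodesic space is a real tree iff it satisfies the four-point condition, so everything is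
  expressed through betweenness. Let \<open>D\<close> be the sum of the two metrics on
  \<open>T\<^sub>1 \<times> T\<^sub>2\<close>. The trees are compatible iff some invariant nonempty subset of the product is a
  real tree for \<open>D\<close>: it is the image of a common refinement, and conversely its projections are
  collapse maps. In such a subset, an element \<open>g\<close> has translation length
  \<open>\<ell>\<^sub>1(g) + \<ell>\<^sub>2(g)\<close>, because collapse maps preserve the relation \<open>g x \<in> [x, g\<^sup>2 x]\<close>, which
  characterises the points of minimal displacement.

  Conversely, let \<open>\<ell>\<^sub>1 + \<ell>\<^sub>2\<close> be the length function of \<open>T\<^sub>0\<close>. Irreducibility yields \<open>c\<close> and a conjugate
  \<open>a\<close> of \<open>c\<close> that are hyperbolic with disjoint axes in \<open>T\<^sub>1\<close> and in \<open>T\<^sub>2\<close>; disjointness means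
  \<open>\<ell>(c a) > \<ell>(c) + \<ell>(a)\<close>, so it holds in \<open>T\<^sub>0\<close> too. Let \<open>y\<close> be the foot on the axis of \<open>c\<close> of the bridge to
  the axis of \<open>a\<close>. If \<open>w\<close> is generic, then \<open>\<ell>(a w a w\<^sup>-\<^sup>1) = 2 d(y, w y) + 2 d(y, a y)\<close>, which is linear in
  the length function; hence, up to a constant, distances in \<open>T\<^sub>0\<close> between points far out on translates of the axis of
  \<open>c\<close> are the \<open>D\<close>-distances of the corresponding points of \<open>T\<^sub>1 \<times> T\<^sub>2\<close>. So the latter satisfy the
  four-point condition, and so do their medians, among which is the orbit of \<open>(y\<^sub>1, y\<^sub>2)\<close>. An invariant
  subset that contains this orbit and is maximal for the four-point condition is geodesic.
\<close>

section \<open>Betweenness and the four-point condition\<close>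

text \<open>The obstacle is that \<open>T0\<close> comes with no map to or from the other two trees
  and is assumed neither minimal nor irreducible: everything has to be read off from lengths, and a
  length yields a distance only where a path does not fold. Folding depends on the tree, so
  \<open>w\<close> must be generic in three trees at once; hence the detour through far points,
  where genericity holds eventually. The constant in the comparison of distances cancels because
  every sum in the four-point condition has two terms.

  Medians can be added afterwards because a quadruple that satisfies the four-point condition for
  \<open>D\<close> splits in the same way in both factors; otherwise the pairing that is maximal in
  both would be strictly larger than the other two.

  Filling in an orbit must respect the group. The points added are canonical (medians, limits,
  coordinatewise midpoints of gaps), so invariance comes for free. Countability and minimality enter
  through cardinality: they bound the trees by the continuum, so that a tree found inside the
  product fits into any type at least as large as the reals.\<close>

text \<open>In a tree, \<open>\<not> btw d a o b\<close> says that \<open>a\<close> and \<open>b\<close> lie in the same direction from \<open>o\<close>.\<close>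

definition btw :: "('a \<Rightarrow> 'a \<Rightarrow> real) \<Rightarrow> 'a \<Rightarrow> 'a \<Rightarrow> 'a \<Rightarrow> bool" where
  "btw d x p y \<longleftrightarrow> d x p + d p y = d x y"

context Metric_space
begin

lemma btw_sym: "btw d x p y \<longleftrightarrow> btw d y p x"
  by (auto simp: btw_def commute)

lemma btw_refl [simp]: "x \<in> M \<Longrightarrow> btw d x x y" "y \<in> M \<Longrightarrow> btw d x y y"
  by (auto simp: btw_def)

lemma btw_antisym:
  assumes "btw d x p y" "btw d p x y" "x \<in> M" "y \<in> M" "p \<in> M"
  shows "p = x"
  using assms zero[of p x] unfolding btw_def by (smt (verit) commute nonneg)

lemma btw_trans1:
  assumes "btw d x p y" "btw d p q y" "x \<in> M" "y \<in> M" "p \<in> M" "q \<in> M"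
  shows "btw d x q y" "btw d x p q"
  using assms triangle[of x p q] triangle[of x q y] unfolding btw_def by auto

lemma btw_trans2:
  assumes "btw d x p y" "btw d x q p" "x \<in> M" "y \<in> M" "p \<in> M" "q \<in> M"
  shows "btw d x q y" "btw d q p y"
  using assms triangle[of x q y] triangle[of q p y] unfolding btw_def by auto

end

locale four_point = Metric_space T d for T :: "'a set" and d :: "'a \<Rightarrow> 'a \<Rightarrow> real" +
  assumes four_point: "\<lbrakk>x \<in> T; y \<in> T; z \<in> T; w \<in> T\<rbrakk> \<Longrightarrow>
    d x y + d z w \<le> max (d x z + d y w) (d x w + d y z)"
begin

text \<open>Applied to all three pairings, the condition says that no sum exceeds the larger of the
  other two, so the two largest agree. The disjunct tells which pairing is smallest, that is, how
  the quadruple splits.\<close>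

lemma four_point_cases:
  assumes "x \<in> T" "y \<in> T" "z \<in> T" "w \<in> T"
  shows "(d x y + d z w \<le> d x z + d y w \<and> d x z + d y w = d x w + d y z) \<or>
         (d x z + d y w \<le> d x y + d z w \<and> d x y + d z w = d x w + d y z) \<or>
         (d x w + d y z \<le> d x y + d z w \<and> d x y + d z w = d x z + d y w)"
  using four_point[of x y z w] four_point[of x z y w] four_point[of x w y z] assms
  by (simp add: commute[of w] commute[of z y] max_def split: if_splits)

lemma btw_dist:
  assumes "btw d n k z" "btw d n m z" "n \<in> T" "k \<in> T" "m \<in> T" "z \<in> T"
  shows "d k m = \<bar>d n k - d n m\<bar>"
  using assms four_point_cases[of n z k m] triangle[of n k m] triangle[of n m k]
  unfolding btw_def by (auto simp: commute)

lemma btw_unique: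
  assumes "btw d x p y" "btw d x q y" "d x p = d x q" "x \<in> T" "y \<in> T" "p \<in> T" "q \<in> T"
  shows "p = q"
  using btw_dist[of x p y q] assms by simp

text \<open>Triangles are tripods, so each side lies in the union of the other two.\<close>

lemma btw_split:
  assumes "btw d p r q" "o' \<in> T" "p \<in> T" "q \<in> T" "r \<in> T"
  shows "btw d o' r p \<or> btw d o' r q"
  using assms four_point_cases[of o' r p q] triangle[of o' r p] triangle[of o' r q]
    triangle[of o' p r] triangle[of o' q r]
  unfolding btw_def by (auto simp: commute)

text \<open>Segments that overlap in a nondegenerate piece glue to a segment: local geodesics are
  global. If \<open>y = z\<close> were allowed, the path could fold there.\<close>

lemma btw_chain:
  assumes "btw d x y z" "btw d y z w" "y \<noteq> z" "x \<in> T" "y \<in> T" "z \<in> T" "w \<in> T"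
  shows "btw d x y w" "btw d x z w"
proof -
  have "d y z > 0" using assms by simp
  then have "d x w = d x y + d y z + d z w"
    using assms four_point_cases[of x y z w] triangle[of x z w] commute[of w] commute[of z]
    unfolding btw_def by (smt (verit))
  then show "btw d x y w" "btw d x z w" using assms unfolding btw_def by auto
qed

text \<open>\<open>a\<close> and \<open>c\<close> lie in one component of the complement of
  \<open>o'\<close>, and \<open>b\<close> does not. With the negation read as "same direction", this
  is transitivity, which serves in place of components from here on.\<close>

lemma btw_dir:
  assumes "btw d a o' b" "\<not> btw d a o' c" "a \<in> T" "b \<in> T" "c \<in> T" "o' \<in> T"
  shows "btw d c o' b"
  using assms four_point_cases[of a b c o'] triangle[of a o' c] triangle[of c o' b]
  unfolding btw_def by (auto simp: commute)

end

text \<open>Geodesicity is stated by distances only, so that it can be checked on subsets of a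
  product. Paths come back in \<open>geodesic_param\<close>, because a point of a segment is
  determined by its distance from one end.\<close>

locale geodesic_four_point = four_point +
  assumes geod: "\<lbrakk>x \<in> T; y \<in> T; 0 \<le> t; t \<le> d x y\<rbrakk> \<Longrightarrow> \<exists>p\<in>T. d x p = t \<and> d p y = d x y - t"
begin

lemma median:
  assumes "x \<in> T" "y \<in> T" "z \<in> T"
  shows "\<exists>m\<in>T. btw d x m y \<and> btw d y m z \<and> btw d x m z"
proof -
  \<comment> \<open>The distance of the median from \<open>x\<close> is the Gromov product of
    \<open>y\<close> and \<open>z\<close> at \<open>x\<close>, the length of that leg of the
    tripod.\<close>
  have "0 \<le> (d x y + d x z - d y z)/2" "(d x y + d x z - d y z)/2 \<le> d x y"
    using triangle[of y x z] triangle[of x y z] assms by (auto simp: commute)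
  then obtain m where m: "m \<in> T" "d x m = (d x y + d x z - d y z)/2"
      "d m y = d x y - (d x y + d x z - d y z)/2"
    using geod[of x y] assms by blast
  have "d m z \<le> (d x z + d y z - d x y)/2"
    using m assms four_point_cases[of x y z m] triangle[of x m z] triangle[of y m z]
    by (auto simp: commute field_simps)
  then have "d m z = (d x z + d y z - d x y)/2"
    using triangle[of x m z] triangle[of y m z] m assms by (auto simp: commute field_simps)
  then show ?thesis using m unfolding btw_def
    by (intro bexI[of _ m]) (auto simp: commute field_simps)
qed

lemma geodesic_param:
  assumes "x \<in> T" "y \<in> T"
  obtains \<gamma> where "geodesic_segment T d \<gamma> x y" "\<And>t. t \<in> {0..d x y} \<Longrightarrow> d x (\<gamma> t) = t"
    "\<And>t. t \<in> {0..d x y} \<Longrightarrow> btw d x (\<gamma> t) y"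
    "\<gamma> ` {0..d x y} = {p \<in> T. btw d x p y}"
proof -
  have "\<forall>t\<in>{0..d x y}. \<exists>p\<in>T. d x p = t \<and> d p y = d x y - t" using geod assms by auto
  then obtain \<gamma> where \<gamma>: "\<And>t. t \<in> {0..d x y} \<Longrightarrow> \<gamma> t \<in> T \<and> d x (\<gamma> t) = t \<and> d (\<gamma> t) y = d x y - t"
    by metis
  have b: "btw d x (\<gamma> t) y" if "t \<in> {0..d x y}" for t using \<gamma>[OF that] unfolding btw_def by auto
  have 0: "\<gamma> 0 = x" using \<gamma>[of 0] assms zero[of x "\<gamma> 0"] by auto
  have 1: "\<gamma> (d x y) = y" using \<gamma>[of "d x y"] assms zero[of "\<gamma> (d x y)" y] by auto
  have 2: "d (\<gamma> s) (\<gamma> t) = \<bar>s - t\<bar>" if "s \<in> {0..d x y}" "t \<in> {0..d x y}" for s t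
    using btw_dist[OF b[OF that(1)] b[OF that(2)]] \<gamma> that assms by auto
  have "\<gamma> ` {0..d x y} = {p \<in> T. btw d x p y}"
  proof (intro equalityI subsetI)
    fix p assume p: "p \<in> {p \<in> T. btw d x p y}"
    then have "d x p + d p y = d x y" unfolding btw_def by simp
    then have t: "d x p \<in> {0..d x y}" using nonneg[of p y] nonneg[of x p]
      unfolding atLeastAtMost_iff by linarith
    have "\<gamma> (d x p) = p" using btw_unique[of x "\<gamma> (d x p)" y p] b[OF t] \<gamma>[OF t] p assms by auto
    then show "p \<in> \<gamma> ` {0..d x y}" using t by (metis imageI)
  qed (use b \<gamma> in auto)
  then show ?thesis using that[of \<gamma>] \<gamma> b 0 1 2 unfolding geodesic_segment_def by auto
qed

end

section \<open>Real trees and the four-point condition\<close>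

text \<open>Supplies the last point of one segment on another and the first point of a segment in a
  characteristic set; both conditions are sublevel conditions of 2-Lipschitz functions.\<close>

lemma Lipschitz_sublevel_extrema:
  fixes F :: "real \<Rightarrow> real"
  assumes L: "\<And>s t. \<lbrakk>s \<in> {a..b}; t \<in> {a..b}\<rbrakk> \<Longrightarrow> \<bar>F s - F t\<bar> \<le> L * \<bar>s - t\<bar>"
    and ex: "t0 \<in> {a..b}" "F t0 \<le> 0"
  shows "\<exists>t\<in>{a..b}. F t \<le> 0 \<and> (\<forall>s\<in>{a..b}. F s \<le> 0 \<longrightarrow> t \<le> s)"
    and "\<exists>t\<in>{a..b}. F t \<le> 0 \<and> (\<forall>s\<in>{a..b}. F s \<le> 0 \<longrightarrow> s \<le> t)"
proof -
  have "(max L 0)-lipschitz_on {a..b} F"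
  proof (rule lipschitz_onI)
    fix x y assume "x \<in> {a..b}" "y \<in> {a..b}"
    then have "\<bar>F x - F y\<bar> \<le> L * \<bar>x - y\<bar>" by (rule L)
    also have "\<dots> \<le> max L 0 * \<bar>x - y\<bar>" by (intro mult_right_mono) auto
    finally show "dist (F x) (F y) \<le> max L 0 * dist x y" by (simp add: dist_real_def)
  qed simp
  then have "continuous_on {a..b} F" by (rule lipschitz_on_continuous_on)
  then have "closed ({a..b} \<inter> F -` {..0})" by (intro continuous_closed_preimage) auto
  then have "compact ({a..b} \<inter> F -` {..0})" by (metis compact_Int_closed compact_Icc inf.absorb_iff2 inf_left_idem)
  moreover have "{a..b} \<inter> F -` {..0} \<noteq> {}" using ex by auto
  ultimately show "\<exists>t\<in>{a..b}. F t \<le> 0 \<and> (\<forall>s\<in>{a..b}. F s \<le> 0 \<longrightarrow> t \<le> s)"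
    and "\<exists>t\<in>{a..b}. F t \<le> 0 \<and> (\<forall>s\<in>{a..b}. F s \<le> 0 \<longrightarrow> s \<le> t)"
    using compact_attains_inf[of "{a..b} \<inter> F -` {..0}"] compact_attains_sup[of "{a..b} \<inter> F -` {..0}"]
    by auto
qed

context Metric_space
begin

lemma Lipschitz_path_continuous:
  fixes f :: "real \<Rightarrow> 'a" and S :: "real set"
  assumes "f ` S \<subseteq> M" and L: "\<And>s t. \<lbrakk>s \<in> S; t \<in> S\<rbrakk> \<Longrightarrow> d (f s) (f t) \<le> L * \<bar>s - t\<bar>"
  shows "continuous_map (top_of_set S) mtopology f"
  unfolding continuous_map_to_metric
proof (intro ballI allI impI)
  fix x and e :: real assume x: "x \<in> topspace (top_of_set S)" and e: "0 < e"
  define U where "U = S \<inter> ball x (e / (\<bar>L\<bar> + 1))"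
  have "openin (top_of_set S) U" unfolding U_def by (simp add: openin_open_Int)
  moreover have "x \<in> U" unfolding U_def using x e by (simp add: divide_pos_pos add_nonneg_pos)
  moreover have "f y \<in> mball (f x) e" if "y \<in> U" for y
  proof -
    have y: "y \<in> S" "\<bar>x - y\<bar> < e / (\<bar>L\<bar> + 1)" using that unfolding U_def by (auto simp: dist_real_def)
    have "d (f x) (f y) \<le> L * \<bar>x - y\<bar>" using L x y by auto
    also have "\<dots> \<le> (\<bar>L\<bar> + 1) * \<bar>x - y\<bar>" by (intro mult_right_mono) auto
    also have "\<dots> < e" using y(2) by (simp add: pos_less_divide_eq mult.commute add_nonneg_pos)
    finally show ?thesis using assms(1) x y by auto
  qed
  ultimately show "\<exists>U. openin (top_of_set S) U \<and> x \<in> U \<and> (\<forall>y\<in>U. f y \<in> mball (f x) e)" by blast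
qed

text \<open>A continuous injection from a compact space to a Hausdorff space is an embedding. Asking
  only for a nonexpanding parametrisation lets glued paths qualify before they are known to be
  geodesic.\<close>

lemma arc_between_of_Lipschitz:
  assumes l: "l > 0" and f: "f ` {0..l} \<subseteq> M"
    and L: "\<And>s t. \<lbrakk>s \<in> {0..l}; t \<in> {0..l}\<rbrakk> \<Longrightarrow> d (f s) (f t) \<le> \<bar>s - t\<bar>"
    and inj: "inj_on f {0..l}"
  shows "arc_between M d (f ` {0..l}) (f 0) (f l)"
proof -
  define h where "h = (\<lambda>s::real. f (s * l))"
  have im: "(\<lambda>s. s * l) ` {0..1} = {0..l}" using l by (simp add: image_mult_atLeastAtMost_if' mult.commute)
  have sl: "s * l \<in> {0..l}" if "s \<in> {0..1}" for s using that im by blast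
  have h: "h ` {0..1} = f ` {0..l}" unfolding h_def using im by (metis image_image)
  have "continuous_map (top_of_set {0..1}) mtopology h"
  proof (rule Lipschitz_path_continuous[where L = l])
    show "h ` {0..1} \<subseteq> M" using h f by simp
    show "d (h s) (h t) \<le> l * \<bar>s - t\<bar>" if "s \<in> {0..1}" "t \<in> {0..1}" for s t
    proof -
      have "d (h s) (h t) \<le> \<bar>s * l - t * l\<bar>" unfolding h_def using L sl that by blast
      also have "\<dots> = l * \<bar>s - t\<bar>" using l by (metis abs_mult abs_of_pos left_diff_distrib mult.commute)
      finally show ?thesis .
    qed
  qed
  moreover have "inj_on h {0..1}"
  proof (rule inj_onI)
    fix s t assume st: "s \<in> {0..1}" "t \<in> {0..1}" "h s = h t"
    then have "s * l = t * l" using inj sl unfolding h_def inj_on_def by blast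
    then show "s = t" using l by simp
  qed
  ultimately have "embedding_map (top_of_set {0..1}) mtopology h"
    by (intro continuous_imp_embedding_map) (auto simp: compact_space_subtopology Hausdorff_space_mtopology)
  then show ?thesis unfolding arc_between_def
    by (intro exI[of _ h]) (use h in \<open>auto simp: h_def\<close>)
qed

lemma geodesic_segmentD:
  assumes "geodesic_segment M d \<gamma> x y"
  shows "\<gamma> 0 = x" "\<gamma> (d x y) = y"
    and "t \<in> {0..d x y} \<Longrightarrow> \<gamma> t \<in> M"
    and "\<lbrakk>s \<in> {0..d x y}; t \<in> {0..d x y}\<rbrakk> \<Longrightarrow> d (\<gamma> s) (\<gamma> t) = \<bar>s - t\<bar>"
    and "t \<in> {0..d x y} \<Longrightarrow> d x (\<gamma> t) = t"
    and "t \<in> {0..d x y} \<Longrightarrow> d (\<gamma> t) y = d x y - t"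
proof -
  note g = assms[unfolded geodesic_segment_def]
  show 1: "\<gamma> 0 = x" "\<gamma> (d x y) = y" using g by blast+
  show "\<gamma> t \<in> M" if "t \<in> {0..d x y}" using g that by blast
  show 2: "d (\<gamma> s) (\<gamma> t) = \<bar>s - t\<bar>" if "s \<in> {0..d x y}" "t \<in> {0..d x y}" for s t using g that by blast
  have e: "0 \<in> {0..d x y}" "d x y \<in> {0..d x y}" by simp_all
  show "d x (\<gamma> t) = t" if "t \<in> {0..d x y}" using 2[OF e(1) that] that 1 by simp
  show "d (\<gamma> t) y = d x y - t" if "t \<in> {0..d x y}" using 2[OF that e(2)] that 1 by simp
qed

lemma arc_between_geodesic:
  assumes "geodesic_segment M d \<gamma> x y" "x \<in> M" "y \<in> M" "x \<noteq> y"
  shows "arc_between M d (\<gamma> ` {0..d x y}) x y"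
proof -
  have "d x y > 0" using assms by simp
  moreover have "inj_on \<gamma> {0..d x y}"
  proof (rule inj_onI)
    fix s t assume st: "s \<in> {0..d x y}" "t \<in> {0..d x y}" "\<gamma> s = \<gamma> t"
    then have "d (\<gamma> s) (\<gamma> s) = \<bar>s - t\<bar>" using geodesic_segmentD(4)[OF assms(1), of s t] by simp
    moreover have "d (\<gamma> s) (\<gamma> s) = 0" using geodesic_segmentD(3)[OF assms(1) st(1)] by simp
    ultimately show "s = t" by simp
  qed
  ultimately show ?thesis using arc_between_of_Lipschitz[of "d x y" \<gamma>] geodesic_segmentD[OF assms(1)]
    by (metis image_subsetI order_refl)
qed

lemma geodesic_concat:
  assumes "geodesic_segment M d \<gamma> x p" "geodesic_segment M d \<sigma> p y" "btw d x p y"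
    "x \<in> M" "y \<in> M" "p \<in> M"
  shows "geodesic_segment M d (\<lambda>t. if t \<le> d x p then \<gamma> t else \<sigma> (t - d x p)) x y"
proof -
  have xy: "d x y = d x p + d p y" using assms unfolding btw_def by simp
  let ?h = "\<lambda>t. if t \<le> d x p then \<gamma> t else \<sigma> (t - d x p)"
  have \<gamma>M: "\<gamma> t \<in> M" if "0 \<le> t" "t \<le> d x p" for t using geodesic_segmentD(3)[OF assms(1)] that by simp
  have \<sigma>M: "\<sigma> t \<in> M" if "0 \<le> t" "t \<le> d p y" for t using geodesic_segmentD(3)[OF assms(2)] that by simp
  have key: "d (\<gamma> s) (\<sigma> (t - d x p)) = t - s" if "0 \<le> s" "s \<le> d x p" "d x p \<le> t" "t \<le> d x y" for s t
  proof -
    have m: "\<gamma> s \<in> M" "\<sigma> (t - d x p) \<in> M" using \<gamma>M \<sigma>M that xy by auto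
    have 1: "d x (\<gamma> s) = s" "d (\<gamma> s) p = d x p - s" using geodesic_segmentD[OF assms(1)] that by auto
    have 2: "d p (\<sigma> (t - d x p)) = t - d x p" "d (\<sigma> (t - d x p)) y = d x y - t"
      using geodesic_segmentD(5,6)[OF assms(2), of "t - d x p"] that xy by auto
    show ?thesis using triangle[OF m(1) assms(6) m(2)] triangle[OF assms(4) m(1) assms(5)]
       triangle[OF m(1) m(2) assms(5)] 1 2 by linarith
  qed
  have "d (?h s) (?h t) = \<bar>s - t\<bar>" if "s \<in> {0..d x y}" "t \<in> {0..d x y}" for s t
  proof -
    consider "s \<le> d x p" "t \<le> d x p" | "s \<le> d x p" "\<not> t \<le> d x p" | "\<not> s \<le> d x p" "t \<le> d x p"
      | "\<not> s \<le> d x p" "\<not> t \<le> d x p" by blast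
    then show ?thesis
    proof cases
      case 1 then show ?thesis using geodesic_segmentD(4)[OF assms(1), of s t] that by simp
    next
      case 2 then show ?thesis using key[of s t] that by auto
    next
      case 3 then show ?thesis using key[of t s] that by (auto simp: commute)
    next
      case 4 then show ?thesis using geodesic_segmentD(4)[OF assms(2), of "s - d x p" "t - d x p"] that xy by simp
    qed
  qed
  moreover have "?h ` {0..d x y} \<subseteq> M"
  proof (rule image_subsetI)
    fix t assume "t \<in> {0..d x y}"
    then show "?h t \<in> M" using \<gamma>M[of t] \<sigma>M[of "t - d x p"] xy by simp
  qed
  moreover have "?h 0 = x" using geodesic_segmentD(1)[OF assms(1)] by simp
  moreover have "?h (d x y) = y"
  proof (cases "p = y")
    case True
    then show ?thesis using geodesic_segmentD(2)[OF assms(1)] by simp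
  next
    case False
    then have "0 < d p y" using assms(5,6) by simp
    then have "\<not> d x y \<le> d x p" "d x y - d x p = d p y" using xy by linarith+
    then show ?thesis using geodesic_segmentD(2)[OF assms(2)] by simp
  qed
  ultimately show ?thesis unfolding geodesic_segment_def by (intro conjI ballI)
qed

end

context real_tree
begin

text \<open>Geodesics from \<open>x\<close> to \<open>p\<close> and from \<open>p\<close> to
  \<open>y\<close> concatenate to a geodesic, and uniqueness of arcs identifies its image with that
  of \<gamma>.\<close>

lemma btw_in_geodesic:
  assumes "geodesic_segment T d \<gamma> x y" "btw d x p y" "x \<in> T" "y \<in> T" "p \<in> T"
  shows "p \<in> \<gamma> ` {0..d x y}"
proof (cases "x = y")
  case True
  then have "p = x" using assms nonneg[of x p] nonneg[of p y] unfolding btw_def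
    by (metis add_nonneg_eq_0_iff mdist_zero zero)
  moreover have "0 \<in> {0..d x y}" by simp
  ultimately show ?thesis using geodesic_segmentD(1)[OF assms(1)] by (metis imageI)
next
  case False
  obtain \<sigma> \<tau> where st: "geodesic_segment T d \<sigma> x p" "geodesic_segment T d \<tau> p y"
    using geodesic assms by metis
  let ?h = "\<lambda>t. if t \<le> d x p then \<sigma> t else \<tau> (t - d x p)"
  have h: "geodesic_segment T d ?h x y" using geodesic_concat st assms by blast
  have "?h ` {0..d x y} = \<gamma> ` {0..d x y}"
    using unique_arc[OF assms(3,4) False] arc_between_geodesic[OF h] arc_between_geodesic[OF assms(1)]
      assms False by blast
  moreover have "p = ?h (d x p)" using geodesic_segmentD(2)[OF st(1)] by simp
  moreover have "d x p \<in> {0..d x y}" using assms(2) nonneg[of p y] nonneg[of x p] unfolding btw_def atLeastAtMost_iff by linarith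
  ultimately show ?thesis by blast
qed

lemma btw_same_geodesic:
  assumes "btw d n k z" "btw d n m z" "n \<in> T" "k \<in> T" "m \<in> T" "z \<in> T"
  shows "d k m = \<bar>d n k - d n m\<bar>"
proof -
  obtain \<gamma> where \<gamma>: "geodesic_segment T d \<gamma> n z" using geodesic assms by blast
  obtain s t where st: "s \<in> {0..d n z}" "t \<in> {0..d n z}" "k = \<gamma> s" "m = \<gamma> t"
    using btw_in_geodesic[OF \<gamma>] assms by (metis imageE)
  then show ?thesis using geodesic_segmentD(4,5)[OF \<gamma>] by simp
qed

text \<open>The median is the last point \<open>m\<close> of \<open>[x, y]\<close> on \<open>[x, z]\<close>: then \<open>[y, m] \<union> [m, z]\<close> is an arc, and
  therefore the geodesic from \<open>y\<close> to \<open>z\<close>.\<close>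

lemma exists_median:
  assumes "x \<in> T" "y \<in> T" "z \<in> T"
  shows "\<exists>m\<in>T. btw d x m y \<and> btw d y m z \<and> btw d x m z"
proof (cases "y = z")
  case True
  then show ?thesis using assms by (intro bexI[of _ y]) (auto simp: btw_def)
next
  case yz: False
  obtain \<gamma> where \<gamma>0: "geodesic_segment T d \<gamma> x y" using geodesic assms by blast
  define D where "D = d x y"
  have \<gamma>T: "\<gamma> t \<in> T" if "t \<in> {0..D}" for t using geodesic_segmentD(3)[OF \<gamma>0] that unfolding D_def by simp
  have \<gamma>d: "d (\<gamma> s) (\<gamma> t) = \<bar>s - t\<bar>" if "s \<in> {0..D}" "t \<in> {0..D}" for s t using geodesic_segmentD(4)[OF \<gamma>0] that unfolding D_def by simp
  have D0: "0 \<le> D" unfolding D_def by simp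
  have \<gamma>x: "\<gamma> 0 = x" and \<gamma>y: "\<gamma> D = y" using geodesic_segmentD(1,2)[OF \<gamma>0] unfolding D_def by simp_all
  \<comment> \<open>\<open>F t\<close> is the excess of the detour from \<open>x\<close> to
    \<open>z\<close> through \<open>\<gamma> t\<close>; it is never negative, and it vanishes
    exactly where \<gamma> runs on \<open>[x, z]\<close>.\<close>
  define F where "F = (\<lambda>t. d x (\<gamma> t) + d (\<gamma> t) z - d x z)"
  have FL: "\<bar>F s - F t\<bar> \<le> 2 * \<bar>s - t\<bar>" if "s \<in> {0..D}" "t \<in> {0..D}" for s t
    unfolding F_def using \<gamma>d[OF that] \<gamma>T[OF that(1)] \<gamma>T[OF that(2)] assms triangle[of x "\<gamma> s" "\<gamma> t"] triangle[of x "\<gamma> t" "\<gamma> s"]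
     triangle[of "\<gamma> s" "\<gamma> t" z] triangle[of "\<gamma> t" "\<gamma> s" z] commute[of "\<gamma> s" "\<gamma> t"] by (smt (verit))
  have "F 0 = 0" unfolding F_def using \<gamma>x assms by simp
  then obtain t where t: "t \<in> {0..D}" "F t \<le> 0" "\<And>s. s \<in> {0..D} \<Longrightarrow> F s \<le> 0 \<Longrightarrow> s \<le> t"
    using Lipschitz_sublevel_extrema(2)[where a=0 and b=D and F=F and L=2, OF FL, of 0] D0 by auto
  define m where "m = \<gamma> t"
  have mT: "m \<in> T" unfolding m_def using \<gamma>T t by auto
  have "F t = 0" using t triangle[of x "\<gamma> t" z] \<gamma>T assms unfolding F_def by fastforce
  then have m: "btw d x m z" unfolding btw_def F_def m_def by simp
  have "d x m = t" "d m y = D - t" using \<gamma>d[of 0 t] \<gamma>d[of t D] t D0 \<gamma>x \<gamma>y unfolding m_def by auto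
  then have mxy: "btw d x m y" unfolding btw_def D_def by simp
  obtain \<sigma> where \<sigma>0: "geodesic_segment T d \<sigma> m z" using geodesic mT assms by blast
  define a where "a = D - t"
  define h where "h = (\<lambda>s. if s \<le> a then \<gamma> (D - s) else \<sigma> (s - a))"
  have a0: "0 \<le> a" "a \<le> D" unfolding a_def using t by auto
  have \<sigma>T: "\<sigma> s \<in> T" if "s \<in> {0..d m z}" for s using geodesic_segmentD(3)[OF \<sigma>0] that by simp
  have \<sigma>x: "btw d x (\<sigma> s) z" if "s \<in> {0..d m z}" for s
  proof -
    have "d m (\<sigma> s) = s" "d (\<sigma> s) z = d m z - s" using geodesic_segmentD(5,6)[OF \<sigma>0] that by simp_all
    then show ?thesis using m triangle[OF assms(1) mT \<sigma>T[OF that]] triangle[OF assms(1) \<sigma>T[OF that] assms(3)]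
      unfolding btw_def by linarith
  qed
  have \<gamma>nb: "\<not> btw d x (\<gamma> s) z" if "s \<in> {0..D}" "t < s" for s
    using t(3)[of s] that unfolding F_def btw_def by auto
  define l where "l = a + d m z"
  have hL: "d (h r) (h s) \<le> \<bar>r - s\<bar>" if "r \<in> {0..l}" "s \<in> {0..l}" for r s
  proof -
    have mix: "d (\<gamma> (D - r)) (\<sigma> (s - a)) \<le> s - r" if "0 \<le> r" "r \<le> a" "a \<le> s" "s \<le> l" for r s
    proof -
      have "d (\<gamma> (D - r)) m = a - r" unfolding m_def using \<gamma>d[of "D - r" t] that t a_def by auto
      moreover have "d m (\<sigma> (s - a)) = s - a" using geodesic_segmentD(5)[OF \<sigma>0, of "s - a"] that l_def by simp
      ultimately show ?thesis using triangle[of "\<gamma> (D-r)" m "\<sigma> (s-a)"] \<gamma>T[of "D - r"] \<sigma>T[of "s - a"] mT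
        that a0 l_def by auto
    qed
    consider "r \<le> a" "s \<le> a" | "r \<le> a" "\<not> s \<le> a" | "\<not> r \<le> a" "s \<le> a" | "\<not> r \<le> a" "\<not> s \<le> a" by blast
    then show ?thesis
    proof cases
      case 1 then show ?thesis using \<gamma>d[of "D - r" "D - s"] that a0 unfolding h_def by auto
    next
      case 2 then show ?thesis using mix[of r s] that unfolding h_def by auto
    next
      case 3 then show ?thesis using mix[of s r] that unfolding h_def by (auto simp: commute)
    next
      case 4 then show ?thesis using geodesic_segmentD(4)[OF \<sigma>0, of "r - a" "s - a"] that l_def unfolding h_def by simp
    qed
  qed
  \<comment> \<open>The two legs cannot meet beyond the junction: before \<open>a\<close> the path
    is off \<open>[x, z]\<close> by maximality of \<open>t\<close>, after it the path stays on
    \<open>[x, z]\<close>.\<close>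
  have hinj: "inj_on h {0..l}"
  proof (rule linorder_inj_onI')
    fix r s assume rs: "r \<in> {0..l}" "s \<in> {0..l}" "r < s"
    consider "s \<le> a" | "r < a" "\<not> s \<le> a" | "\<not> r < a" "\<not> s \<le> a" by linarith
    then show "h r \<noteq> h s"
    proof cases
      case 1
      then have "d (h r) (h s) = s - r" using \<gamma>d[of "D - r" "D - s"] rs a0 unfolding h_def by auto
      then show ?thesis using rs \<gamma>T[of "D - s"] 1 a0 unfolding h_def by (auto split: if_splits)
    next
      case 2
      have "\<not> btw d x (h r) z" using \<gamma>nb[of "D - r"] 2 rs a0 unfolding h_def a_def by auto
      moreover have "btw d x (h s) z" using \<sigma>x[of "s - a"] 2 rs unfolding h_def l_def by auto
      ultimately show ?thesis by metis
    next
      case 3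
      have "h r = \<sigma> (r - a)" using 3 geodesic_segmentD(1)[OF \<sigma>0] unfolding h_def m_def a_def by (cases "r = D - t") simp_all
      then have "d (h r) (h s) = s - r" using geodesic_segmentD(4)[OF \<sigma>0, of "r - a" "s - a"] 3 rs unfolding h_def l_def by simp
      then show ?thesis using rs \<sigma>T[of "s - a"] 3 unfolding h_def l_def by auto
    qed
  qed
  have hT: "h ` {0..l} \<subseteq> T" using \<gamma>T \<sigma>T a0 unfolding h_def l_def by auto
  have h0: "h 0 = y" unfolding h_def using a0 \<gamma>y by simp
  have hl: "h l = z"
  proof (cases "m = z")
    case True
    have "d m z = 0" unfolding True using assms by simp
    moreover have "\<gamma> t = z" using True m_def by simp
    ultimately show ?thesis by (simp add: a_def h_def l_def)
  next
    case False
    then have "0 < d m z" using mT assms by simp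
    then show ?thesis using geodesic_segmentD(2)[OF \<sigma>0] by (simp add: h_def l_def)
  qed
  have ha: "h a = m" "a \<in> {0..l}" unfolding h_def l_def m_def a_def using a0 a_def by auto
  have l: "l > 0" using h0 hl yz a0 nonneg[of m z] unfolding l_def by (metis add.right_neutral add_nonneg_nonneg order_less_le)
  have arc: "arc_between T d (h ` {0..l}) y z"
    using arc_between_of_Lipschitz[OF l hT hL hinj] h0 hl by simp
  obtain \<rho> where \<rho>: "geodesic_segment T d \<rho> y z" using geodesic assms by blast
  have "h ` {0..l} = \<rho> ` {0..d y z}"
    using unique_arc[OF assms(2,3) yz] arc arc_between_geodesic[OF \<rho> assms(2,3) yz] by blast
  then obtain u where u: "u \<in> {0..d y z}" "m = \<rho> u" using ha by (metis imageE imageI)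
  have "d y m = u" "d m z = d y z - u" using u geodesic_segmentD(5,6)[OF \<rho>] by simp_all
  then have "btw d y m z" unfolding btw_def by simp
  then show ?thesis using m mxy mT by blast
qed

text \<open>The branch points \<open>m\<close> and \<open>n\<close> towards \<open>z\<close> and
  \<open>w\<close> both lie on \<open>[x, y]\<close>. The path from \<open>z\<close> through
  \<open>m\<close> and \<open>n\<close> to \<open>w\<close> bounds \<open>d z w\<close>, and the
  order of \<open>m\<close> and \<open>n\<close> decides which of the two sums on the right is
  reached.\<close>

theorem geodesic_four_point: "geodesic_four_point T d"
proof
  fix x y assume xy: "x \<in> T" "y \<in> T"
  fix t assume t: "0 \<le> t" "t \<le> d x y"
  obtain \<rho> where \<rho>: "geodesic_segment T d \<rho> x y" using geodesic xy by blast
  then have "d x (\<rho> t) = t" "d (\<rho> t) y = d x y - t" "\<rho> t \<in> T" using t geodesic_segmentD(3,5,6)[OF \<rho>] by simp_all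
  then show "\<exists>p\<in>T. d x p = t \<and> d p y = d x y - t" by blast
next
  fix x y z w assume T: "x \<in> T" "y \<in> T" "z \<in> T" "w \<in> T"
  obtain m where m: "m \<in> T" "btw d x m y" "btw d y m z" "btw d x m z" using exists_median T by blast
  obtain n where n: "n \<in> T" "btw d x n y" "btw d y n w" "btw d x n w" using exists_median T by blast
  have "d m n = \<bar>d x m - d x n\<bar>" using btw_same_geodesic m n T by blast
  moreover have "d z w \<le> d z m + d m n + d n w" using triangle[of z m w] triangle[of m n w] T m n by simp
  ultimately show "d x y + d z w \<le> max (d x z + d y w) (d x w + d y z)"
    using m n unfolding btw_def by (smt (verit) commute)
qed

end

context geodesic_four_point
begin

text \<open>Every point strictly inside the segment is a cut point that separates \<open>x\<close>
  from \<open>y\<close>, so the connected set \<open>A\<close> contains it. Conversely, the inverse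
  of the arc's parametrisation, restricted to the segment, is continuous and takes the values 0 and
  1, hence all values between, so \<open>A\<close> has no further points.\<close>

lemma arc_between_eq:
  assumes arc: "arc_between T d A x y" and T: "x \<in> T" "y \<in> T"
  shows "A = {p \<in> T. btw d x p y}"
proof -
  obtain \<sigma> where \<sigma>: "embedding_map (top_of_set {0..1::real}) mtopology \<sigma>" "\<sigma> 0 = x" "\<sigma> 1 = y" "A = \<sigma> ` {0..1}"
    using arc unfolding arc_between_def by blast
  then have hom: "homeomorphic_map (top_of_set {0..1}) (subtopology mtopology A) \<sigma>"
    unfolding embedding_map_def by simp
  then have cont: "continuous_map (top_of_set {0..1}) mtopology \<sigma>"
    using homeomorphic_imp_continuous_map continuous_map_in_subtopology by blast
  have "\<sigma> \<in> topspace (top_of_set {0..1}) \<rightarrow> topspace mtopology" using cont by (rule continuous_map_funspace)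
  then have AT: "A \<subseteq> T" using \<sigma>(4) by auto
  have conn: "connectedin mtopology A" unfolding \<sigma>(4)
    by (rule connectedin_continuous_map_image[OF cont]) (auto simp: connectedin_subtopology)
  have xyA: "x \<in> A" "y \<in> A" using \<sigma> by auto
  have sub: "{p \<in> T. btw d x p y} \<subseteq> A"
  proof
    fix p assume p: "p \<in> {p \<in> T. btw d x p y}"
    show "p \<in> A"
    proof (rule ccontr)
      assume pA: "p \<notin> A"
      define U where "U = {z \<in> T. z \<noteq> p \<and> \<not> btw d x p z}"
      define V where "V = {z \<in> T. z \<noteq> p \<and> btw d x p z}"
      \<comment> \<open>A ball around \<open>z\<close> too small to reach \<open>p\<close> stays in
        the direction of \<open>z\<close> seen from \<open>p\<close>; this makes both sides
        open.\<close>
      have near: "w \<in> T \<and> w \<noteq> p \<and> (btw d x p w \<longleftrightarrow> btw d x p z)" if z: "z \<in> T" "z \<noteq> p" and w: "w \<in> mball z (d z p)" for z w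
      proof -
        have wT: "w \<in> T" "d z w < d z p" using w by auto
        have "\<not> btw d z p w" using wT nonneg[of p w] unfolding btw_def by linarith
        moreover have "\<not> btw d w p z" using calculation btw_sym by blast
        ultimately show ?thesis using btw_dir[of z p x w] btw_dir[of w p x z] wT z p T btw_sym by blast
      qed
      have "openin mtopology U"
        unfolding openin_mtopology
      proof (intro conjI allI impI)
        show "U \<subseteq> T" unfolding U_def by blast
        fix z assume z: "z \<in> U"
        then have zT: "z \<in> T" "z \<noteq> p" unfolding U_def by blast+
        have "mball z (d z p) \<subseteq> U" using near[OF zT] z unfolding U_def by blast
        moreover have "0 < d z p" using zT p by simp
        ultimately show "\<exists>r>0. mball z r \<subseteq> U" by blast
      qed
      moreover have "openin mtopology V"
        unfolding openin_mtopology
      proof (intro conjI allI impI)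
        show "V \<subseteq> T" unfolding V_def by blast
        fix z assume z: "z \<in> V"
        then have zT: "z \<in> T" "z \<noteq> p" unfolding V_def by blast+
        have "mball z (d z p) \<subseteq> V" using near[OF zT] z unfolding V_def by blast
        moreover have "0 < d z p" using zT p by simp
        ultimately show "\<exists>r>0. mball z r \<subseteq> V" by blast
      qed
      moreover have "A \<subseteq> U \<union> V" using pA AT unfolding U_def V_def by blast
      moreover have "U \<inter> V \<inter> A = {}" unfolding U_def V_def by blast
      moreover have "x \<in> U"
      proof -
        have "x \<noteq> p" using pA xyA by blast
        then have "0 < d x p" using p T by simp
        then have "\<not> btw d x p x" using T nonneg[of p x] mdist_zero[OF T(1)] unfolding btw_def by linarith
        then show ?thesis using \<open>x \<noteq> p\<close> T unfolding U_def by blast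
      qed
      moreover have "y \<in> V" using p pA xyA T unfolding V_def by blast
      ultimately show False using conn xyA unfolding connectedin by blast
    qed
  qed
  obtain \<gamma> where \<gamma>: "geodesic_segment T d \<gamma> x y" "\<gamma> ` {0..d x y} = {p \<in> T. btw d x p y}"
    using geodesic_param[OF T] by metis
  obtain g where g: "homeomorphic_maps (top_of_set {0..1}) (subtopology mtopology A) \<sigma> g"
    using hom unfolding homeomorphic_map_maps by blast
  have "continuous_map (top_of_set {0..d x y}) mtopology \<gamma>"
    using \<gamma>(1) unfolding geodesic_segment_def by (intro Lipschitz_path_continuous[where L=1]) auto
  then have "continuous_map (top_of_set {0..d x y}) (subtopology mtopology A) \<gamma>"
    by (rule continuous_map_into_subtopology) (use \<gamma>(2) sub in \<open>simp add: image_subset_iff_funcset[symmetric]\<close>)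
  moreover have "continuous_map (subtopology mtopology A) (top_of_set {0..1}) g"
    using g unfolding homeomorphic_maps_def by (elim conjE)
  ultimately have "continuous_map (top_of_set {0..d x y}) (top_of_set {0..1}) (g \<circ> \<gamma>)"
    by (rule continuous_map_compose)
  then have "continuous_map (top_of_set {0..d x y}) euclideanreal (g \<circ> \<gamma>)"
    by (simp add: continuous_map_in_subtopology)
  then have gc: "continuous_on {0..d x y} (g \<circ> \<gamma>)"
    by (simp add: continuous_map_iff_continuous)
  have gs: "g (\<sigma> t) = t" if "t \<in> {0..1}" for t using g that unfolding homeomorphic_maps_def by simp
  have sg: "\<sigma> (g p) = p" if "p \<in> A" for p using g that AT unfolding homeomorphic_maps_def by auto
  have "A \<subseteq> {p \<in> T. btw d x p y}"
  proof
    fix q assume "q \<in> A"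
    then obtain t where t: "t \<in> {0..1}" "q = \<sigma> t" using \<sigma>(4) by blast
    have "(g \<circ> \<gamma>) 0 = 0" "(g \<circ> \<gamma>) (d x y) = 1"
      using gs[of 0] gs[of 1] \<sigma> \<gamma>(1) unfolding geodesic_segment_def by auto
    then obtain s where s: "s \<in> {0..d x y}" "(g \<circ> \<gamma>) s = t"
      using IVT'[of "g \<circ> \<gamma>" 0 t "d x y"] gc t by auto
    have "\<gamma> s \<in> A" using s(1) sub \<gamma>(2) by blast
    then have "\<gamma> s = q" using sg[of "\<gamma> s"] t s(2) by simp
    then show "q \<in> {p \<in> T. btw d x p y}" using \<gamma>(2) s by blast
  qed
  then show ?thesis using sub by blast
qed

lemma arc_between_btw:
  assumes "x \<in> T" "y \<in> T" "x \<noteq> y"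
  shows "arc_between T d {p \<in> T. btw d x p y} x y"
  using geodesic_param[OF assms(1,2)] arc_between_geodesic assms by metis

theorem real_treeI:
  assumes "T \<noteq> {}" shows "real_tree T d"
proof
  show "\<exists>\<gamma>. geodesic_segment T d \<gamma> x y" if "x \<in> T" "y \<in> T" for x y using geodesic_param that by metis
  show "\<exists>!A. arc_between T d A x y" if "x \<in> T" "y \<in> T" "x \<noteq> y" for x y
    using arc_between_btw arc_between_eq that by blast
qed fact

end

section \<open>Isometric actions on trees\<close>

text \<open>Only the pointwise laws of an action are kept; a \<open>group_action\<close> is a
  homomorphism into bijections that are extensional on the space.\<close>

locale tree_action = geodesic_four_point T d + group G
  for G :: "('g, 'm) monoid_scheme" (structure) and T :: "'a set"
    and d :: "'a \<Rightarrow> 'a \<Rightarrow> real" and \<phi> :: "'g \<Rightarrow> 'a \<Rightarrow> 'a" +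
  assumes act_closed [simp]: "\<lbrakk>g \<in> carrier G; x \<in> T\<rbrakk> \<Longrightarrow> \<phi> g x \<in> T"
    and act_mult: "\<lbrakk>g \<in> carrier G; h \<in> carrier G; x \<in> T\<rbrakk> \<Longrightarrow> \<phi> (g \<otimes> h) x = \<phi> g (\<phi> h x)"
    and act_one [simp]: "x \<in> T \<Longrightarrow> \<phi> \<one> x = x"
    and act_isometry [simp]: "\<lbrakk>g \<in> carrier G; x \<in> T; y \<in> T\<rbrakk> \<Longrightarrow> d (\<phi> g x) (\<phi> g y) = d x y"
    and T_nonempty: "T \<noteq> {}"

lemma (in real_tree_action) tree_action: "tree_action G T d \<phi>"
proof -
  interpret gf: geodesic_four_point T d by (rule geodesic_four_point)
  interpret group G using group_hom unfolding group_hom_def by blast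
  show ?thesis
  proof
    show "\<phi> g x \<in> T" if "g \<in> carrier G" "x \<in> T" for g x using element_image that by blast
    show "\<phi> (g \<otimes> h) x = \<phi> g (\<phi> h x)" if "g \<in> carrier G" "h \<in> carrier G" "x \<in> T" for g h x
      using composition_rule that by blast
    show "\<phi> \<one> x = x" if "x \<in> T" for x using id_eq_one that by (metis restrict_apply')
    show "d (\<phi> g x) (\<phi> g y) = d x y" if "g \<in> carrier G" "x \<in> T" "y \<in> T" for g x y
      using isometric that by blast
    show "T \<noteq> {}" by (rule nonempty)
  qed
qed

context tree_action
begin

lemma act_inv [simp]:
  assumes "g \<in> carrier G" "x \<in> T"
  shows "\<phi> (inv g) (\<phi> g x) = x" "\<phi> g (\<phi> (inv g) x) = x"
  using act_mult[of "inv g" g x] act_mult[of g "inv g" x] assms by simp_all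

lemma act_btw [simp]:
  assumes "g \<in> carrier G" "x \<in> T" "p \<in> T" "y \<in> T"
  shows "btw d (\<phi> g x) (\<phi> g p) (\<phi> g y) \<longleftrightarrow> btw d x p y"
  using assms unfolding btw_def by simp

lemma act_eq_iff [simp]:
  assumes "g \<in> carrier G" "x \<in> T" "y \<in> T"
  shows "\<phi> g x = \<phi> g y \<longleftrightarrow> x = y"
  using assms act_inv(1) by metis

lemma act_dist_inv:
  assumes "g \<in> carrier G" "x \<in> T" "y \<in> T"
  shows "d (\<phi> (inv g) x) y = d x (\<phi> g y)"
  using act_isometry[of g "\<phi> (inv g) x" y] assms by simp

lemma act_btw_inv:
  assumes "g \<in> carrier G" "x \<in> T" "p \<in> T" "y \<in> T"
  shows "btw d (\<phi> (inv g) x) p y \<longleftrightarrow> btw d x (\<phi> g p) (\<phi> g y)"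
  using act_btw[of g "\<phi> (inv g) x" p y] assms by simp

lemma act_pow_Suc:
  assumes "g \<in> carrier G" "x \<in> T"
  shows "\<phi> (g [^] Suc n) x = \<phi> g (\<phi> (g [^] n) x)" "\<phi> (g [^] Suc n) x = \<phi> (g [^] n) (\<phi> g x)"
  using act_mult[of g "g [^] n" x] act_mult[of "g [^] n" g x] assms nat_pow_Suc2[of g n] by simp_all

abbreviation len where "len \<equiv> tree_length T d \<phi>"

lemma tree_length_eqI:
  assumes "x \<in> T" "d x (\<phi> g x) = r" "\<And>z. z \<in> T \<Longrightarrow> r \<le> d z (\<phi> g z)"
  shows "len g = r"
  unfolding tree_length_def by (rule Least_equality) (use assms in auto)

text \<open>The orbit of a point with \<open>g x \<in> [x, g\<^sup>2 x]\<close> is a local, hence a global geodesic,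
  so that its displacement is \<open>lim d z (g\<^sup>n z) / n\<close> for every \<open>z\<close>.\<close>

lemma dist_pow:
  fixes n :: nat
  assumes g: "g \<in> carrier G" and x: "x \<in> T" and b: "btw d x (\<phi> g x) (\<phi> g (\<phi> g x))"
  shows "d x (\<phi> (g [^] n) x) = n * d x (\<phi> g x) \<and>
    btw d x (\<phi> (g [^] n) x) (\<phi> (g [^] Suc n) x)"
proof (cases "\<phi> g x = x")
  case True
  then have "\<phi> (g [^] n) x = x" for n :: nat
  proof (induction n)
    case (Suc n)
    then show ?case using act_pow_Suc(1)[OF g x, of n] by simp
  qed (use x in simp)
  then show ?thesis using x True by simp
next
  case False
  show ?thesis
  proof (induction n)
    case 0 then show ?case using x g by simp
  next
    case (Suc n)
    let ?y = "\<phi> (g [^] n) x"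
    have y: "?y \<in> T" "g [^] n \<in> carrier G" using x g by auto
    have s: "\<phi> (g [^] Suc n) x = \<phi> (g [^] n) (\<phi> g x)"
      "\<phi> (g [^] Suc (Suc n)) x = \<phi> (g [^] n) (\<phi> g (\<phi> g x))"
      using act_pow_Suc(2)[OF g x, of n] act_pow_Suc(2)[OF g x, of "Suc n"] act_pow_Suc(2)[of g "\<phi> g x" n] g x
      by (simp_all del: nat_pow_Suc)
    have dd: "d ?y (\<phi> (g [^] Suc n) x) = d x (\<phi> g x)" unfolding s using y x g by simp
    have "btw d ?y (\<phi> (g [^] Suc n) x) (\<phi> (g [^] Suc (Suc n)) x)"
      unfolding s using b y x g by simp
    moreover have "?y \<noteq> \<phi> (g [^] Suc n) x" unfolding s using False x g y by simp
    ultimately have "btw d x (\<phi> (g [^] Suc n) x) (\<phi> (g [^] Suc (Suc n)) x)"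
      using btw_chain(2)[of x ?y] Suc x g y by (simp del: nat_pow_Suc)
    moreover have "d x (\<phi> (g [^] Suc n) x) = Suc n * d x (\<phi> g x)"
      using Suc dd unfolding btw_def by (simp add: algebra_simps del: nat_pow_Suc)
    ultimately show ?case by blast
  qed
qed

lemma displacement_min:
  assumes g: "g \<in> carrier G" and x: "x \<in> T" and z: "z \<in> T" and b: "btw d x (\<phi> g x) (\<phi> g (\<phi> g x))"
  shows "d x (\<phi> g x) \<le> d z (\<phi> g z)"
proof (rule ccontr)
  assume n: "\<not> ?thesis"
  have zn: "d z (\<phi> (g [^] n) z) \<le> n * d z (\<phi> g z)" for n :: nat
  proof (induction n)
    case (Suc n)
    have "d z (\<phi> (g [^] Suc n) z) \<le> d z (\<phi> g z) + d (\<phi> g z) (\<phi> (g [^] Suc n) z)"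
      using triangle z g by (simp del: nat_pow_Suc)
    also have "d (\<phi> g z) (\<phi> (g [^] Suc n) z) = d z (\<phi> (g [^] n) z)"
      using act_pow_Suc(1)[OF g z] z g by (simp del: nat_pow_Suc)
    finally show ?case using Suc by (simp add: algebra_simps del: nat_pow_Suc)
  qed (use z in simp)
  \<comment> \<open>The orbits of \<open>x\<close> and \<open>z\<close> stay within
    \<open>d x z\<close> of each other, while the gap between their growth rates is multiplied by
    \<open>n\<close>; it only has to outgrow \<open>2 * d x z\<close>.\<close>
  obtain n :: nat where "n * (d x (\<phi> g x) - d z (\<phi> g z)) > 2 * d x z"
    using n reals_Archimedean3[of "d x (\<phi> g x) - d z (\<phi> g z)"] by auto
  moreover have "d x (\<phi> (g [^] n) x) \<le> d x z + d z (\<phi> (g [^] n) z) + d (\<phi> (g [^] n) z) (\<phi> (g [^] n) x)"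
    using triangle[of x z "\<phi> (g [^] n) x"] triangle[of z "\<phi> (g [^] n) z" "\<phi> (g [^] n) x"] x z g by simp
  moreover have "d (\<phi> (g [^] n) z) (\<phi> (g [^] n) x) = d x z" using x z g by (simp add: commute)
  ultimately show False using dist_pow[OF g x b, of n] zn[of n] by (simp add: algebra_simps)
qed

lemma len_eq:
  assumes "g \<in> carrier G" "x \<in> T" "btw d x (\<phi> g x) (\<phi> g (\<phi> g x))"
  shows "len g = d x (\<phi> g x)"
  using tree_length_eqI[of x g] displacement_min assms by blast

text \<open>The midpoint of \<open>[x, g x]\<close> realises the translation length.\<close>

lemma exists_min_displacement:
  assumes g: "g \<in> carrier G"
  shows "\<exists>x\<in>T. btw d x (\<phi> g x) (\<phi> g (\<phi> g x))"
proof -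
  obtain x where x: "x \<in> T" using T_nonempty by blast
  define a where "a = d x (\<phi> g x)"
  have "0 \<le> a/2" "a/2 \<le> d x (\<phi> g x)" unfolding a_def by (simp_all add: field_simps)
  then obtain m where m: "m \<in> T" "d x m = a/2" "d m (\<phi> g x) = a/2"
    using geod[of x "\<phi> g x" "a/2"] x g unfolding a_def by auto
  let ?x1 = "\<phi> g x" let ?x2 = "\<phi> g (\<phi> g x)" let ?m1 = "\<phi> g m" let ?m2 = "\<phi> g (\<phi> g m)"
  have T: "?x1 \<in> T" "?x2 \<in> T" "?m1 \<in> T" "?m2 \<in> T" using x m g by auto
  have e: "d ?x1 ?x2 = a" "d ?x1 ?m1 = a/2" "d ?m1 ?x2 = a/2" "d ?m1 ?m2 = d m ?m1" "d ?x2 ?m2 = a/2"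
    using m x g T a_def by simp_all
  have b1: "btw d x m ?x1" "btw d ?x1 ?m1 ?x2" using m e a_def unfolding btw_def by auto
  show ?thesis
  proof (cases "?m1 = m")
    case True
    then show ?thesis using m by (intro bexI[of _ m]) auto
  next
    case False
    text \<open>\<open>g x\<close> lies in direction of \<open>m\<close> and \<open>g\<^sup>2 x\<close> in direction of \<open>g\<^sup>2 m\<close>, seen from \<open>g m\<close>.\<close>
    have "0 < d m ?m1" using False m T by simp
    then have 1: "\<not> btw d ?x1 ?m1 m" using m e(2) commute[of ?m1 m] commute[of ?x1 m] unfolding btw_def by linarith
    have "0 < d ?m1 ?m2" using False m T g by simp
    then have 2: "\<not> btw d ?x2 ?m1 ?m2" using m e commute[of ?x2 ?m1] unfolding btw_def by linarith
    have "btw d m ?m1 ?x2" using btw_dir[OF b1(2) 1] T m by blast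
    then have "btw d ?m2 ?m1 m" using btw_dir[of ?x2 ?m1 m ?m2] 2 T m btw_sym by blast
    then show ?thesis using m btw_sym by blast
  qed
qed

text \<open>The characteristic set of \<open>g\<close>: the axis if \<open>g\<close> is hyperbolic,
  the set of fixed points otherwise. Both kinds are handled together, and \<open>is_axis\<close> is
  needed only to read the definition of irreducibility.\<close>

definition min_set where "min_set g = {x \<in> T. d x (\<phi> g x) = len g}"

lemma min_setI:
  assumes "g \<in> carrier G" "x \<in> T" "btw d x (\<phi> g x) (\<phi> g (\<phi> g x))"
  shows "x \<in> min_set g"
  using len_eq assms unfolding min_set_def by simp

lemma len_le:
  assumes "g \<in> carrier G" "z \<in> T" shows "len g \<le> d z (\<phi> g z)"
  using exists_min_displacement[OF assms(1)] len_eq displacement_min assms by metis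

lemma len_nonneg: "g \<in> carrier G \<Longrightarrow> 0 \<le> len g"
  using exists_min_displacement[of g] len_eq nonneg by metis

lemma min_set_nonempty: "g \<in> carrier G \<Longrightarrow> min_set g \<noteq> {}"
  using exists_min_displacement min_setI by blast

lemma min_set_in: "x \<in> min_set g \<Longrightarrow> x \<in> T"
  unfolding min_set_def by simp

text \<open>The midpoint \<open>m\<close> of \<open>[x, g x]\<close> is moved by at most
  \<open>a/2 + a/2\<close> and at least \<open>a\<close>, so there is no fold at \<open>g x\<close>
  between \<open>m\<close> and \<open>g m\<close>. The overlaps with \<open>[x, g x]\<close> and
  with its image are nondegenerate, and the pieces chain up.\<close>

lemma min_set_btw:
  assumes g: "g \<in> carrier G" and "x \<in> min_set g"
  shows "btw d x (\<phi> g x) (\<phi> g (\<phi> g x))"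
proof -
  have x: "x \<in> T" "d x (\<phi> g x) = len g" using assms(2) unfolding min_set_def by auto
  define a where "a = len g"
  show ?thesis
  proof (cases "a = 0")
    case True
    then have "\<phi> g x = x" using x g a_def zero[of x "\<phi> g x"] by simp
    then show ?thesis using x by simp
  next
    case False
    then have a: "a > 0" using len_nonneg[OF g] a_def by simp
    obtain m where m: "m \<in> T" "d x m = a/2" "d m (\<phi> g x) = a/2"
      using geod[of x "\<phi> g x" "a/2"] x g a unfolding a_def by auto
    let ?x1 = "\<phi> g x" let ?x2 = "\<phi> g (\<phi> g x)" let ?m1 = "\<phi> g m"
    have T: "?x1 \<in> T" "?x2 \<in> T" "?m1 \<in> T" using x m g by auto
    have e: "d ?x1 ?x2 = a" "d ?x1 ?m1 = a/2" "d ?m1 ?x2 = a/2"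
      using m x g T a_def by simp_all
    have "d m ?m1 \<le> d m ?x1 + d ?x1 ?m1" using triangle m T by blast
    then have "d m ?m1 = a" using len_le[OF g m(1)] m e a_def by simp
    then have b: "btw d m ?x1 ?m1" using m e unfolding btw_def by simp
    have b1: "btw d x m ?x1" "btw d ?x1 ?m1 ?x2" using m e x a_def unfolding btw_def by auto
    have "m \<noteq> ?x1" "?x1 \<noteq> ?m1" using m e a T by auto
    then have "btw d x ?x1 ?m1" using btw_chain[OF b1(1) b] x m T by blast
    then show ?thesis using btw_chain(1)[OF _ b1(2)] x m T \<open>?x1 \<noteq> ?m1\<close> by blast
  qed
qed

lemma hyperbolic_iff:
  assumes "g \<in> carrier G"
  shows "hyperbolic T \<phi> g \<longleftrightarrow> 0 < len g"
proof
  assume h: "hyperbolic T \<phi> g"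
  obtain x where x: "x \<in> min_set g" using min_set_nonempty[OF assms] by blast
  then have "\<phi> g x \<noteq> x" using h min_set_in unfolding hyperbolic_def by blast
  then have "0 < d x (\<phi> g x)" using min_set_in[OF x] assms by simp
  then show "0 < len g" using x unfolding min_set_def by simp
next
  assume l: "0 < len g"
  show "hyperbolic T \<phi> g" unfolding hyperbolic_def
  proof
    fix x assume x: "x \<in> T"
    then have "0 < d x (\<phi> g x)" using len_le[OF assms x] l by linarith
    then show "\<phi> g x \<noteq> x" using x assms by force
  qed
qed

lemma min_set_act:
  assumes g: "g \<in> carrier G" and h: "h \<in> carrier G" and x: "x \<in> T"
  shows "\<phi> h x \<in> min_set (h \<otimes> g \<otimes> inv h) \<longleftrightarrow> x \<in> min_set g"
    and "len (h \<otimes> g \<otimes> inv h) = len g"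
proof -
  have k: "h \<otimes> g \<otimes> inv h \<in> carrier G" using g h by simp
  have e: "\<phi> (h \<otimes> g \<otimes> inv h) (\<phi> h z) = \<phi> h (\<phi> g z)" if "z \<in> T" for z
    using that g h by (simp add: act_mult)
  obtain z where z: "z \<in> min_set g" using min_set_nonempty[OF g] by blast
  have zT: "z \<in> T" using min_set_in z by blast
  have "len (h \<otimes> g \<otimes> inv h) = d (\<phi> h z) (\<phi> h (\<phi> g z))"
    using len_eq[OF k, of "\<phi> h z"] min_set_btw[OF g z] e zT g h by simp
  then show l: "len (h \<otimes> g \<otimes> inv h) = len g" using z zT g h unfolding min_set_def by simp
  show "\<phi> h x \<in> min_set (h \<otimes> g \<otimes> inv h) \<longleftrightarrow> x \<in> min_set g"
    unfolding min_set_def l using e[OF x] x g h by simp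
qed

lemma min_set_self:
  assumes "g \<in> carrier G" "x \<in> T"
  shows "\<phi> g x \<in> min_set g \<longleftrightarrow> x \<in> min_set g"
  using min_set_act(1)[of g g x] assms by (simp add: m_assoc)

lemma min_set_inv:
  assumes "g \<in> carrier G"
  shows "min_set (inv g) = min_set g" "len (inv g) = len g"
proof -
  have e: "d x (\<phi> (inv g) x) = d x (\<phi> g x)" if "x \<in> T" for x
    using act_dist_inv[of g x x] that assms by (simp add: commute)
  have "(\<lambda>x. d x (\<phi> (inv g) x)) ` T = (\<lambda>x. d x (\<phi> g x)) ` T" using e by auto
  then show l: "len (inv g) = len g" unfolding tree_length_def by simp
  show "min_set (inv g) = min_set g" unfolding min_set_def l using e by auto
qed

lemma min_set_pow_act:
  assumes "g \<in> carrier G" "x \<in> T"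
  shows "\<phi> (g [^] (n::nat)) x \<in> min_set g \<longleftrightarrow> x \<in> min_set g"
proof (induction n)
  case (Suc n)
  then show ?case using act_pow_Suc(1)[OF assms, of n] min_set_self[OF assms(1), of "\<phi> (g [^] n) x"] assms
    by (simp del: nat_pow_Suc)
qed (use assms in simp)

lemma min_set_btw_inv:
  assumes "g \<in> carrier G" "x \<in> min_set g"
  shows "btw d (\<phi> (inv g) x) x (\<phi> g x)"
  using act_btw_inv[of g x x "\<phi> g x"] min_set_btw[OF assms] min_set_in[OF assms(2)] assms by simp

end

section \<open>Axes\<close>

definition (in group) conjg where "conjg k g = k \<otimes> g \<otimes> inv k"

lemma (in group) conjg_closed [simp]: "\<lbrakk>k \<in> carrier G; g \<in> carrier G\<rbrakk> \<Longrightarrow> conjg k g \<in> carrier G"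
  unfolding conjg_def by simp

lemma (in group) conjg_mult:
  "\<lbrakk>k \<in> carrier G; h \<in> carrier G; g \<in> carrier G\<rbrakk> \<Longrightarrow> conjg (k \<otimes> h) g = conjg k (conjg h g)"
  unfolding conjg_def by (simp add: inv_mult_group m_assoc)

context tree_action
begin

text \<open>Seen from \<open>g p\<close>, the point \<open>p\<close> lies on the way to
  \<open>x\<close> or to \<open>y\<close>. That end is within its own distance to \<open>p\<close>
  plus \<open>len g\<close> of \<open>g p\<close>, which leaves at most \<open>len g\<close> for the
  stretch from \<open>g p\<close> to \<open>p\<close>.\<close>

lemma min_set_convex:
  assumes g: "g \<in> carrier G" and x: "x \<in> min_set g" and y: "y \<in> min_set g" and p: "p \<in> T" and b: "btw d x p y"
  shows "p \<in> min_set g"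
proof -
  have T: "x \<in> T" "y \<in> T" using x y min_set_in by auto
  have d: "d x (\<phi> g x) = len g" "d y (\<phi> g y) = len g" using x y unfolding min_set_def by auto
  have "btw d (\<phi> g p) p x \<or> btw d (\<phi> g p) p y" using btw_split[OF b] T p g by simp
  moreover have "d (\<phi> g p) x \<le> d x p + len g" "d (\<phi> g p) y \<le> d p y + len g"
    using triangle[of x "\<phi> g x" "\<phi> g p"] triangle[of y "\<phi> g y" "\<phi> g p"] T p g d by (auto simp: commute)
  ultimately have "d p (\<phi> g p) \<le> len g" unfolding btw_def by (auto simp: commute)
  then show ?thesis using len_le[OF g p] p unfolding min_set_def by simp
qed

text \<open>An axis has only the two directions of \<open>g m\<close> and \<open>g^-1 m\<close> at
  each of its points \<open>m\<close>, whereas a proper tripod needs three.\<close>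

lemma min_set_no_tripod:
  assumes g: "g \<in> carrier G" "0 < len g" and "p \<in> min_set g" "q \<in> min_set g" "r \<in> min_set g"
    and m: "m \<in> T" "btw d p m q" "btw d q m r" "btw d p m r"
  shows "m = p \<or> m = q \<or> m = r"
proof (rule ccontr)
  assume n: "\<not> ?thesis"
  have T: "p \<in> T" "q \<in> T" "r \<in> T" using assms min_set_in by auto
  have mg: "m \<in> min_set g" using min_set_convex[OF g(1)] assms by blast
  have gT: "\<phi> g m \<in> T" "\<phi> (inv g) m \<in> T" using m g by auto
  have ne: "\<phi> g m \<noteq> m" using mg g m zero[of m m] unfolding min_set_def by auto
  \<comment> \<open>If \<open>z\<close> lay in neither direction, the path from \<open>z\<close>
    through \<open>m\<close> and \<open>g m\<close> to \<open>g z\<close> would not fold and would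
    exceed \<open>len g\<close> by \<open>2 * d z m\<close>.\<close>
  have dir: "\<not> btw d z m (\<phi> g m) \<or> \<not> btw d z m (\<phi> (inv g) m)" if z: "z \<in> min_set g" "z \<noteq> m" for z
  proof (rule ccontr)
    assume "\<not> ?thesis"
    then have b: "btw d z m (\<phi> g m)" "btw d (\<phi> (inv g) m) m z" using btw_sym by blast+
    have zT: "z \<in> T" using z min_set_in by blast
    have "btw d m (\<phi> g m) (\<phi> g z)" using b(2) act_btw_inv[of g m m z] g m zT by simp
    then have "btw d z m (\<phi> g z)" "btw d z (\<phi> g m) (\<phi> g z)"
      using btw_chain[OF b(1)] ne zT gT m g by auto
    then have "d z (\<phi> g z) = 2 * d z m + d m (\<phi> g m)" using b(1) zT m g unfolding btw_def by (simp add: commute)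
    moreover have "d z (\<phi> g z) = len g" "d m (\<phi> g m) = len g" using z mg unfolding min_set_def by auto
    ultimately show False using z(2) zT m by simp
  qed
  have "btw d (\<phi> (inv g) m) m (\<phi> g m)" using min_set_btw_inv[OF g(1) mg] .
  have same: False if "\<not> btw d x m v" "\<not> btw d y m v" "btw d x m y" "x \<in> T" "y \<in> T" "v \<in> T" for x y v
    using btw_dir[of x m y v] that m btw_sym by blast
  show False
    using dir[OF assms(3)] dir[OF assms(4)] dir[OF assms(5)] n same[OF _ _ m(2)] same[OF _ _ m(3)] same[OF _ _ m(4)] T gT
    by metis
qed

text \<open>Projection to the characteristic set: \<open>b\<close> is the first point of that set on
  a segment from \<open>x\<close> to one of its points. The median of \<open>x\<close>,
  \<open>b\<close> and \<open>v\<close> is in the set by convexity and cannot come before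
  \<open>b\<close>, so it is \<open>b\<close>.\<close>

lemma min_set_proj:
  assumes g: "g \<in> carrier G" and x: "x \<in> T"
  shows "\<exists>b\<in>min_set g. \<forall>v\<in>min_set g. btw d x b v"
proof -
  obtain q where q: "q \<in> min_set g" using min_set_nonempty[OF g] by blast
  have qT: "q \<in> T" using q min_set_in by blast
  obtain \<gamma> where \<gamma>: "geodesic_segment T d \<gamma> x q" "\<gamma> ` {0..d x q} = {p \<in> T. btw d x p q}"
    using geodesic_param[OF x qT] by metis
  note \<gamma>' = geodesic_segmentD[OF \<gamma>(1)]
  define F where "F = (\<lambda>t. d (\<gamma> t) (\<phi> g (\<gamma> t)) - len g)"
  have FL: "\<bar>F s - F t\<bar> \<le> 2 * \<bar>s - t\<bar>" if st: "s \<in> {0..d x q}" "t \<in> {0..d x q}" for s t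
  proof -
    let ?a = "\<gamma> s" let ?b = "\<gamma> t"
    have ab: "?a \<in> T" "?b \<in> T" "d ?a ?b = \<bar>s - t\<bar>" using \<gamma>'(3,4) st by auto
    have "d ?a (\<phi> g ?a) \<le> d ?a ?b + (d ?b (\<phi> g ?b) + d (\<phi> g ?b) (\<phi> g ?a))"
      "d ?b (\<phi> g ?b) \<le> d ?b ?a + (d ?a (\<phi> g ?a) + d (\<phi> g ?a) (\<phi> g ?b))"
      using triangle[of ?a ?b "\<phi> g ?a"] triangle[of ?b "\<phi> g ?b" "\<phi> g ?a"]
       triangle[of ?b ?a "\<phi> g ?b"] triangle[of ?a "\<phi> g ?a" "\<phi> g ?b"] ab g by auto
    moreover have "d ?b ?a = d ?a ?b" "d (\<phi> g ?b) (\<phi> g ?a) = d ?a ?b" "d (\<phi> g ?a) (\<phi> g ?b) = d ?a ?b"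
      using ab g commute by auto
    ultimately show ?thesis unfolding F_def ab(3)[symmetric] abs_le_iff by linarith
  qed
  have "F (d x q) \<le> 0" using q \<gamma>'(2) unfolding F_def min_set_def by simp
  then obtain t where t: "t \<in> {0..d x q}" "F t \<le> 0" "\<And>s. s \<in> {0..d x q} \<Longrightarrow> F s \<le> 0 \<Longrightarrow> t \<le> s"
    using Lipschitz_sublevel_extrema(1)[where a=0 and b="d x q" and F=F and L=2, OF FL, of "d x q"] by auto
  have in_min: "\<gamma> s \<in> min_set g \<longleftrightarrow> F s \<le> 0" if "s \<in> {0..d x q}" for s
    using len_le[OF g] \<gamma>'(3)[OF that] unfolding F_def min_set_def by fastforce
  define b where "b = \<gamma> t"
  have b: "b \<in> min_set g" "b \<in> T" "d x b = t" unfolding b_def using in_min t \<gamma>'(3,5) by auto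
  have bq: "btw d x b q" using \<gamma>(2) t b_def by blast
  have "btw d x b v" if v: "v \<in> min_set g" for v
  proof -
    have vT: "v \<in> T" using v min_set_in by blast
    obtain m where m: "m \<in> T" "btw d x m b" "btw d b m v" "btw d x m v" using median[of x b v] x b vT by blast
    have "m \<in> min_set g" using min_set_convex[OF g b(1) v m(1,3)] .
    moreover have "btw d x m q" using btw_trans2(1)[OF bq m(2)] x qT b m by blast
    then obtain s where s: "s \<in> {0..d x q}" "m = \<gamma> s" using \<gamma>(2) m by blast
    ultimately have "t \<le> s" using t(3) in_min by blast
    moreover have "d x m = s" using \<gamma>'(5) s by blast
    ultimately have "d m b \<le> 0" using m(2) b(3) unfolding btw_def by simp
    then have "m = b" using m b nonneg[of m b] zero[of m b] by linarith
    then show ?thesis using m by simp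
  qed
  then show ?thesis using b by blast
qed

section \<open>Disjoint axes and how to produce them\<close>

definition disjoint_axes where "disjoint_axes g h \<longleftrightarrow> min_set g \<inter> min_set h = {}"

lemma disjoint_axes_sym: "disjoint_axes g h \<longleftrightarrow> disjoint_axes h g"
  unfolding disjoint_axes_def by blast

lemma min_set_conjg:
  assumes "g \<in> carrier G" "h \<in> carrier G"
  shows "min_set (conjg h g) = \<phi> h ` min_set g" "len (conjg h g) = len g"
proof -
  show "len (conjg h g) = len g" using min_set_act(2) T_nonempty assms unfolding conjg_def by blast
  show "min_set (conjg h g) = \<phi> h ` min_set g"
  proof (intro equalityI subsetI)
    fix y assume y: "y \<in> min_set (conjg h g)"
    then have yT: "y \<in> T" using min_set_in by blast
    then have "\<phi> (inv h) y \<in> min_set g"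
      using min_set_act(1)[of g h "\<phi> (inv h) y"] y assms unfolding conjg_def by simp
    then show "y \<in> \<phi> h ` min_set g" using act_inv(2)[of h y] yT assms by (metis imageI)
  next
    fix y assume "y \<in> \<phi> h ` min_set g"
    then show "y \<in> min_set (conjg h g)" using min_set_act(1)[of g h] min_set_in assms unfolding conjg_def by blast
  qed
qed

lemma disjoint_axes_conjg:
  assumes "g \<in> carrier G" "h \<in> carrier G" "k \<in> carrier G"
  shows "disjoint_axes (conjg k g) (conjg k h) \<longleftrightarrow> disjoint_axes g h"
proof -
  have "inj_on (\<phi> k) T" using act_eq_iff[of k] assms by (auto intro: inj_onI)
  then show ?thesis unfolding disjoint_axes_def using assms min_set_in
    by (metis (no_types, lifting) min_set_conjg(1) image_empty image_is_empty inj_on_image_Int subsetI)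
qed

lemma disjoint_axes_inv: "g \<in> carrier G \<Longrightarrow> disjoint_axes (inv g) h \<longleftrightarrow> disjoint_axes g h"
  unfolding disjoint_axes_def by (simp add: min_set_inv)

text \<open>\<open>y\<close> is the projection of an arbitrary \<open>p\<close> in the
  characteristic set of \<open>h\<close>, and \<open>z\<close> is the projection of \<open>y\<close>
  back. Since \<open>z\<close> lies on \<open>[y, p]\<close>, \<open>y\<close> is also the
  projection of \<open>z\<close>, so no distance between the two sets has to be minimised.\<close>

lemma bridge:
  assumes g: "g \<in> carrier G" and h: "h \<in> carrier G" and disjoint_axes: "disjoint_axes g h"
  obtains y z where "y \<in> min_set g" "z \<in> min_set h" "y \<noteq> z" "y \<in> T" "z \<in> T"
    "\<And>v. v \<in> min_set g \<Longrightarrow> btw d z y v" "\<And>v. v \<in> min_set h \<Longrightarrow> btw d y z v"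
proof -
  obtain p where p: "p \<in> min_set h" using min_set_nonempty[OF h] by blast
  have pT: "p \<in> T" using p min_set_in by blast
  obtain y where y: "y \<in> min_set g" "\<And>v. v \<in> min_set g \<Longrightarrow> btw d p y v"
    using min_set_proj[OF g pT] by blast
  have yT: "y \<in> T" using y min_set_in by blast
  obtain z where z: "z \<in> min_set h" "\<And>v. v \<in> min_set h \<Longrightarrow> btw d y z v"
    using min_set_proj[OF h yT] by blast
  have zT: "z \<in> T" using z min_set_in by blast
  have "btw d z y v" if v: "v \<in> min_set g" for v
    using btw_trans2(2)[OF y(2)[OF v], of z] z(2)[OF p] pT yT zT v min_set_in btw_sym by blast
  moreover have "y \<noteq> z" using y z disjoint_axes unfolding disjoint_axes_def by blast
  ultimately show ?thesis using that y z yT zT by blast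
qed

text \<open>Every path between the two sets runs along the nondegenerate bridge, so the
  characteristic set of \<open>l\<close> projects to a single point.\<close>

lemma foot:
  assumes "l \<in> carrier G" "g \<in> carrier G" "disjoint_axes l g"
  obtains b where "b \<in> min_set g" "\<And>z v. z \<in> min_set l \<Longrightarrow> v \<in> min_set g \<Longrightarrow> btw d z b v"
proof -
  obtain y z where b: "y \<in> min_set g" "z \<in> min_set l" "y \<noteq> z" "y \<in> T" "z \<in> T"
    "\<And>v. v \<in> min_set g \<Longrightarrow> btw d z y v" "\<And>v. v \<in> min_set l \<Longrightarrow> btw d y z v"
    using bridge[of g l] assms disjoint_axes_sym by metis
  have "btw d w y v" if "w \<in> min_set l" "v \<in> min_set g" for w v
    using btw_chain(2)[of w z y v] b that min_set_in btw_sym by metis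
  then show ?thesis using that b by blast
qed

lemma dist_pow_min_set:
  fixes i j :: nat
  assumes g: "g \<in> carrier G" and c: "c \<in> min_set g"
  shows "d (\<phi> (g [^] i) c) (\<phi> (g [^] j) c) = \<bar>real i - real j\<bar> * len g"
proof -
  have cT: "c \<in> T" using c min_set_in by blast
  have *: "d (\<phi> (g [^] i) c) (\<phi> (g [^] j) c) = (real j - real i) * len g" if "i \<le> j" for i j :: nat
  proof -
    have "g [^] j = g [^] i \<otimes> g [^] (j - i)" using that g by (simp add: nat_pow_mult)
    then have "d (\<phi> (g [^] i) c) (\<phi> (g [^] j) c) = d c (\<phi> (g [^] (j - i)) c)"
      using g cT by (simp add: act_mult)
    then show ?thesis using dist_pow[OF g cT min_set_btw[OF g c], of "j - i"] c that
      unfolding min_set_def by (simp add: of_nat_diff)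
  qed
  show ?thesis using *[of i j] *[of j i] by (cases "i \<le> j") (auto simp: commute)
qed

text \<open>The axis of \<open>l\<close> hangs off the axis of \<open>g\<close> at a point \<open>b\<close>. If \<open>g\<^sup>n\<close> moves the axis of \<open>m\<close> onto
  a point of the axis of \<open>l\<close>, then some point of the axis of \<open>m\<close> projects to \<open>g\<^sup>-\<^sup>n b\<close>; three such
  points form a tripod.\<close>

lemma finite_not_disjoint_axes:
  assumes l: "l \<in> carrier G" and g: "g \<in> carrier G" "0 < len g" and m: "m \<in> carrier G" "0 < len m"
    and disjoint_axes: "disjoint_axes l g"
  shows "finite {n::nat. \<not> disjoint_axes l (conjg (g [^] n) m)}"
proof (rule ccontr)
  assume "infinite {n::nat. \<not> disjoint_axes l (conjg (g [^] n) m)}" (is "infinite ?S")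
  then obtain n1 n2 n3 where n: "n1 \<in> ?S" "n2 \<in> ?S" "n3 \<in> ?S" "n1 < n2" "n2 < n3"
    using infinite_nat_iff_unbounded by metis
  obtain b where b: "b \<in> min_set g" "\<And>z v. z \<in> min_set l \<Longrightarrow> v \<in> min_set g \<Longrightarrow> btw d z b v"
    using foot[OF l g(1) disjoint_axes] by blast
  have bT: "b \<in> T" using b min_set_in by blast
  define h where "h = inv g"
  have h: "h \<in> carrier G" "min_set h = min_set g" "len h = len g" using g min_set_inv unfolding h_def by auto
  define f where "f n = \<phi> (h [^] n) b" for n :: nat
  have f: "f n \<in> min_set g" "f n \<in> T" for n
    using min_set_pow_act[OF h(1) bT] b h bT unfolding f_def by auto
  have fd: "d (f i) (f j) = \<bar>real i - real j\<bar> * len g" for i j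
    unfolding f_def using dist_pow_min_set[OF h(1)] b h by simp
  have ex: "\<exists>w\<in>min_set m. (\<phi> (g [^] n) w \<in> min_set l) \<and> (\<forall>v\<in>min_set g. btw d w (f n) v)" if S: "n \<in> ?S" for n
  proof -
    have "\<not> disjoint_axes l (conjg (g [^] n) m)" using S by blast
    then obtain w where w: "w \<in> min_set m" "\<phi> (g [^] n) w \<in> min_set l"
      unfolding disjoint_axes_def using min_set_conjg(1)[of m "g [^] n"] m g by auto
    have wT: "w \<in> T" using w min_set_in by blast
    have fn: "\<phi> (g [^] n) (f n) = b" unfolding f_def h_def using g bT by (simp add: nat_pow_inv)
    have "btw d w (f n) v" if v: "v \<in> min_set g" for v
    proof -
      have vT: "v \<in> T" using v min_set_in by blast
      have "btw d (\<phi> (g [^] n) w) b (\<phi> (g [^] n) v)"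
        using b(2)[OF w(2)] v min_set_pow_act[OF g(1) vT] by blast
      then show ?thesis using act_btw[of "g [^] n" w "f n" v] g wT f vT unfolding fn[symmetric] by simp
    qed
    then show ?thesis using w by blast
  qed
  obtain w1 where w1: "w1 \<in> min_set m" "\<And>v. v \<in> min_set g \<Longrightarrow> btw d w1 (f n1) v" using ex[OF n(1)] by blast
  obtain w2 where w2: "w2 \<in> min_set m" "\<phi> (g [^] n2) w2 \<in> min_set l" "\<And>v. v \<in> min_set g \<Longrightarrow> btw d w2 (f n2) v"
    using ex[OF n(2)] by blast
  obtain w3 where w3: "w3 \<in> min_set m" "\<And>v. v \<in> min_set g \<Longrightarrow> btw d w3 (f n3) v" using ex[OF n(3)] by blast
  have wT: "w1 \<in> T" "w2 \<in> T" "w3 \<in> T" using w1 w2 w3 min_set_in by auto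
  have ne: "f n1 \<noteq> f n2" "f n3 \<noteq> f n2" "f n1 \<noteq> f n3"
    using fd[of n1 n2] fd[of n3 n2] fd[of n1 n3] n g f zero by fastforce+
  have b12: "btw d w1 (f n2) w2"
    using btw_chain(2)[OF w1(2)[OF f(1)[of n2]], of w2] w2(3)[OF f(1)[of n1]] ne wT f btw_sym by blast
  have b32: "btw d w2 (f n2) w3"
    using btw_chain(2)[OF w3(2)[OF f(1)[of n2]], of w2] w2(3)[OF f(1)[of n3]] ne wT f btw_sym by blast
  have "btw d (f n1) (f n2) (f n3)"
    unfolding btw_def fd using n by (simp add: algebra_simps)
  then have "btw d w1 (f n2) (f n3)"
    using btw_chain(2)[OF w1(2)[OF f(1)[of n2]], of "f n3"] ne wT f by blast
  then have b13: "btw d w1 (f n2) w3"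
    using btw_chain(1)[of w1 "f n2" "f n3" w3] w3(2)[OF f(1)[of n2]] ne wT f btw_sym by metis
  have "f n2 = w1 \<or> f n2 = w2 \<or> f n2 = w3"
    using min_set_no_tripod[OF m w1(1) w2(1) w3(1) f(2) b12 b32 b13] .
  \<comment> \<open>The tripod must not degenerate. At \<open>w2\<close> this would put
    \<open>b\<close> into the characteristic set of \<open>l\<close>; \<open>w1\<close> and
    \<open>w3\<close> project to points other than \<open>f n2\<close>.\<close>
  moreover have "f n2 \<noteq> w2"
  proof
    assume "f n2 = w2"
    then have "b \<in> min_set l" using w2(2) g bT unfolding f_def h_def by (auto simp: nat_pow_inv)
    then show False using b disjoint_axes unfolding disjoint_axes_def by blast
  qed
  moreover have "f n2 \<noteq> w1" using w1(2)[OF f(1)[of n2]] ne(1) f wT unfolding btw_def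
    by (metis add_nonneg_eq_0_iff commute nonneg mdist_zero zero)
  moreover have "f n2 \<noteq> w3" using w3(2)[OF f(1)[of n2]] ne(2) f wT unfolding btw_def
    by (metis add_nonneg_eq_0_iff commute nonneg mdist_zero zero)
  ultimately show False by blast
qed

text \<open>A point of the characteristic set off the line would span a proper tripod with two
  points far out on either side. \<open>R\<close> exceeds \<open>d x (\<gamma> 0)\<close>, so
  neither far point can be the median.\<close>

lemma is_axis_min_set:
  assumes g: "g \<in> carrier G" and A: "is_axis T d \<phi> g A"
  shows "min_set g \<subseteq> A"
proof
  fix x assume x: "x \<in> min_set g"
  then have xT: "x \<in> T" using min_set_in by blast
  obtain \<gamma> :: "real \<Rightarrow> 'a" and c where \<gamma>: "A = range \<gamma>" "A \<subseteq> T" "\<And>s t. d (\<gamma> s) (\<gamma> t) = \<bar>s - t\<bar>" "c \<noteq> 0"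
      "\<And>t. \<phi> g (\<gamma> t) = \<gamma> (t + c)" using A unfolding is_axis_def by metis
  have \<gamma>T: "\<gamma> t \<in> T" for t using \<gamma> by blast
  have b: "btw d (\<gamma> t) (\<phi> g (\<gamma> t)) (\<phi> g (\<phi> g (\<gamma> t)))" for t unfolding btw_def \<gamma>(3,5) by simp
  have \<gamma>m: "\<gamma> t \<in> min_set g" for t using min_setI[OF g \<gamma>T b] .
  have l: "0 < len g" using len_eq[OF g \<gamma>T b[of 0]] \<gamma> by simp
  define R where "R = d x (\<gamma> 0) + 1"
  have R: "0 < R" unfolding R_def using nonneg[of x "\<gamma> 0"] by linarith
  obtain m where m: "m \<in> T" "btw d x m (\<gamma> R)" "btw d (\<gamma> R) m (\<gamma> (-R))" "btw d x m (\<gamma> (-R))"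
    using median[OF xT \<gamma>T \<gamma>T] by blast
  have xR: "d x (\<gamma> R) \<le> 2 * R - 1" "d x (\<gamma> (-R)) \<le> 2 * R - 1" "d (\<gamma> R) (\<gamma> (-R)) = 2 * R"
    using triangle[OF xT \<gamma>T[of 0] \<gamma>T[of R]] triangle[OF xT \<gamma>T[of 0] \<gamma>T[of "-R"]] R_def R \<gamma>(3) by auto
  have "m \<noteq> \<gamma> R"
  proof
    assume "m = \<gamma> R"
    then have "d x (\<gamma> (-R)) = d x (\<gamma> R) + 2 * R" using m(4) xR(3) unfolding btw_def by simp
    then show False using xR nonneg[of x "\<gamma> R"] by linarith
  qed
  moreover have "m \<noteq> \<gamma> (-R)"
  proof
    assume "m = \<gamma> (-R)"
    then have "d x (\<gamma> R) = d x (\<gamma> (-R)) + 2 * R" using m(2) xR(3) commute[of "\<gamma> (-R)"] unfolding btw_def by simp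
    then show False using xR nonneg[of x "\<gamma> (-R)"] by linarith
  qed
  ultimately have "m = x" using min_set_no_tripod[OF g l x \<gamma>m \<gamma>m m] by blast
  then have xb: "btw d (\<gamma> R) x (\<gamma> (-R))" using m by simp
  define s where "s = R - d (\<gamma> R) x"
  have s: "\<bar>s\<bar> \<le> R" using xb xR(3) nonneg[of "\<gamma> R" x] nonneg[of x "\<gamma> (-R)"] unfolding s_def btw_def by linarith
  have "\<gamma> s = x"
  proof (rule btw_unique[of "\<gamma> R" _ "\<gamma> (-R)"])
    show "btw d (\<gamma> R) (\<gamma> s) (\<gamma> (-R))" using s unfolding btw_def \<gamma>(3) by auto
    show "d (\<gamma> R) (\<gamma> s) = d (\<gamma> R) x" using s nonneg[of "\<gamma> R" x] unfolding \<gamma>(3) s_def by auto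
  qed (use \<gamma>T xT xb in auto)
  then show "x \<in> A" using \<gamma>(1) by blast
qed

text \<open>A compact overlap of axes is bounded, so a power \<open>k\<close> of \<open>h\<close>
  that translates by more than its diameter moves the axis of \<open>g\<close> off itself. Otherwise
  \<open>w\<close> and \<open>k w\<close> would lie on the axis of \<open>g\<close> on either side
  of \<open>b\<close> and \<open>k b\<close>, and the overlap would contain both.\<close>

lemma irreducible_disjoint:
  assumes "irreducible_action G T d \<phi>"
  shows "\<exists>g\<in>carrier G. \<exists>h\<in>carrier G. 0 < len g \<and> 0 < len h \<and> disjoint_axes g h"
proof -
  obtain g h A B where gh: "g \<in> carrier G" "h \<in> carrier G" "hyperbolic T \<phi> g" "hyperbolic T \<phi> h"
     "is_axis T d \<phi> g A" "is_axis T d \<phi> h B" "compactin mtopology (A \<inter> B)"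
    using assms unfolding irreducible_action_def by blast
  have l: "0 < len g" "0 < len h" using gh hyperbolic_iff by auto
  obtain o' K where K: "A \<inter> B \<subseteq> mcball o' K" using compactin_imp_mbounded[OF gh(7)] unfolding mbounded_def by blast
  obtain N :: nat where N: "N * len h > 2 * \<bar>K\<bar> + 1" using reals_Archimedean3[OF l(2)] by blast
  define k where "k = h [^] N"
  have k: "k \<in> carrier G" unfolding k_def using gh by simp
  have "disjoint_axes g (conjg k g)"
  proof (rule ccontr)
    assume "\<not> ?thesis"
    then obtain w where w: "w \<in> min_set g" "\<phi> k w \<in> min_set g"
      unfolding disjoint_axes_def using min_set_conjg(1)[OF gh(1) k] by auto
    have wT: "w \<in> T" using w min_set_in by blast
    obtain b where b: "b \<in> min_set h" "\<And>v. v \<in> min_set h \<Longrightarrow> btw d w b v"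
      using min_set_proj[OF gh(2) wT] by blast
    have bT: "b \<in> T" using b min_set_in by blast
    let ?b = "\<phi> k b" let ?z = "\<phi> k w"
    have b': "?b \<in> min_set h" using min_set_pow_act[OF gh(2) bT] b k_def by blast
    have T: "?b \<in> T" "?z \<in> T" using bT wT k by auto
    \<comment> \<open>\<open>k\<close> commutes with \<open>h\<close>, so it maps the axis of
      \<open>h\<close> to itself and projections to projections.\<close>
    have "min_set h = \<phi> k ` min_set h"
    proof -
      have "conjg k h = h" unfolding k_def conjg_def using gh
        by (metis inv_solve_right' nat_pow_closed nat_pow_Suc nat_pow_Suc2 m_closed)
      then show ?thesis using min_set_conjg(1)[OF gh(2) k] by simp
    qed
    then obtain b0 where b0: "b0 \<in> min_set h" "b = \<phi> k b0" using b by blast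
    have "btw d ?z ?b b" using b(2)[OF b0(1)] b0 act_btw[OF k wT bT] min_set_in by blast
    then have bz: "btw d b ?b ?z" using btw_sym by blast
    have db: "d b ?b = N * len h" using dist_pow_min_set[OF gh(2) b(1), of 0 N] bT k_def by simp
    then have "b \<noteq> ?b" using N T bT mdist_zero[of b] by auto
    then have "btw d w b ?z" "btw d w ?b ?z" using btw_chain[OF b(2)[OF b'] bz] wT bT T by auto
    then have "b \<in> min_set g" "?b \<in> min_set g" using min_set_convex[OF gh(1) w] bT T by blast+
    then have "b \<in> A \<inter> B" "?b \<in> A \<inter> B" using is_axis_min_set gh b b' by blast+
    then have "d o' b \<le> K" "d o' ?b \<le> K" "o' \<in> T" using K by auto
    then have "d b ?b \<le> 2 * K" using triangle[of b o' ?b] bT T by (simp add: commute)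
    then show False using db N by linarith
  qed
  then show ?thesis using gh l min_set_conjg(2)[OF gh(1) k] k by (metis conjg_closed)
qed

text \<open>Two moves suffice: a power of \<open>g\<close> takes the axis of \<open>c\<close> off
  that of \<open>g'\<close>, and then a power of \<open>g'\<close> takes the result off itself.
  Undoing the first move leaves a conjugate of \<open>c\<close> next to \<open>c\<close>.\<close>

lemma exists_disjoint_conjugate:
  assumes "irreducible_action G T d \<phi>" and c: "c \<in> carrier G" "0 < len c"
  shows "\<exists>w\<in>carrier G. disjoint_axes c (conjg w c)"
proof -
  obtain g g' where g: "g \<in> carrier G" "g' \<in> carrier G" "0 < len g" "0 < len g'" "disjoint_axes g g'"
    using irreducible_disjoint assms by blast
  have "finite {n::nat. \<not> disjoint_axes g' (conjg (g [^] n) c)}" using finite_not_disjoint_axes g c disjoint_axes_sym by blast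
  then obtain n :: nat where n: "disjoint_axes g' (conjg (g [^] n) c)"
    using infinite_UNIV_nat by (metis (mono_tags, lifting) UNIV_eq_I mem_Collect_eq)
  let ?k = "g [^] n"
  let ?c = "conjg ?k c"
  have cc: "?c \<in> carrier G" "?k \<in> carrier G" "0 < len ?c" using g c min_set_conjg(2) by auto
  have "finite {n::nat. \<not> disjoint_axes ?c (conjg (g' [^] n) ?c)}" using finite_not_disjoint_axes g cc n disjoint_axes_sym by blast
  then obtain m :: nat where m: "disjoint_axes ?c (conjg (g' [^] m) ?c)"
    using infinite_UNIV_nat by (metis (mono_tags, lifting) UNIV_eq_I mem_Collect_eq)
  let ?w = "inv ?k \<otimes> (g' [^] m \<otimes> ?k)"
  have w: "?w \<in> carrier G" using g by simp
  have "conjg (g' [^] m) ?c = conjg ?k (conjg ?w c)"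
  proof -
    have "?k \<otimes> ?w = g' [^] m \<otimes> ?k" using g by (simp add: m_assoc[symmetric])
    then show ?thesis using g c w by (simp add: conjg_mult[symmetric])
  qed
  then have "disjoint_axes c (conjg ?w c)" using m disjoint_axes_conjg[of c "conjg ?w c" ?k] c w cc by simp
  then show ?thesis using w by blast
qed

section \<open>Translation lengths of products\<close>

lemma len_of_two_steps:
  assumes \<gamma>: "\<gamma> \<in> carrier G" and T: "x \<in> T" "y \<in> T"
    and b: "btw d x y (\<phi> \<gamma> x)" "btw d y (\<phi> \<gamma> x) (\<phi> \<gamma> y)" and ne: "x \<noteq> y" "y \<noteq> \<phi> \<gamma> x"
  shows "len \<gamma> = d x y + d y (\<phi> \<gamma> x)"
proof -
  let ?x1 = "\<phi> \<gamma> x" let ?y1 = "\<phi> \<gamma> y" let ?x2 = "\<phi> \<gamma> (\<phi> \<gamma> x)"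
  have T': "?x1 \<in> T" "?y1 \<in> T" "?x2 \<in> T" using T \<gamma> by auto
  \<comment> \<open>The path \<open>x\<close>, \<open>y\<close>, \<open>?x1\<close>,
    \<open>?y1\<close> does not fold and overlaps its translate in \<open>[?x1, ?y1]\<close>, so
    that \<open>x\<close> is on the axis of \<gamma>.\<close>
  have "btw d x ?x1 ?y1" using btw_chain(2)[OF b ne(2)] T T' by blast
  moreover have "btw d ?x1 ?y1 ?x2" using b(1) T T' \<gamma> by simp
  moreover have "?x1 \<noteq> ?y1" using ne T \<gamma> by simp
  ultimately have "btw d x ?x1 ?x2" using btw_chain(1) T T' by blast
  then have "len \<gamma> = d x ?x1" using len_eq[OF \<gamma> T(1)] by blast
  then show ?thesis using b(1) unfolding btw_def by simp
qed

text \<open>With a bridge from \<open>y\<close> to \<open>z\<close>, the path \<open>h^-1 z\<close>,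
  \<open>z\<close>, \<open>y\<close>, \<open>g y\<close>, \<open>g z\<close> does not fold, and
  \<open>g h\<close> maps its start to its end; so the length of the product is
  \<open>len g + len h\<close> plus twice the bridge. A common point of the characteristic sets
  gives the opposite inequality.\<close>

lemma len_mult_disjoint:
  assumes g: "g \<in> carrier G" "0 < len g" and h: "h \<in> carrier G" "0 < len h"
  shows "disjoint_axes g h \<longleftrightarrow> len g + len h < len (g \<otimes> h)"
proof
  assume disjoint_axes: "disjoint_axes g h"
  obtain y z where b: "y \<in> min_set g" "z \<in> min_set h" "y \<noteq> z" "y \<in> T" "z \<in> T"
    "\<And>v. v \<in> min_set g \<Longrightarrow> btw d z y v" "\<And>v. v \<in> min_set h \<Longrightarrow> btw d y z v"
    using bridge[OF g(1) h(1) disjoint_axes] by metis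
  let ?x = "\<phi> (inv h) z"
  let ?y1 = "\<phi> g y" let ?z1 = "\<phi> g z" let ?z2 = "\<phi> g (\<phi> h z)"
  have T: "?x \<in> T" "?y1 \<in> T" "?z1 \<in> T" "?z2 \<in> T" using b g h by auto
  have gx: "\<phi> (g \<otimes> h) ?x = ?z1" "\<phi> (g \<otimes> h) z = ?z2" using b g h by (auto simp: act_mult)
  have dyz: "d y ?y1 = len g" "d ?x z = len h"
    using b g h act_dist_inv[of h z z] unfolding min_set_def by auto
  have ne: "y \<noteq> ?y1" "?x \<noteq> z" using dyz g h b T zero[of y ?y1] zero[of ?x z] by auto
  have xm: "?x \<in> min_set h" using min_set_self[of "inv h" z] min_set_inv b h by simp
  have 1: "btw d ?x z y" using b(7)[OF xm] btw_sym by blast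
  have 2: "btw d z y ?y1" using b(6) min_set_self b g by blast
  have "btw d y (\<phi> (inv g) y) (\<phi> (inv g) y)" using b g by simp
  have "btw d z y (\<phi> (inv g) y)" using b(6) min_set_self[of "inv g" y] min_set_inv b g by simp
  then have "btw d (\<phi> (inv g) y) y z" using btw_sym by blast
  then have 3: "btw d y ?y1 ?z1" using act_btw_inv[of g y y z] b g by simp
  have "btw d y z (\<phi> h z)" using b(7) min_set_self b h by blast
  then have 4: "btw d ?y1 ?z1 ?z2" using act_btw[of g y z "\<phi> h z"] b g h by simp
  have y1z1: "?y1 \<noteq> ?z1" using b g by simp
  have c1: "btw d ?x y ?y1" using btw_chain(2)[OF 1 2] b T by blast
  have c2: "btw d ?x ?y1 ?z1" using btw_chain(2)[OF c1 3] b T ne by blast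
  have c3: "btw d ?x z ?y1" using btw_chain(1)[OF 1 2] b T by blast
  have c4: "btw d ?x z ?z1" using btw_trans1(1)[of ?x z ?z1 z] btw_trans2(1)[OF c2 c3] b T by blast
  have e1: "btw d z ?y1 ?z1" using btw_chain(2)[OF 2 3] b T ne by blast
  have e2: "btw d z ?z1 ?z2" using btw_chain(2)[OF e1 4] b T y1z1 by blast
  have dz: "d z ?z1 = 2 * d y z + len g"
    using e1 2 b g dyz unfolding btw_def by (simp add: commute)
  have "0 < d y z" using b by simp
  then have "0 < d z ?z1" using dz g by linarith
  then have "z \<noteq> ?z1" using mdist_pos_eq[of z ?z1] b T by blast
  then have "len (g \<otimes> h) = d ?x z + d z ?z1"
    using len_of_two_steps[of "g \<otimes> h" ?x z] g h b T gx c4 e2 ne by simp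
  then show "len g + len h < len (g \<otimes> h)" using dz dyz \<open>0 < d y z\<close> by simp
next
  assume l: "len g + len h < len (g \<otimes> h)"
  show "disjoint_axes g h" unfolding disjoint_axes_def
  proof (rule ccontr)
    assume "min_set g \<inter> min_set h \<noteq> {}"
    then obtain x where x: "x \<in> T" "d x (\<phi> g x) = len g" "d x (\<phi> h x) = len h" unfolding min_set_def by blast
    have "len (g \<otimes> h) \<le> d x (\<phi> (g \<otimes> h) x)" using len_le x g h by simp
    also have "\<dots> \<le> d x (\<phi> g x) + d (\<phi> g x) (\<phi> g (\<phi> h x))" using triangle[of x "\<phi> g x" "\<phi> g (\<phi> h x)"] x g h by (simp add: act_mult)
    also have "\<dots> = len g + len h" using x g h by simp
    finally show False using l by simp
  qed
qed

text \<open>Let \<open>x\<close> be the projection of the fixed point \<open>p\<close> to the axis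
  of \<open>g\<close>. If \<open>h\<close> moves \<open>x\<close>, then \<open>h x\<close> and
  \<open>h^-1 x\<close> leave the axis at \<open>x\<close> towards \<open>p\<close>, and the path
  \<open>h^-1 x\<close>, \<open>x\<close>, \<open>g^j x\<close> does not fold. If \<open>h\<close>
  fixes \<open>x\<close>, only a fold of the axis by \<open>h^i\<close> can interfere. One
  \<open>i\<close> serves all \<open>j\<close>, because \<open>j\<close> is chosen afterwards, in
  the other tree.\<close>

lemma hyperbolic_mult_elliptic:
  assumes g: "g \<in> carrier G" "0 < len g" and h: "h \<in> carrier G" and p: "p \<in> T" "\<phi> h p = p"
  shows "\<exists>i\<in>{1, 2::nat}. \<forall>j\<ge>1::nat. 0 < len (g [^] j \<otimes> h [^] i)"
proof -
  obtain x where x: "x \<in> min_set g" "\<And>v. v \<in> min_set g \<Longrightarrow> btw d p x v"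
    using min_set_proj[OF g(1) p(1)] by blast
  have xT: "x \<in> T" using x min_set_in by blast
  have gi: "inv g \<in> carrier G" "min_set (inv g) = min_set g" "len (inv g) = len g"
    using g min_set_inv by auto
  define u where "u j = \<phi> (g [^] j) x" for j :: nat
  define v where "v j = \<phi> (inv g [^] j) x" for j :: nat
  have u: "u j \<in> T" "u j \<in> min_set g" for j
    unfolding u_def using xT x g min_set_pow_act[OF g(1) xT] by auto
  have v: "v j \<in> T" "v j \<in> min_set g" for j
    unfolding v_def using xT x g gi min_set_pow_act[OF gi(1) xT] by auto
  have d_uu: "d (u i) (u j) = \<bar>real i - real j\<bar> * len g" for i j
    unfolding u_def using dist_pow_min_set[OF g(1) x(1)] .
  have d_vv: "d (v i) (v j) = \<bar>real i - real j\<bar> * len g" for i j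
    unfolding v_def using dist_pow_min_set[OF gi(1)] x gi by simp
  have u0: "u 0 = x" "v 0 = x" unfolding u_def v_def using xT by auto
  have du: "d x (u j) = j * len g" "d x (v j) = j * len g" for j
    using d_uu[of 0 j] d_vv[of 0 j] u0 by auto
  have shift: "btw d (v j) x z \<longleftrightarrow> btw d x (u j) (\<phi> (g [^] j) z)" if "z \<in> T" for j z
    unfolding u_def v_def using act_btw_inv[of "g [^] j" x x z] that g xT by (simp add: nat_pow_inv)
  show ?thesis
  proof (cases "\<phi> h x = x")
    case False
    have ne: "0 < d x (\<phi> h x)" using False xT h by simp
    have "d p (\<phi> h x) = d p x" using act_isometry[OF h p(1) xT] p(2) by simp
    then have nb: "\<not> btw d p x (\<phi> h x)" using ne unfolding btw_def by simp
    have hx: "btw d (\<phi> h x) x w" if "w \<in> min_set g" for w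
      using btw_dir[OF x(2)[OF that] nb] p xT h min_set_in[OF that] by simp
    have "d (\<phi> (inv h) x) p = d x p" using act_dist_inv[of h x p] p xT h by simp
    moreover have ne': "0 < d (\<phi> (inv h) x) x" using ne act_dist_inv[of h x x] xT h by simp
    ultimately have nb': "\<not> btw d p x (\<phi> (inv h) x)" unfolding btw_def by (simp add: commute)
    have hx': "btw d (\<phi> (inv h) x) x w" if "w \<in> min_set g" for w
      using btw_dir[OF x(2)[OF that] nb'] p xT h min_set_in[OF that] by simp
    have "0 < len (g [^] j \<otimes> h [^] (1::nat))" if "j \<ge> 1" for j :: nat
    proof -
      let ?x = "\<phi> (inv h) x"
      have e: "\<phi> (g [^] j \<otimes> h) ?x = u j" "\<phi> (g [^] j \<otimes> h) x = \<phi> (g [^] j) (\<phi> h x)"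
        unfolding u_def using g h xT by (auto simp: act_mult)
      have "0 < d x (u j)" using du that g by simp
      then have nu: "x \<noteq> u j" using xT u by simp
      have nx: "?x \<noteq> x" using ne' xT h by simp
      have 1: "btw d ?x x (\<phi> (g [^] j \<otimes> h) ?x)" using hx'[OF u(2)] e by simp
      have 2: "btw d x (\<phi> (g [^] j \<otimes> h) ?x) (\<phi> (g [^] j \<otimes> h) x)"
        unfolding e using shift[of "\<phi> h x" j] hx[OF v(2)] btw_sym xT h by auto
      have "len (g [^] j \<otimes> h) = d ?x x + d x (u j)"
        using len_of_two_steps[OF _ _ _ 1 2] g h xT nx nu e by simp
      then show ?thesis using ne' \<open>0 < d x (u j)\<close> h by simp
    qed
    then show ?thesis by blast
  next
    case hx: True
    text \<open>If \<open>g\<^sup>j h\<^sup>i\<close> is not hyperbolic, then \<open>h\<^sup>i\<close> maps the direction of \<open>g x\<close> at \<open>x\<close> to that of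
      \<open>g\<^sup>-\<^sup>1 x\<close>, which \<open>h\<close> and \<open>h\<^sup>2\<close> cannot both do.\<close>
    have fix2: "\<phi> (h [^] i) x = x" for i :: nat
    proof (induction i)
      case (Suc i) then show ?case using act_pow_Suc(1)[OF h xT, of i] hx by simp
    qed (use xT in simp)
    have nbtw: "\<not> btw d (v j) x (\<phi> (h [^] i) (u j))" if "j \<ge> 1" "\<not> 0 < len (g [^] j \<otimes> h [^] i)" for i j :: nat
    proof
      assume b: "btw d (v j) x (\<phi> (h [^] i) (u j))"
      let ?\<gamma> = "g [^] j \<otimes> h [^] i"
      have e: "\<phi> ?\<gamma> x = u j" "\<phi> ?\<gamma> (u j) = \<phi> (g [^] j) (\<phi> (h [^] i) (u j))"
        unfolding u_def using g h xT fix2 by (auto simp: act_mult)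
      have "btw d x (\<phi> ?\<gamma> x) (\<phi> ?\<gamma> (\<phi> ?\<gamma> x))" unfolding e using shift b u h by simp
      then have "len ?\<gamma> = j * len g" using len_eq[of ?\<gamma> x] e du g h xT by simp
      then show False using that g by simp
    qed
    have uu: "\<not> btw d (u i) x (u j)" "\<not> btw d (v i) x (v j)" if "i \<ge> 1" "j \<ge> 1" for i j
    proof -
      have "\<bar>real i - real j\<bar> < real i + real j" using that by simp
      then have "\<bar>real i - real j\<bar> * len g < (real i + real j) * len g" using g by simp
      then show "\<not> btw d (u i) x (u j)" "\<not> btw d (v i) x (v j)"
        unfolding btw_def d_uu d_vv using du[of i] du[of j] commute[of "u i" x] commute[of "v i" x]
        by (auto simp: algebra_simps)
    qed
    have tr: "\<not> btw d a' x c'" if "\<not> btw d a' x b'" "\<not> btw d b' x c'" "a' \<in> T" "b' \<in> T" "c' \<in> T" for a' b' c'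
      using btw_dir[of a' x c' b'] that xT by blast
    show ?thesis
    proof (rule ccontr)
      assume "\<not> ?thesis"
      then obtain j j' :: nat where j: "j \<ge> 1" "\<not> 0 < len (g [^] j \<otimes> h [^] (1::nat))"
          "j' \<ge> 1" "\<not> 0 < len (g [^] j' \<otimes> h [^] (2::nat))" by blast
      have key: "\<not> btw d (v 1) x (\<phi> (h [^] i) (u 1))" if "k \<ge> 1" "\<not> 0 < len (g [^] k \<otimes> h [^] i)" for i k :: nat
      proof -
        have "\<not> btw d (\<phi> (h [^] i) (u k)) x (\<phi> (h [^] i) (u 1))"
          using act_btw[of "h [^] i" "u k" x "u 1"] uu(1)[of k 1] that fix2 h u xT by simp
        then show ?thesis using tr[OF tr[OF uu(2)[of 1 k] nbtw[OF that]]] that u v h by simp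
      qed
      have 1: "\<not> btw d (v 1) x (\<phi> h (u 1))" using key[OF j(1,2)] h by simp
      have "\<not> btw d (v 1) x (\<phi> (h [^] (2::nat)) (u 1))" using key[OF j(3,4)] .
      moreover have "\<phi> (h [^] (2::nat)) (u 1) = \<phi> h (\<phi> h (u 1))"
        using act_pow_Suc(1)[OF h u(1), of 1 1] h by (simp add: numeral_2_eq_2)
      ultimately have 2: "\<not> btw d (v 1) x (\<phi> h (\<phi> h (u 1)))" by metis
      have w: "\<phi> h (u 1) \<in> T" "\<phi> h (\<phi> h (u 1)) \<in> T" using h u by auto
      \<comment> \<open>\<open>h\<close> and its square both send \<open>u 1\<close> into the
        direction of \<open>v 1\<close>. Cancelling one \<open>h\<close>, \<open>u 1\<close> and
        \<open>h (u 1)\<close> share a direction, so \<open>u 1\<close> and \<open>v 1\<close> would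
        too.\<close>
      have 3: "\<not> btw d (\<phi> h (u 1)) x (v 1)" using 1 btw_sym by blast
      have "\<not> btw d (\<phi> h (u 1)) x (\<phi> h (\<phi> h (u 1)))" using tr[OF 3 2 w(1) v(1) w(2)] .
      then have "\<not> btw d (u 1) x (\<phi> h (u 1))" using act_btw[OF h u(1) xT w(1), of 1] hx by simp
      then have 4: "\<not> btw d (\<phi> h (u 1)) x (u 1)" using btw_sym by blast
      have "\<not> btw d (v 1) x (u 1)" using tr[OF 1 4 v(1) w(1) u(1)] .
      then show False using min_set_btw_inv[OF g(1) x(1)] g unfolding u_def v_def by simp
    qed
  qed
qed

end

section \<open>Recovering distances from translation lengths\<close>

text \<open>All that is retained of the bridge: at \<open>y\<close>, the directions towards
  \<open>c y\<close> and \<open>c^-1 y\<close> differ from those towards \<open>a y\<close> and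
  \<open>a^-1 y\<close>. The axis of \<open>a\<close> is no longer mentioned, and one pair
  \<open>c\<close>, \<open>a\<close> can serve in three trees.\<close>

locale based_tree = tree_action G T d \<phi>
  for G :: "('g, 'm) monoid_scheme" (structure) and T :: "'a set"
    and d :: "'a \<Rightarrow> 'a \<Rightarrow> real" and \<phi> :: "'g \<Rightarrow> 'a \<Rightarrow> 'a" +
  fixes c a :: 'g and y :: 'a
  assumes c: "c \<in> carrier G" and a: "a \<in> carrier G" and y: "y \<in> T"
    and y_min: "y \<in> min_set c" and len_c: "0 < len c" and a_moves: "\<phi> a y \<noteq> y"
    and off_axis: "\<lbrakk>e \<in> {c, inv c}; f \<in> {a, inv a}\<rbrakk> \<Longrightarrow> btw d (\<phi> e y) y (\<phi> f y)"

text \<open>The path \<open>y\<close>, \<open>z\<close>, \<open>f z\<close>, \<open>f y\<close> does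
  not fold, so \<open>f y\<close> lies in the direction of the bridge at \<open>y\<close>, where the
  axis of \<open>c\<close> has no points.\<close>

lemma (in tree_action) exists_based_tree:
  assumes c: "c \<in> carrier G" "0 < len c" and a: "a \<in> carrier G" "0 < len a" and disjoint_axes: "disjoint_axes c a"
  shows "\<exists>y. based_tree G T d \<phi> c a y"
proof -
  obtain y z where b: "y \<in> min_set c" "z \<in> min_set a" "y \<noteq> z" "y \<in> T" "z \<in> T"
    "\<And>v. v \<in> min_set c \<Longrightarrow> btw d z y v" "\<And>v. v \<in> min_set a \<Longrightarrow> btw d y z v"
    using bridge[OF c(1) a(1) disjoint_axes] by metis
  have "based_tree G T d \<phi> c a y"
  proof unfold_locales
    show "\<phi> a y \<noteq> y"
    proof
      assume "\<phi> a y = y"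
      then have "d y (\<phi> a y) = 0" using b by simp
      then show False using len_le[OF a(1) b(4)] a(2) by simp
    qed
    show "btw d (\<phi> e y) y (\<phi> f y)" if e: "e \<in> {c, inv c}" and f: "f \<in> {a, inv a}" for e f
    proof -
      have eC: "e \<in> carrier G" "\<phi> e y \<in> min_set c"
        using e c b min_set_self[of c y] min_set_self[of "inv c" y] min_set_inv by auto
      have fC: "f \<in> carrier G" "\<phi> f z \<in> min_set a" "\<phi> (inv f) z \<in> min_set a"
        using f a b min_set_self[of a z] min_set_self[of "inv a" z] min_set_inv by auto
      have T: "\<phi> e y \<in> T" "\<phi> f y \<in> T" "\<phi> f z \<in> T" using b eC fC by auto
      have 1: "btw d y z (\<phi> f z)" using b fC by blast
      have "btw d (\<phi> (inv f) z) z y" using b(7)[OF fC(3)] btw_sym by blast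
      then have 2: "btw d z (\<phi> f z) (\<phi> f y)" using act_btw_inv[of f z z y] b fC by simp
      have zfz: "z \<noteq> \<phi> f z"
      proof
        assume "z = \<phi> f z"
        then have "d z (\<phi> f z) = 0" using b by simp
        moreover have "len f = len a" using f a min_set_inv by auto
        ultimately show False using len_le[OF fC(1) b(5)] a(2) by simp
      qed
      have "btw d y z (\<phi> f y)" using btw_chain(1)[OF 1 2 zfz] b T by blast
      then have "\<not> btw d z y (\<phi> f y)" using btw_antisym[of y z "\<phi> f y"] b T by blast
      then have "btw d (\<phi> f y) y (\<phi> e y)" using btw_dir[OF b(6)[OF eC(2)]] b T by blast
      then show ?thesis using btw_sym by blast
    qed
  qed (use assms b in auto)
  then show ?thesis by blast
qed

context based_tree
begin

text \<open>Neither \<open>w y\<close> nor \<open>w^-1 y\<close> lies in the direction of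
  \<open>a y\<close> or \<open>a^-1 y\<close> at \<open>y\<close>; these are the conditions that
  keep the path in \<open>generic_len\<close> from folding.\<close>

definition generic where
  "generic w \<longleftrightarrow> w \<in> carrier G \<and> \<phi> w y \<noteq> y \<and>
     (\<forall>f\<in>{a, inv a}. btw d (\<phi> w y) y (\<phi> f y) \<and> btw d (\<phi> (inv w) y) y (\<phi> f y))"

text \<open>The path \<open>w a^-1 y\<close>, \<open>w y\<close>, \<open>y\<close>,
  \<open>a y\<close>, \<open>a w y\<close> does not fold, and \<open>a w a w^-1\<close> maps its
  start to its end, so it is a fundamental domain of the axis. Two of its four pieces have length
  \<open>d y (a y)\<close>, the other two \<open>d y (w y)\<close>.\<close>

lemma generic_len:
  assumes "generic w"
  shows "len (a \<otimes> w \<otimes> a \<otimes> inv w) = 2 * d y (\<phi> w y) + 2 * d y (\<phi> a y)"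
proof -
  have w: "w \<in> carrier G" "\<phi> w y \<noteq> y" and
    b: "btw d (\<phi> w y) y (\<phi> a y)" "btw d (\<phi> w y) y (\<phi> (inv a) y)"
       "btw d (\<phi> (inv w) y) y (\<phi> a y)" "btw d (\<phi> (inv w) y) y (\<phi> (inv a) y)"
    using assms unfolding generic_def by auto
  let ?g = "a \<otimes> w \<otimes> a \<otimes> inv w"
  let ?p = "\<phi> w (\<phi> (inv a) y)" let ?q = "\<phi> w y" let ?gx = "\<phi> a (\<phi> w y)" let ?gy = "\<phi> a (\<phi> w (\<phi> a y))"
  have T: "?p \<in> T" "?q \<in> T" "?gx \<in> T" "?gy \<in> T" "\<phi> a y \<in> T" using w a y by auto
  have g: "?g \<in> carrier G" "\<phi> ?g ?p = ?gx" "\<phi> ?g ?q = ?gy" using w a y by (auto simp: act_mult)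
  have "btw d (\<phi> (inv a) y) y (\<phi> (inv w) y)" using b btw_sym by blast
  then have s1: "btw d ?p ?q y" using act_btw[of w "\<phi> (inv a) y" y "\<phi> (inv w) y"] w a y by simp
  have "btw d (\<phi> (inv a) y) y (\<phi> w y)" using b btw_sym by blast
  then have s2: "btw d y (\<phi> a y) ?gx" using act_btw[of a "\<phi> (inv a) y" y "\<phi> w y"] w a y by simp
  have s3: "btw d (\<phi> a y) ?gx ?gy"
    using act_btw[of "a \<otimes> w" "\<phi> (inv w) y" y "\<phi> a y"] b w a y by (simp add: act_mult)
  have ne: "y \<noteq> \<phi> a y" "?q \<noteq> y" "\<phi> a y \<noteq> ?gx" using a_moves w a y by auto
  have x01: "?p \<noteq> ?q" using a_moves w a y act_eq_iff[of a "\<phi> (inv a) y" y] by auto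
  have c1: "btw d ?p ?q (\<phi> a y)" "btw d ?p y (\<phi> a y)" using btw_chain[OF s1 b(1)] ne T y by auto
  have "btw d ?p (\<phi> a y) ?gx" using btw_chain(2)[OF c1(2) s2] ne T y by blast
  then have r1: "btw d ?p ?q ?gx" using btw_trans2(1)[OF _ c1(1)] T by blast
  have e1: "btw d ?q (\<phi> a y) ?gx" using btw_chain(2)[OF b(1) s2] ne T y by blast
  then have r2: "btw d ?q ?gx ?gy" using btw_chain(2)[OF _ s3] ne T y by blast
  have d1: "d ?q ?gx = 2 * d y (\<phi> w y) + d y (\<phi> a y)"
    using e1 b(1) w a y unfolding btw_def by (simp add: commute)
  have "0 < d y (\<phi> a y)" using ne(1) T y by simp
  then have "0 < d ?q ?gx" using d1 nonneg[of y "\<phi> w y"] by linarith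
  then have "?q \<noteq> ?gx" using mdist_pos_eq[of ?q ?gx] T by blast
  then have "len ?g = d ?p ?q + d ?q ?gx"
    using len_of_two_steps[of ?g ?p ?q] g T r1 r2 x01 by simp
  moreover have "d ?p ?q = d y (\<phi> a y)" using act_dist_inv[of a y y] w a y by simp
  ultimately show ?thesis using d1 by simp
qed

lemma axis_pow:
  assumes "e \<in> {c, inv c}"
  shows "e \<in> carrier G" "d (\<phi> (e [^] (i::nat)) y) (\<phi> (e [^] (j::nat)) y) = \<bar>real i - real j\<bar> * len c"
proof -
  have e: "min_set e = min_set c" "len e = len c" using assms min_set_inv c by auto
  show 1: "e \<in> carrier G" using assms c by auto
  show "d (\<phi> (e [^] i) y) (\<phi> (e [^] j) y) = \<bar>real i - real j\<bar> * len c"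
    using dist_pow_min_set[OF 1, of y] e y_min by simp
qed

text \<open>Up to the action, \<open>w y\<close> seen from \<open>y\<close> is \<open>r m\<close>
  seen from \<open>x n\<close>, and \<open>w^-1 y\<close> is \<open>x n\<close> seen from
  \<open>r m\<close>. By \<open>off_axis\<close>, it suffices that each lies in a direction of the
  axis of \<open>c\<close> or of its translate. From \<open>r m\<close> this holds once
  \<open>m\<close> is large compared with \<open>n\<close>, which fixes the order of the
  quantifiers.\<close>

lemma eventually_generic:
  assumes e1: "e1 \<in> {c, inv c}" and e2: "e2 \<in> {c, inv c}" and t: "t \<in> carrier G"
  shows "\<forall>\<^sub>F n::nat in sequentially. \<forall>\<^sub>F m::nat in sequentially. generic (inv (e1 [^] n) \<otimes> t \<otimes> e2 [^] m)"
proof -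
  note e1C = axis_pow(1)[OF e1] and e2C = axis_pow(1)[OF e2]
  define x where "x n = \<phi> (e1 [^] n) y" for n :: nat
  define r where "r m = \<phi> t (\<phi> (e2 [^] m) y)" for m :: nat
  have T: "x n \<in> T" "r n \<in> T" for n unfolding x_def r_def using e1C e2C t y by auto
  have dx: "d (x i) (x j) = \<bar>real i - real j\<bar> * len c" for i j unfolding x_def using axis_pow(2)[OF e1] .
  have dr: "d (r i) (r j) = \<bar>real i - real j\<bar> * len c" for i j
    unfolding r_def using axis_pow(2)[OF e2] t e2C y by simp
  have far: "d (x n) (r m) \<ge> m * len c - d (x n) (r 0)" for n m
    using triangle[of "r 0" "x n" "r m"] T dr[of 0 m] commute[of "x n" "r 0"] by simp
  text \<open>\<open>F n m\<close> says that, seen from \<open>x n\<close>, the point \<open>r m\<close> lies in neither direction of the axis. For large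
    \<open>m\<close> this does not depend on \<open>m\<close>, and it holds for at most one \<open>n\<close>.\<close>
  define F where "F n m \<longleftrightarrow> btw d (r m) (x n) (x (Suc n)) \<and> btw d (r m) (x n) (x (n - 1))" for n m
  have "\<exists>M::nat. M * len c > d (x n) (r 0)" for n using reals_Archimedean3[OF len_c] by blast
  then obtain M :: "nat \<Rightarrow> nat" where M: "\<And>n. M n * len c > d (x n) (r 0)" by metis
  have M': "m * len c > d (x n) (r 0)" if "m \<ge> M n" for m n
  proof -
    have "real (M n) * len c \<le> real m * len c" using that len_c by simp
    then show ?thesis using M[of n] by linarith
  qed
  \<comment> \<open>If \<open>x n\<close> separated the two points, its distances to them would add
    up to \<open>\<bar>real m - real m'\<bar> * len c\<close>, but each of them grows like the full
    multiple of \<open>len c\<close>.\<close>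
  have same: "\<not> btw d (r m) (x n) (r m')" if m: "m \<ge> M n" "m' \<ge> M n" for n m m'
  proof
    assume "btw d (r m) (x n) (r m')"
    then have "d (x n) (r m) + d (x n) (r m') = \<bar>real m - real m'\<bar> * len c"
      unfolding btw_def dr by (simp add: commute)
    moreover have "d (x n) (r m) + d (x n) (r m') \<ge> (real m + real m') * len c - 2 * d (x n) (r 0)"
    proof -
      have "d (x n) (r m) \<ge> m * len c - d (x n) (r 0)" "d (x n) (r m') \<ge> m' * len c - d (x n) (r 0)" by (rule far)+
      then show ?thesis by (simp add: algebra_simps)
    qed
    moreover have "(real m + real m') * len c - \<bar>real m - real m'\<bar> * len c > 2 * d (x n) (r 0)"
      using M'[OF m(1)] M'[OF m(2)] by (cases "m \<le> m'") (auto simp: algebra_simps)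
    ultimately show False by linarith
  qed
  have F_const: "F n m \<longleftrightarrow> F n m'" if m: "m \<ge> M n" "m' \<ge> M n" for n m m'
  proof -
    have "btw d (r m) (x n) q \<longleftrightarrow> btw d (r m') (x n) q" if q: "q \<in> T" for q
      using btw_dir[OF _ same[OF m] T(2) q T(2) T(1)] btw_dir[OF _ same[OF m(2) m(1)] T(2) q T(2) T(1)] by blast
    then show ?thesis unfolding F_def using T(1) by simp
  qed
  \<comment> \<open>Both points would be the foot of \<open>r m\<close> on the axis, and each would
    be farther from \<open>r m\<close> than the other.\<close>
  have F_unique: False if F: "F n m" "F n' m" and n: "n < n'" for n n' m
  proof -
    have 1: "d (r m) (x n') = d (r m) (x n) + (real n' - real n) * len c"
    proof -
      have "btw d (x n) (x (Suc n)) (x n')" unfolding btw_def dx using n by (simp add: algebra_simps)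
      moreover have "x n \<noteq> x (Suc n)" using dx[of n "Suc n"] len_c T zero[of "x n" "x (Suc n)"] by simp
      ultimately have "btw d (r m) (x n) (x n')" using btw_chain(1)[of "r m" "x n" "x (Suc n)" "x n'"] F T
        unfolding F_def by blast
      then show ?thesis unfolding btw_def dx using n by simp
    qed
    have 2: "d (r m) (x n) = d (r m) (x n') + (real n' - real n) * len c"
    proof -
      have "btw d (x n') (x (n' - 1)) (x n)" unfolding btw_def dx using n by (simp add: of_nat_diff algebra_simps)
      moreover have "x n' \<noteq> x (n' - 1)" using dx[of n' "n' - 1"] len_c T n zero[of "x n'" "x (n' - 1)"] by (simp add: of_nat_diff)
      ultimately have "btw d (r m) (x n') (x n)" using btw_chain(1)[of "r m" "x n'" "x (n' - 1)" "x n"] F T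
        unfolding F_def by blast
      then show ?thesis unfolding btw_def dx using n by simp
    qed
    have "(real n' - real n) * len c > 0" using n len_c by simp
    then show False using 1 2 by linarith
  qed
  \<comment> \<open>\<open>N\<close> lies past the only possible exception. It is at least 1 because
    \<open>n - 1\<close> has to be a genuine predecessor for \<open>x (n - 1)\<close> to lie in the
    backward direction.\<close>
  obtain N where N: "N \<ge> 1" "\<And>n m. n \<ge> N \<Longrightarrow> m \<ge> M n \<Longrightarrow> \<not> F n m"
  proof (cases "\<exists>n0. F n0 (M n0)")
    case True
    then obtain n0 where n0: "F n0 (M n0)" by blast
    show ?thesis
    proof (rule that[of "Suc n0"])
      fix n m assume n: "n \<ge> Suc n0" "m \<ge> M n"
      show "\<not> F n m"
      proof
        assume "F n m"
        define m' where "m' = max m (M n0)"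
        have "F n m'" using F_const[of n m m'] n \<open>F n m\<close> unfolding m'_def by simp
        moreover have "F n0 m'" using F_const[of n0 "M n0" m'] n0 unfolding m'_def by simp
        ultimately show False using F_unique[of n0 m' n] n by simp
      qed
    qed simp
  next
    case False
    then show ?thesis using that[of 1] F_const by blast
  qed
  have "generic (inv (e1 [^] n) \<otimes> t \<otimes> e2 [^] m)" if n: "n \<ge> N" and m: "m \<ge> M n" for n m
  proof -
    let ?w = "inv (e1 [^] n) \<otimes> t \<otimes> e2 [^] m"
    have wC: "?w \<in> carrier G" using e1C e2C t by simp
    have wy: "\<phi> ?w y = \<phi> (inv (e1 [^] n)) (r m)" unfolding r_def using e1C e2C t y by (simp add: act_mult m_assoc)
    have "inv ?w = inv (e2 [^] m) \<otimes> inv t \<otimes> (e1 [^] n)" using e1C e2C t by (simp add: inv_mult_group m_assoc)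
    then have iwy: "\<phi> (inv ?w) y = \<phi> (inv (e2 [^] m)) (\<phi> (inv t) (x n))"
      unfolding x_def using e1C e2C t y by (simp add: act_mult m_assoc)
    have m0: "m \<ge> 1"
    proof (rule ccontr)
      assume "\<not> m \<ge> 1"
      then have "m = 0" by simp
      then show False using M'[OF m] nonneg[of "x n" "r 0"] by simp
    qed
    have "x n \<noteq> r m"
    proof
      assume "x n = r m"
      then have "d (x n) (r m) = 0" using T by simp
      moreover have "d (x n) (r m) \<ge> m * len c - d (x n) (r 0)" by (rule far)
      ultimately show False using M'[OF m] by simp
    qed
    then have 1: "\<phi> ?w y \<noteq> y" unfolding wy using act_eq_iff[of "e1 [^] n" "\<phi> (inv (e1 [^] n)) (r m)" y] e1C T y
      unfolding x_def by auto
    have n1: "n \<ge> 1" using n N by simp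
    obtain e where e: "e \<in> {c, inv c}" "\<not> btw d (r m) (x n) (\<phi> (e1 [^] n) (\<phi> e y))"
    proof -
      have s: "x (Suc n) = \<phi> (e1 [^] n) (\<phi> e1 y)" unfolding x_def using act_pow_Suc(2)[OF e1C y] .
      obtain k where k: "n = Suc k" using n1 by (cases n) auto
      have "\<phi> (e1 [^] n) (\<phi> (inv e1) y) = \<phi> (e1 [^] k) (\<phi> e1 (\<phi> (inv e1) y))"
        unfolding k using act_pow_Suc(2)[OF e1C] e1C y by simp
      then have p: "x (n - 1) = \<phi> (e1 [^] n) (\<phi> (inv e1) y)" unfolding x_def using k e1C y by simp
      have "e1 \<in> {c, inv c}" "inv e1 \<in> {c, inv c}" using e1 c by auto
      then show ?thesis using that N(2)[OF n m] s p unfolding F_def by auto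
    qed
    have eC: "e \<in> carrier G" using e c by auto
    have nb1: "\<not> btw d (\<phi> ?w y) y (\<phi> e y)"
      unfolding wy using act_btw_inv[of "e1 [^] n" "r m" y "\<phi> e y"] e e1C T y eC unfolding x_def by simp
    have nb2': "\<not> btw d (x n) (r m) (r (m - 1))"
    proof
      assume b: "btw d (x n) (r m) (r (m - 1))"
      have "btw d (r m) (r (m - 1)) (r 0)" unfolding btw_def dr using m0 by (simp add: of_nat_diff algebra_simps)
      moreover have "r m \<noteq> r (m - 1)" using dr[of m "m - 1"] m0 len_c T zero[of "r m" "r (m - 1)"] by (simp add: of_nat_diff)
      ultimately have "btw d (x n) (r m) (r 0)" using btw_chain(1)[OF b] T by blast
      then have "d (x n) (r 0) = d (x n) (r m) + m * len c" unfolding btw_def dr by simp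
      then show False using M'[OF m] nonneg[of "x n" "r m"] by linarith
    qed
    have nb2: "\<not> btw d (\<phi> (inv ?w) y) y (\<phi> (inv e2) y)"
    proof -
      obtain k where k: "m = Suc k" using m0 by (cases m) auto
      have "\<phi> (e2 [^] m) (\<phi> (inv e2) y) = \<phi> (e2 [^] k) (\<phi> e2 (\<phi> (inv e2) y))"
        unfolding k using act_pow_Suc(2)[OF e2C] e2C y by simp
      then have p: "\<phi> (e2 [^] (m - 1)) y = \<phi> (e2 [^] m) (\<phi> (inv e2) y)" using k e2C y by simp
      have "btw d (\<phi> (inv ?w) y) y (\<phi> (inv e2) y) \<longleftrightarrow> btw d (\<phi> (inv t) (x n)) (\<phi> (e2 [^] m) y) (\<phi> (e2 [^] m) (\<phi> (inv e2) y))"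
        unfolding iwy using act_btw_inv[of "e2 [^] m" "\<phi> (inv t) (x n)" y "\<phi> (inv e2) y"] e2C T t y by simp
      also have "\<dots> \<longleftrightarrow> btw d (x n) (r m) (r (m - 1))"
        unfolding r_def p using act_btw_inv[of t "x n"] e2C T t y by simp
      finally show ?thesis using nb2' by simp
    qed
    have ie2: "inv e2 \<in> {c, inv c}" using e2 c by auto
    have "btw d (\<phi> ?w y) y (\<phi> f y)" "btw d (\<phi> (inv ?w) y) y (\<phi> f y)" if f: "f \<in> {a, inv a}" for f
    proof -
      have fC: "f \<in> carrier G" using f a by auto
      show "btw d (\<phi> ?w y) y (\<phi> f y)"
        using btw_dir[of "\<phi> f y" y "\<phi> e y"] off_axis[OF e(1) f] nb1 btw_dir[of "\<phi> e y" y "\<phi> f y" "\<phi> ?w y"] btw_sym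
         wC eC fC y by (meson act_closed)
      show "btw d (\<phi> (inv ?w) y) y (\<phi> f y)"
        using off_axis[OF ie2 f] nb2 btw_dir[of "\<phi> (inv e2) y" y "\<phi> f y" "\<phi> (inv ?w) y"] btw_sym
         wC e2C fC y by (meson act_closed inv_closed)
    qed
    then show ?thesis unfolding generic_def using 1 wC by blast
  qed
  then show ?thesis unfolding eventually_sequentially by blast
qed

text \<open>This recovers \<open>y\<close> as the median of three far points, in the directions of
  \<open>c y\<close>, \<open>c^-1 y\<close> and \<open>a y\<close>. The exponents stay arbitrary, as
  they are fixed later by genericity.\<close>

lemma base_median:
  fixes i j k :: nat
  shows "btw d (\<phi> (c [^] i) y) y (\<phi> (inv c [^] j) y)"
    and "e \<in> {c, inv c} \<Longrightarrow> btw d (\<phi> (e [^] i) y) y (\<phi> (a \<otimes> c [^] k) y)"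
proof -
  have ic: "inv c \<in> {c, inv c}" "c \<in> {c, inv c}" by auto
  have start: "btw d y (\<phi> e y) (\<phi> (e [^] i) y)" if e: "e \<in> {c, inv c}" and i: "i \<ge> 1" for e and i :: nat
    using axis_pow(2)[OF e, of 0 1] axis_pow(2)[OF e, of 1 i] axis_pow(2)[OF e, of 0 i] axis_pow(1)[OF e] y i
    unfolding btw_def by (simp add: algebra_simps)
  show "btw d (\<phi> (c [^] i) y) y (\<phi> (inv c [^] j) y)"
  proof -
    have "d (\<phi> (c [^] i) y) (\<phi> (inv c [^] j) y) = d (\<phi> (c [^] (i + j)) y) y"
      using act_isometry[of "c [^] j" "\<phi> (c [^] i) y" "\<phi> (inv c [^] j) y"] c y
      by (simp add: nat_pow_inv act_mult[symmetric] nat_pow_mult add.commute)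
    also have "\<dots> = (real i + real j) * len c" using axis_pow(2)[OF ic(2), of "i + j" 0] y by simp
    finally show ?thesis unfolding btw_def
      using axis_pow(2)[OF ic(2), of i 0] axis_pow(2)[OF ic(1), of 0 j] y by (simp add: algebra_simps)
  qed
  show "btw d (\<phi> (e [^] i) y) y (\<phi> (a \<otimes> c [^] k) y)" if e: "e \<in> {c, inv c}"
  proof -
    note eC = axis_pow(1)[OF e]
    have off: "btw d (\<phi> (e [^] i) y) y (\<phi> f y)" if e: "e \<in> {c, inv c}" and f: "f \<in> {a, inv a}" for e f and i :: nat
    proof (cases "i \<ge> 1")
      case True
      note eC = axis_pow(1)[OF e]
      have fC: "f \<in> carrier G" using f a by auto
      have "0 < d y (\<phi> e y)" using axis_pow(2)[OF e, of 0 1] len_c eC y by simp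
      then have "\<phi> e y \<noteq> y" using y by auto
      then have "\<not> btw d (\<phi> e y) y (\<phi> (e [^] i) y)"
        using start[OF e True] btw_antisym[of y "\<phi> e y" "\<phi> (e [^] i) y"] eC y by auto
      then show ?thesis using btw_dir[OF off_axis[OF e f]] eC fC y by simp
    next
      case False
      then have "i = 0" by simp
      then show ?thesis using y f a by auto
    qed
    have 1: "btw d (\<phi> (e [^] i) y) y (\<phi> a y)" using off e by blast
    have "btw d (\<phi> (inv a) y) y (\<phi> (c [^] k) y)" using off[OF ic(2), of "inv a" k] btw_sym by blast
    then have "btw d y (\<phi> a y) (\<phi> (a \<otimes> c [^] k) y)" using act_btw_inv[of a y y "\<phi> (c [^] k) y"] a c y by (simp add: act_mult)
    then show ?thesis using btw_chain(1)[OF 1] a_moves a c eC y by simp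
  qed
qed

end

section \<open>The product of two trees\<close>

text \<open>The quadruple splits as \<open>x\<close>, \<open>u\<close> against \<open>y\<close>,
  \<open>z\<close>. So \<open>u\<close> branches off the leg of the tripod towards \<open>x\<close>,
  possibly at \<open>p\<close>, and \<open>p\<close> separates it from \<open>y\<close> and
  \<open>z\<close>.\<close>

lemma (in four_point) median_split:
  assumes T: "x \<in> T" "y \<in> T" "z \<in> T" "p \<in> T" "u \<in> T"
    and m: "btw d x p y" "btw d y p z" "btw d x p z"
    and s: "d x y + d z u = d x z + d y u" "d x u + d y z \<le> d x y + d z u"
  shows "btw d y p u" "btw d z p u"
proof -
  have 1: "btw d y p u" if T: "x \<in> T" "y \<in> T" "z \<in> T" and m: "btw d x p y" "btw d y p z" "btw d x p z"
    and s: "d x y + d z u = d x z + d y u" for x y z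
  proof (rule ccontr)
    assume n: "\<not> ?thesis"
    have "btw d y p x" using m btw_sym by blast
    then have "btw d u p x" "btw d u p z" using btw_dir[OF _ n] m(2) T \<open>p \<in> T\<close> \<open>u \<in> T\<close> by blast+
    then have "btw d y p u" using m s unfolding btw_def by (simp add: commute)
    then show False using n by blast
  qed
  show "btw d y p u" using 1 T m s by blast
  show "btw d z p u" using 1[of x z y] T m s btw_sym by simp
qed

locale two_trees = A: tree_action G T1 d1 \<phi>1 + B: tree_action G T2 d2 \<phi>2
  for G :: "('g, 'm) monoid_scheme" (structure)
    and T1 :: "'a set" and d1 :: "'a \<Rightarrow> 'a \<Rightarrow> real" and \<phi>1 :: "'g \<Rightarrow> 'a \<Rightarrow> 'a"
    and T2 :: "'b set" and d2 :: "'b \<Rightarrow> 'b \<Rightarrow> real" and \<phi>2 :: "'g \<Rightarrow> 'b \<Rightarrow> 'b"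
begin

definition P where "P = T1 \<times> T2"
definition D where "D u v = d1 (fst u) (fst v) + d2 (snd u) (snd v)"
definition act where "act g u = (\<phi>1 g (fst u), \<phi>2 g (snd u))"

lemma P_fst_snd: "u \<in> P \<Longrightarrow> fst u \<in> T1" "u \<in> P \<Longrightarrow> snd u \<in> T2"
  unfolding P_def by auto

sublocale prod: Metric_space P D
proof
  show "0 \<le> D x y" for x y unfolding D_def by simp
  show "D x y = D y x" for x y unfolding D_def by (simp add: A.commute B.commute)
  show "D x y = 0 \<longleftrightarrow> x = y" if "x \<in> P" "y \<in> P" for x y
    using that P_fst_snd unfolding D_def by (simp add: add_nonneg_eq_0_iff prod_eq_iff)
  show "D x z \<le> D x y + D y z" if "x \<in> P" "y \<in> P" "z \<in> P" for x y z
    using A.triangle[of "fst x" "fst y" "fst z"] B.triangle[of "snd x" "snd y" "snd z"] that P_fst_snd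
    unfolding D_def by auto
qed

lemma act_P: "\<lbrakk>g \<in> carrier G; u \<in> P\<rbrakk> \<Longrightarrow> act g u \<in> P"
  unfolding act_def P_def by auto

lemma act_D: "\<lbrakk>g \<in> carrier G; u \<in> P; v \<in> P\<rbrakk> \<Longrightarrow> D (act g u) (act g v) = D u v"
  unfolding act_def P_def D_def by auto

text \<open>Two triangle inequalities add up to an equality only if both are equalities. This is
  what makes the sum metric the right one on the product.\<close>

lemma btw_D_iff:
  assumes "u \<in> P" "p \<in> P" "v \<in> P"
  shows "btw D u p v \<longleftrightarrow> btw d1 (fst u) (fst p) (fst v) \<and> btw d2 (snd u) (snd p) (snd v)"
proof -
  have 1: "d1 (fst u) (fst v) \<le> d1 (fst u) (fst p) + d1 (fst p) (fst v)"
    using A.triangle[OF P_fst_snd(1)[OF assms(1)] P_fst_snd(1)[OF assms(2)] P_fst_snd(1)[OF assms(3)]] .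
  have 2: "d2 (snd u) (snd v) \<le> d2 (snd u) (snd p) + d2 (snd p) (snd v)"
    using B.triangle[OF P_fst_snd(2)[OF assms(1)] P_fst_snd(2)[OF assms(2)] P_fst_snd(2)[OF assms(3)]] .
  show ?thesis
  proof
    assume "btw D u p v"
    then show "btw d1 (fst u) (fst p) (fst v) \<and> btw d2 (snd u) (snd p) (snd v)"
      using 1 2 unfolding btw_def D_def by (intro conjI; linarith)
  next
    assume "btw d1 (fst u) (fst p) (fst v) \<and> btw d2 (snd u) (snd p) (snd v)"
    then show "btw D u p v" unfolding btw_def D_def by linarith
  qed
qed

lemma btw_D_act:
  assumes "g \<in> carrier G" "u \<in> P" "p \<in> P" "v \<in> P"
  shows "btw D (act g u) (act g p) (act g v) \<longleftrightarrow> btw D u p v"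
  using assms act_D unfolding btw_def by simp

section \<open>Adding points to four-point subsets of the product\<close>

lemma four_point_PI:
  assumes "X \<subseteq> P"
    and "\<And>x y z w. \<lbrakk>x \<in> X; y \<in> X; z \<in> X; w \<in> X\<rbrakk> \<Longrightarrow> D x y + D z w \<le> max (D x z + D y w) (D x w + D y z)"
  shows "four_point X D"
  using prod.subspace[OF assms(1)] assms(2) by (simp add: four_point_def four_point_axioms_def)

text \<open>If one factor made the first sum smaller than the second, the other factor would have to
  make up for it. The third sum would then be maximal in both factors and exceed the first in
  \<open>D\<close>.\<close>

lemma common_split:
  assumes X: "four_point X D" "X \<subseteq> P" and x: "x \<in> X" "y \<in> X" "z \<in> X" "u \<in> X"
    and s: "D x y + D z u = D x z + D y u" "D x u + D y z \<le> D x y + D z u"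
  shows "d1 (fst x) (fst y) + d1 (fst z) (fst u) = d1 (fst x) (fst z) + d1 (fst y) (fst u)"
    "d1 (fst x) (fst u) + d1 (fst y) (fst z) \<le> d1 (fst x) (fst y) + d1 (fst z) (fst u)"
    "d2 (snd x) (snd y) + d2 (snd z) (snd u) = d2 (snd x) (snd z) + d2 (snd y) (snd u)"
    "d2 (snd x) (snd u) + d2 (snd y) (snd z) \<le> d2 (snd x) (snd y) + d2 (snd z) (snd u)"
  using A.four_point_cases[of "fst x" "fst y" "fst z" "fst u"] B.four_point_cases[of "snd x" "snd y" "snd z" "snd u"]
    P_fst_snd[OF subsetD[OF X(2) x(1)]] P_fst_snd[OF subsetD[OF X(2) x(2)]]
    P_fst_snd[OF subsetD[OF X(2) x(3)]] P_fst_snd[OF subsetD[OF X(2) x(4)]] s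
  unfolding D_def by (smt (verit))+

text \<open>\<open>p\<close> need not belong to \<open>X\<close>, so the condition for
  \<open>D\<close> says nothing about it directly. It only fixes the common split of
  \<open>x\<close>, \<open>y\<close>, \<open>z\<close>, \<open>u\<close>, and each factor then
  places its coordinate of \<open>p\<close>.\<close>

lemma median_sides:
  assumes X: "four_point X D" "X \<subseteq> P" and x: "x \<in> X" "y \<in> X" "z \<in> X" "u \<in> X" and p: "p \<in> P"
    and m: "btw D x p y" "btw D y p z" "btw D x p z"
  shows "(btw D y p u \<and> btw D z p u) \<or> (btw D x p u \<and> btw D z p u) \<or> (btw D x p u \<and> btw D y p u)"
proof -
  interpret X: four_point X D by (rule X)
  have *: "btw D y p u \<and> btw D z p u" if x: "x \<in> X" "y \<in> X" "z \<in> X"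
    and m: "btw D x p y" "btw D y p z" "btw D x p z"
    and s: "D x y + D z u = D x z + D y u" "D x u + D y z \<le> D x y + D z u" for x y z
  proof -
    have P: "x \<in> P" "y \<in> P" "z \<in> P" "u \<in> P" using x X \<open>u \<in> X\<close> by auto
    note c = common_split[OF X x \<open>u \<in> X\<close> s]
    show ?thesis
      using A.median_split[OF _ _ _ _ _ _ _ _ c(1,2), of "fst p"] B.median_split[OF _ _ _ _ _ _ _ _ c(3,4), of "snd p"]
        m P p P_fst_snd by (simp add: btw_D_iff)
  qed
  have ms: "btw D y p x" "btw D z p y" "btw D z p x" using m prod.commute unfolding btw_def by (simp_all add: add.commute)
  consider "D x u + D y z \<le> D x y + D z u \<and> D x y + D z u = D x z + D y u"
    | "D y u + D x z \<le> D x y + D z u \<and> D x y + D z u = D x u + D y z"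
    | "D z u + D x y \<le> D x z + D y u \<and> D x z + D y u = D x u + D y z"
    using X.four_point_cases[OF x] by (auto simp: add.commute)
  then show ?thesis
  proof cases
    case 1 then show ?thesis using *[OF x(1-3) m] by blast
  next
    case 2
    then have "D y x + D z u = D y z + D x u" "D y u + D x z \<le> D y x + D z u" using prod.commute[of y x] by linarith+
    then show ?thesis using *[OF x(2,1,3) ms(1) m(3,2)] by blast
  next
    case 3
    then have "D z y + D x u = D z x + D y u" "D z u + D y x \<le> D z y + D x u"
      using prod.commute[of y x] prod.commute[of z y] prod.commute[of z x] by linarith+
    then show ?thesis using *[OF x(3,2,1) ms(2,1,3)] by blast
  qed
qed

lemma four_point_insertI:
  assumes X: "four_point X D" "X \<subseteq> P" and p: "p \<in> P"
    and q: "\<And>u v w. \<lbrakk>u \<in> X; v \<in> X; w \<in> X\<rbrakk> \<Longrightarrow> D p u + D v w \<le> max (D p v + D u w) (D p w + D u v)"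
  shows "four_point (insert p X) D"
proof (rule four_point_PI)
  show XP: "insert p X \<subseteq> P" using X p by simp
  interpret X: four_point X D by (rule X)
  have q': "D p u + D v w \<le> max (D p v + D u w) (D p w + D u v)"
    if uvw: "u \<in> insert p X" "v \<in> insert p X" "w \<in> insert p X" for u v w
  proof -
    have P: "u \<in> P" "v \<in> P" "w \<in> P" using uvw XP by auto
    consider "u = p" | "v = p" | "w = p" | "u \<in> X" "v \<in> X" "w \<in> X" using uvw by auto
    then show ?thesis
    proof cases
      case 1 then show ?thesis using prod.triangle[of v p w] prod.commute[of v p] P p by auto
    next
      case 2 then show ?thesis using prod.commute[of u p] p by auto
    next
      case 3 then show ?thesis using prod.commute[of u p] prod.commute[of v p] p by auto
    next
      case 4 then show ?thesis using q by blast
    qed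
  qed
  fix x y z w assume x: "x \<in> insert p X" "y \<in> insert p X" "z \<in> insert p X" "w \<in> insert p X"
  consider "x = p" | "y = p" | "z = p" | "w = p" | "x \<in> X" "y \<in> X" "z \<in> X" "w \<in> X" using x by auto
  then show "D x y + D z w \<le> max (D x z + D y w) (D x w + D y z)"
  proof cases
    case 1 then show ?thesis using q'[OF x(2,3,4)] by simp
  next
    case 2 then show ?thesis using q'[OF x(1,3,4)] prod.commute[of x p] by (simp add: max.commute add.commute)
  next
    case 3 then show ?thesis using q'[OF x(4,1,2)] prod.commute[of x p] prod.commute[of y p] prod.commute[of w]
      by (simp add: max.commute add.commute)
  next
    case 4 then show ?thesis using q'[OF x(3,1,2)] prod.commute[of x p] prod.commute[of y p] prod.commute[of z]
      by (simp add: max.commute add.commute)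
  next
    case 5 then show ?thesis using X.four_point by blast
  qed
qed

text \<open>If three points all lie beyond \<open>p\<close> seen from \<open>s\<close>, their
  distances from \<open>p\<close> are those from \<open>s\<close> less a constant, and the
  inequality for \<open>s\<close> carries over; similarly for \<open>t\<close>. Otherwise
  \<open>p\<close> separates one of them from the other two, and the triangle inequality is
  enough.\<close>

lemma four_point_insert_between:
  assumes X: "four_point X D" "X \<subseteq> P" and p: "p \<in> P" and s: "s \<in> X" "t \<in> X" "btw D s p t"
    and sides: "\<And>u. u \<in> X \<Longrightarrow> btw D s p u \<or> btw D t p u"
  shows "four_point (insert p X) D"
proof (rule four_point_insertI[OF X p])
  interpret X: four_point X D by (rule X)
  have mix0: "btw D u p w" if s: "s \<in> X" "t \<in> X" "btw D s p t"
    and u: "u \<in> X" "btw D s p u" and w: "w \<in> X" "btw D t p w" "\<not> btw D s p w" for s t u w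
  proof -
    have "D s w < D s p + D p w" using w prod.triangle[of s p w] X s p unfolding btw_def by fastforce
    moreover have "D t u \<le> D t p + D p u" using prod.triangle[of t p u] X s p u by blast
    ultimately show ?thesis using X.four_point_cases[of s t u w] s u w
      unfolding btw_def by (smt (verit) prod.commute)
  qed
  have mix: "btw D u p w" if "u \<in> X" "btw D s p u" "w \<in> X" "btw D t p w" "\<not> btw D s p w" for u w
    using mix0[OF s] that by blast
  have mix': "btw D u p w" if "u \<in> X" "btw D s p u" "\<not> btw D t p u" "w \<in> X" "btw D t p w" for u w
    using mix0[of t s w u] s prod.btw_sym that by blast
  have opp: "D p u + D v w \<le> max (D p v + D u w) (D p w + D u v)"
    "D p w + D u v \<le> max (D p u + D w v) (D p v + D w u)"
    if o: "btw D u p w" "btw D v p w" "u \<in> X" "v \<in> X" "w \<in> X" for u v w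
  proof -
    have "u \<in> P" "v \<in> P" using o X by auto
    then have "D u v \<le> D u p + D p v" using prod.triangle p by blast
    moreover have "D u p + D p w = D u w" "D v p + D p w = D v w" using o unfolding btw_def by auto
    moreover have "D u p = D p u" "D v p = D p v" "D w v = D v w" by (rule prod.commute)+
    ultimately show "D p u + D v w \<le> max (D p v + D u w) (D p w + D u v)"
      "D p w + D u v \<le> max (D p u + D w v) (D p v + D w u)"
      unfolding le_max_iff_disj by linarith+
  qed
  fix u v w assume x: "u \<in> X" "v \<in> X" "w \<in> X"
  have sym: "btw D w p u \<longleftrightarrow> btw D u p w" for u w unfolding btw_def by (simp add: prod.commute add.commute)
  have opp': "D p u + D v w \<le> max (D p v + D u w) (D p w + D u v)"
    if "(btw D u p w \<and> btw D v p w) \<or> (btw D u p v \<and> btw D w p v) \<or> (btw D v p u \<and> btw D w p u)"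
    using that
  proof (elim disjE conjE)
    assume "btw D u p w" "btw D v p w"
    then show ?thesis using opp(1) x by blast
  next
    assume "btw D u p v" "btw D w p v"
    then have "D p u + D w v \<le> max (D p w + D u v) (D p v + D u w)" using opp(1) x by blast
    then show ?thesis using prod.commute[of w v] max.commute by metis
  next
    assume "btw D v p u" "btw D w p u"
    then show ?thesis using opp(2)[of v u w] x by blast
  qed
  consider "btw D s p u" "btw D s p v" "btw D s p w" | "btw D t p u" "btw D t p v" "btw D t p w"
    | "(btw D u p w \<and> btw D v p w) \<or> (btw D u p v \<and> btw D w p v) \<or> (btw D v p u \<and> btw D w p u)"
    using sides[OF x(1)] sides[OF x(2)] sides[OF x(3)] mix mix' x sym by metis
  then show "D p u + D v w \<le> max (D p v + D u w) (D p w + D u v)"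
  proof cases
    case 1 then show ?thesis using X.four_point[of s u v w] s x unfolding btw_def by auto
  next
    case 2 then show ?thesis using X.four_point[of t u v w] s x unfolding btw_def by auto
  next
    case 3 then show ?thesis by (rule opp')
  qed
qed

text \<open>Each instance of the condition involves four points, so finitely many insertions suffice
  for it.\<close>

lemma four_point_Un:
  assumes X: "four_point X D" "X \<subseteq> P" and N: "N \<subseteq> P"
    and step: "\<And>F p. \<lbrakk>F \<subseteq> N; p \<in> N; four_point (X \<union> F) D\<rbrakk> \<Longrightarrow> four_point (insert p (X \<union> F)) D"
  shows "four_point (X \<union> N) D"
proof (rule four_point_PI)
  show "X \<union> N \<subseteq> P" using X N by blast
  have fin: "four_point (X \<union> F) D" if "finite F" "F \<subseteq> N" for F
    using that by (induction F) (use X step in auto)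
  fix x y z w assume x: "x \<in> X \<union> N" "y \<in> X \<union> N" "z \<in> X \<union> N" "w \<in> X \<union> N"
  interpret F: four_point "X \<union> ({x, y, z, w} \<inter> N)" D by (rule fin) auto
  show "D x y + D z w \<le> max (D x z + D y w) (D x w + D y z)" using F.four_point x by blast
qed

section \<open>Medians and limits\<close>

definition invariant where "invariant S \<longleftrightarrow> (\<forall>g\<in>carrier G. \<forall>u\<in>S. act g u \<in> S)"

definition medians where
  "medians S = {p \<in> P. \<exists>x\<in>S. \<exists>y\<in>S. \<exists>z\<in>S. btw D x p y \<and> btw D y p z \<and> btw D x p z}"

lemma four_point_medians:
  assumes X: "four_point X D" "X \<subseteq> P"
  shows "four_point (X \<union> medians X) D"
proof (rule four_point_Un[OF X])
  show "medians X \<subseteq> P" unfolding medians_def by blast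
  fix F p assume F: "F \<subseteq> medians X" "p \<in> medians X" "four_point (X \<union> F) D"
  have FP: "X \<union> F \<subseteq> P" using F X unfolding medians_def by blast
  obtain x y z where p: "p \<in> P" "x \<in> X" "y \<in> X" "z \<in> X" "btw D x p y" "btw D y p z" "btw D x p z"
    using F(2) unfolding medians_def by blast
  show "four_point (insert p (X \<union> F)) D"
  proof (rule four_point_insert_between[OF F(3) FP p(1) _ _ p(5)])
    show "btw D x p u \<or> btw D y p u" if "u \<in> X \<union> F" for u
      using median_sides[OF F(3) FP _ _ _ that p(1) p(5-7)] p by blast
  qed (use p in auto)
qed

lemma invariant_medians:
  assumes "invariant S" "S \<subseteq> P" shows "invariant (medians S)"
  unfolding invariant_def medians_def
proof (intro ballI CollectI conjI)
  fix g p assume g: "g \<in> carrier G" and "p \<in> {p \<in> P. \<exists>x\<in>S. \<exists>y\<in>S. \<exists>z\<in>S. btw D x p y \<and> btw D y p z \<and> btw D x p z}"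
  then obtain x y z where p: "p \<in> P" "x \<in> S" "y \<in> S" "z \<in> S" "btw D x p y" "btw D y p z" "btw D x p z" by blast
  then show "act g p \<in> P" using act_P g by blast
  have xP: "x \<in> P" "y \<in> P" "z \<in> P" using p assms by auto
  show "\<exists>x\<in>S. \<exists>y\<in>S. \<exists>z\<in>S. btw D x (act g p) y \<and> btw D y (act g p) z \<and> btw D x (act g p) z"
  proof (rule bexI[of _ "act g x"], rule bexI[of _ "act g y"], rule bexI[of _ "act g z"])
    show "btw D (act g x) (act g p) (act g y) \<and> btw D (act g y) (act g p) (act g z) \<and> btw D (act g x) (act g p) (act g z)"
      using btw_D_act[OF g] p xP by blast
  qed (use assms(1) g p in \<open>auto simp: invariant_def\<close>)
qed

definition limits where "limits S = {p \<in> P. \<forall>e>0. \<exists>r\<in>S. D p r < e}"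

lemma invariant_limits:
  assumes "invariant S" "S \<subseteq> P" shows "invariant (limits S)"
  unfolding invariant_def limits_def
proof (intro ballI CollectI conjI allI impI)
  fix g p assume g: "g \<in> carrier G" and p: "p \<in> {p \<in> P. \<forall>e>0. \<exists>r\<in>S. D p r < e}"
  then show "act g p \<in> P" using act_P by blast
  fix e :: real assume "e > 0"
  then obtain r where r: "r \<in> S" "D p r < e" using p by blast
  then show "\<exists>r\<in>S. D (act g p) r < e"
    using assms g p act_D[of g p r] unfolding invariant_def by (intro bexI[of _ "act g r"]) auto
qed

lemma four_point_limits:
  assumes X: "four_point X D" "X \<subseteq> P"
  shows "four_point (X \<union> limits X) D"
proof (rule four_point_PI)
  show sub: "X \<union> limits X \<subseteq> P" using X unfolding limits_def by blast
  interpret X: four_point X D by (rule X)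
  have near: "\<exists>r\<in>X. D p r < e" if "p \<in> X \<union> limits X" "e > 0" for p e
    using that X unfolding limits_def by (cases "p \<in> X") (force intro: bexI[of _ p], blast)
  fix x y z w assume x: "x \<in> X \<union> limits X" "y \<in> X \<union> limits X" "z \<in> X \<union> limits X" "w \<in> X \<union> limits X"
  show "D x y + D z w \<le> max (D x z + D y w) (D x w + D y z)"
  proof (rule field_le_epsilon)
    fix e :: real assume "e > 0"
    then have e: "e / 8 > 0" by simp
    obtain x' y' z' w' where n: "x' \<in> X" "y' \<in> X" "z' \<in> X" "w' \<in> X"
      "D x x' < e/8" "D y y' < e/8" "D z z' < e/8" "D w w' < e/8"
      using near[OF x(1) e] near[OF x(2) e] near[OF x(3) e] near[OF x(4) e] by blast
    have P: "x \<in> P" "y \<in> P" "z \<in> P" "w \<in> P" "x' \<in> P" "y' \<in> P" "z' \<in> P" "w' \<in> P" using x n sub X by auto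
    have diff: "\<bar>D u v - D u' v'\<bar> < e/4"
      if "D u u' < e/8" "D v v' < e/8" and P: "u \<in> P" "v \<in> P" "u' \<in> P" "v' \<in> P" for u v u' v'
      using that(1,2) prod.triangle[OF P(1,3,2)] prod.triangle[OF P(3,4,2)] prod.triangle[OF P(3,1,4)] prod.triangle[OF P(1,2,4)]
        prod.commute[of u u'] prod.commute[of v v'] by linarith
    have "D x' y' + D z' w' \<le> max (D x' z' + D y' w') (D x' w' + D y' z')" using X.four_point n by blast
    then show "D x y + D z w \<le> max (D x z + D y w) (D x w + D y z) + e"
      using diff[OF n(5,6) P(1,2,5,6)] diff[OF n(7,8) P(3,4,7,8)] diff[OF n(5,7) P(1,3,5,7)]
        diff[OF n(6,8) P(2,4,6,8)] diff[OF n(5,8) P(1,4,5,8)] diff[OF n(6,7) P(2,3,6,7)]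
      unfolding le_max_iff_disj using max.cobounded1[of "D x z + D y w" "D x w + D y z"]
        max.cobounded2[of "D x w + D y z" "D x z + D y w"] by linarith
  qed
qed

end

text \<open>Half-trees are convex.\<close>

lemma (in four_point) btw_hull:
  assumes "btw d t s x" "btw d t s y" "btw d x q y" "t \<in> T" "s \<in> T" "x \<in> T" "y \<in> T" "q \<in> T"
  shows "btw d t s q"
  using btw_split[OF assms(3), of s] btw_trans1(2)[OF assms(1), of q] btw_trans1(2)[OF assms(2), of q] assms
  by blast

context two_trees
begin

lemma act_inv_act: "\<lbrakk>g \<in> carrier G; u \<in> P\<rbrakk> \<Longrightarrow> act (inv g) (act g u) = u" "\<lbrakk>g \<in> carrier G; u \<in> P\<rbrakk> \<Longrightarrow> act g (act (inv g) u) = u"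
  unfolding act_def P_def by auto

lemma exists_median_P:
  assumes "x \<in> P" "y \<in> P" "z \<in> P"
  shows "\<exists>m\<in>P. btw D x m y \<and> btw D y m z \<and> btw D x m z"
proof -
  obtain m1 where m1: "m1 \<in> T1" "btw d1 (fst x) m1 (fst y)" "btw d1 (fst y) m1 (fst z)" "btw d1 (fst x) m1 (fst z)"
    using A.median[OF P_fst_snd(1)[OF assms(1)] P_fst_snd(1)[OF assms(2)] P_fst_snd(1)[OF assms(3)]] by blast
  obtain m2 where m2: "m2 \<in> T2" "btw d2 (snd x) m2 (snd y)" "btw d2 (snd y) m2 (snd z)" "btw d2 (snd x) m2 (snd z)"
    using B.median[OF P_fst_snd(2)[OF assms(1)] P_fst_snd(2)[OF assms(2)] P_fst_snd(2)[OF assms(3)]] by blast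
  have mP: "(m1, m2) \<in> P" unfolding P_def using m1 m2 by simp
  have "btw D x (m1, m2) y" "btw D y (m1, m2) z" "btw D x (m1, m2) z"
    unfolding btw_D_iff[OF assms(1) mP assms(2)] btw_D_iff[OF assms(2) mP assms(3)] btw_D_iff[OF assms(1) mP assms(3)]
      fst_conv snd_conv using m1 m2 by blast+
  then show ?thesis using mP by blast
qed

section \<open>Gaps and their midpoints\<close>

definition gap where
  "gap S s t \<longleftrightarrow> s \<in> S \<and> t \<in> S \<and> s \<noteq> t \<and> (\<forall>r\<in>S. btw D s r t \<longrightarrow> r = s \<or> r = t)"

text \<open>For \<open>D\<close>, the points between \<open>s\<close> and \<open>t\<close> form a
  product of two segments and many of them are halfway. Halving in each factor makes the point
  unique, hence equivariant.\<close>

definition midpoint where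
  "midpoint s t p \<longleftrightarrow> p \<in> P \<and> btw d1 (fst s) (fst p) (fst t) \<and> btw d2 (snd s) (snd p) (snd t) \<and>
     d1 (fst s) (fst p) = d1 (fst p) (fst t) \<and> d2 (snd s) (snd p) = d2 (snd p) (snd t)"

definition gap_midpoints where
  "gap_midpoints S = {p. \<exists>s t. gap S s t \<and> midpoint s t p}"

lemma midpoint_sym: "midpoint s t p \<longleftrightarrow> midpoint t s p"
  unfolding midpoint_def using A.commute B.commute A.btw_sym B.btw_sym by metis

lemma midpoint_unique:
  assumes "midpoint s t p" "midpoint s t q" "s \<in> P" "t \<in> P"
  shows "p = q"
proof (rule prod_eqI)
  have P: "p \<in> P" "q \<in> P" using assms unfolding midpoint_def by auto
  have "d1 (fst s) (fst p) = d1 (fst s) (fst q)" "d2 (snd s) (snd p) = d2 (snd s) (snd q)"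
    using assms unfolding midpoint_def btw_def by linarith+
  then show "fst p = fst q" "snd p = snd q"
    using A.btw_unique[of "fst s" "fst p" "fst t" "fst q"] B.btw_unique[of "snd s" "snd p" "snd t" "snd q"]
      assms P P_fst_snd unfolding midpoint_def by auto
qed

lemma midpoint_btw: "\<lbrakk>midpoint s t p; s \<in> P; t \<in> P\<rbrakk> \<Longrightarrow> btw D s p t"
  using btw_D_iff unfolding midpoint_def by blast

lemma exists_midpoint:
  assumes "s \<in> P" "t \<in> P" shows "\<exists>p. midpoint s t p"
proof -
  obtain p1 where p1: "p1 \<in> T1" "d1 (fst s) p1 = d1 (fst s) (fst t) / 2" "d1 p1 (fst t) = d1 (fst s) (fst t) - d1 (fst s) (fst t) / 2"
    using A.geod[of "fst s" "fst t" "d1 (fst s) (fst t) / 2"] assms P_fst_snd by auto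
  obtain p2 where p2: "p2 \<in> T2" "d2 (snd s) p2 = d2 (snd s) (snd t) / 2" "d2 p2 (snd t) = d2 (snd s) (snd t) - d2 (snd s) (snd t) / 2"
    using B.geod[of "snd s" "snd t" "d2 (snd s) (snd t) / 2"] assms P_fst_snd by auto
  have "midpoint s t (p1, p2)" unfolding midpoint_def btw_def P_def using p1 p2 by simp
  then show ?thesis by blast
qed

text \<open>The median of \<open>s\<close>, \<open>t\<close> and \<open>u\<close> belongs to
  \<open>S\<close> and lies in the gap, so it is one of its ends.\<close>

lemma gap_side:
  assumes S: "S \<subseteq> P" "medians S \<subseteq> S" and g: "gap S s t" and u: "u \<in> S"
  shows "btw D t s u \<or> btw D s t u"
proof -
  have st: "s \<in> S" "t \<in> S" using g unfolding gap_def by auto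
  obtain m where m: "m \<in> P" "btw D s m t" "btw D t m u" "btw D s m u"
    using exists_median_P[of s t u] st u S by blast
  then have "m \<in> S" using S(2) st u unfolding medians_def by blast
  then have "m = s \<or> m = t" using g m unfolding gap_def by blast
  then show ?thesis using m by blast
qed

text \<open>Each point of \<open>S\<close> lies on one side of the gap, and by convexity so does the
  midpoint of a gap with both ends on the same side. A gap with its ends on different sides would
  have \<open>s\<close> and \<open>t\<close> between them, so it is the same gap with the same
  midpoint.\<close>

lemma four_point_gap_midpoints:
  assumes X: "four_point S D" "S \<subseteq> P" "medians S \<subseteq> S"
  shows "four_point (S \<union> gap_midpoints S) D"
proof (rule four_point_Un[OF X(1,2)])
  show "gap_midpoints S \<subseteq> P" unfolding gap_midpoints_def midpoint_def by blast
  interpret S: four_point S D by (rule X)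
  fix F p assume F: "F \<subseteq> gap_midpoints S" "p \<in> gap_midpoints S" "four_point (S \<union> F) D"
  have FP: "S \<union> F \<subseteq> P" using F X unfolding gap_midpoints_def midpoint_def by blast
  obtain s t where st: "gap S s t" "midpoint s t p" using F(2) unfolding gap_midpoints_def by blast
  have stS: "s \<in> S" "t \<in> S" "s \<noteq> t" using st unfolding gap_def by auto
  have stP: "s \<in> P" "t \<in> P" using stS X by auto
  have pP: "p \<in> P" and sp: "btw D s p t" using st midpoint_btw stP unfolding midpoint_def by auto
  have tp: "btw D t p s" using sp prod.btw_sym by blast
  have side: "btw D t p u" if "btw D t s u" "u \<in> P" for u using prod.btw_trans2(1)[OF that(1) tp] that stP pP by blast
  have side': "btw D s p u" if "btw D s t u" "u \<in> P" for u using prod.btw_trans2(1)[OF that(1) sp] that stP pP by blast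
  have hull: "btw D a b q" if "btw D a b x" "btw D a b y" "btw D x q y" "a \<in> P" "b \<in> P" "x \<in> P" "y \<in> P" "q \<in> P" for a b x y q
    using that A.btw_hull[of "fst a" "fst b" "fst x" "fst y" "fst q"] B.btw_hull[of "snd a" "snd b" "snd x" "snd y" "snd q"]
      P_fst_snd by (simp add: btw_D_iff)
  have cross: "p = q" if s't': "gap S s' t'" "midpoint s' t' q" and b: "btw D t s s'" "btw D s t t'" for s' t' q
  proof -
    have m: "s' \<in> S" "t' \<in> S" using s't' unfolding gap_def by auto
    have "btw D s' s t" using b prod.btw_sym by blast
    then have "btw D s' s t'" "btw D s' t t'" using S.btw_chain[of s' s t t'] b m stS by auto
    then have "(s = s' \<or> s = t') \<and> (t = s' \<or> t = t')" using s't' stS unfolding gap_def by blast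
    then have "midpoint s t q" using stS s't'(2) midpoint_sym by metis
    then show ?thesis using midpoint_unique st stP by blast
  qed
  show "four_point (insert p (S \<union> F)) D"
  proof (rule four_point_insert_between[OF F(3) FP pP _ _ sp])
    show "btw D s p u \<or> btw D t p u" if u: "u \<in> S \<union> F" for u
    proof (cases "u \<in> S")
      case True
      then show ?thesis using gap_side[OF X(2,3) st(1) True] side side' X by blast
    next
      case False
      then obtain s' t' where s't': "gap S s' t'" "midpoint s' t' u" using u F unfolding gap_midpoints_def by blast
      have m: "s' \<in> S" "t' \<in> S" using s't' unfolding gap_def by auto
      have mP: "s' \<in> P" "t' \<in> P" "u \<in> P" using m X u FP by auto
      have b: "btw D s' u t'" using midpoint_btw s't' mP by blast
      have c: "btw D t s s' \<or> btw D s t s'" "btw D t s t' \<or> btw D s t t'" using gap_side[OF X(2,3) st(1)] m by auto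
      have "p = u" if "btw D t s t'" "btw D s t s'"
      proof (rule cross)
        show "midpoint t' s' u" using s't' midpoint_sym by blast
        show "gap S t' s'" using s't'(1) prod.btw_sym unfolding gap_def by blast
      qed (use that in auto)
      moreover have "btw D s p p" using pP prod.btw_refl(2) by blast
      ultimately show ?thesis
        using c hull[OF _ _ b stP(2) stP(1) mP] hull[OF _ _ b stP mP] cross[OF s't'] side side' mP by metis
    qed
  qed (use stS in auto)
qed

lemma midpoint_act:
  assumes "midpoint s t p" "g \<in> carrier G" "s \<in> P" "t \<in> P"
  shows "midpoint (act g s) (act g t) (act g p)"
  using assms P_fst_snd act_P unfolding midpoint_def by (simp add: act_def)

lemma invariant_gap_midpoints:
  assumes "invariant S" "S \<subseteq> P" shows "invariant (gap_midpoints S)"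
  unfolding invariant_def
proof (intro ballI)
  fix g p assume g: "g \<in> carrier G" and "p \<in> gap_midpoints S"
  then obtain s t where st: "gap S s t" "midpoint s t p" unfolding gap_midpoints_def by blast
  have stS: "s \<in> S" "t \<in> S" "s \<noteq> t" using st unfolding gap_def by auto
  have stP: "s \<in> P" "t \<in> P" using stS assms by auto
  have inv: "act h u \<in> S" if "u \<in> S" "h \<in> carrier G" for u h using assms that unfolding invariant_def by blast
  have "gap S (act g s) (act g t)"
    unfolding gap_def
  proof (intro conjI ballI impI)
    show "act g s \<in> S" "act g t \<in> S" using inv stS g by auto
    show "act g s \<noteq> act g t" using stS act_inv_act(1) g stP by metis
    fix r assume r: "r \<in> S" "btw D (act g s) r (act g t)"
    let ?r = "act (inv g) r"
    have rP: "r \<in> P" "?r \<in> S" using r assms inv g by auto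
    then have "?r \<in> P" using assms by blast
    note rP = rP this
    have "act g ?r = r" using act_inv_act g rP by blast
    then have "btw D s ?r t" using btw_D_act[OF g stP(1) rP(3) stP(2)] r by simp
    then have "?r = s \<or> ?r = t" using st rP unfolding gap_def by blast
    then show "r = act g s \<or> r = act g t" using \<open>act g ?r = r\<close> by metis
  qed
  then show "act g p \<in> gap_midpoints S"
    using midpoint_act[OF st(2) g stP] unfolding gap_midpoints_def by blast
qed

section \<open>Closed sets without gaps are geodesic\<close>

lemma segment_closed:
  assumes X: "four_point S D" "S \<subseteq> P" "limits S \<subseteq> S" and xy: "x \<in> S" "y \<in> S"
    and v: "\<And>e. e > 0 \<Longrightarrow> \<exists>r\<in>S. btw D x r y \<and> \<bar>D x r - v\<bar> < e"
  shows "\<exists>r\<in>S. btw D x r y \<and> D x r = v"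
proof -
  interpret S: four_point S D by (rule X)
  have P: "x \<in> P" "y \<in> P" using xy X by auto
  have "\<exists>r. \<forall>n::nat. r n \<in> S \<and> btw D x (r n) y \<and> \<bar>D x (r n) - v\<bar> < inverse (real (Suc n))"
    by (rule choice) (use v in \<open>metis inverse_positive_iff_positive of_nat_0_less_iff zero_less_Suc\<close>)
  then obtain r where r: "\<And>n::nat. r n \<in> S" "\<And>n. btw D x (r n) y" "\<And>n. \<bar>D x (r n) - v\<bar> < inverse (real (Suc n))" by blast
  have rP: "r n \<in> P" for n using r X by auto
  have lim0: "(\<lambda>n. D x (r n)) \<longlonglongrightarrow> v"
  proof (rule LIMSEQ_I)
    fix e :: real assume "e > 0"
    then obtain N where N: "inverse (real (Suc N)) < e" using reals_Archimedean by blast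
    have "norm (D x (r n) - v) < e" if "n \<ge> N" for n
    proof -
      have "inverse (real (Suc n)) \<le> inverse (real (Suc N))" using that by simp
      then have "\<bar>D x (r n) - v\<bar> < e" using r(3)[of n] N by linarith
      then show ?thesis by simp
    qed
    then show "\<exists>no. \<forall>n\<ge>no. norm (D x (r n) - v) < e" by blast
  qed
  define a where "a n = d1 (fst x) (fst (r n))" for n
  define b where "b n = d2 (snd x) (snd (r n))" for n
  have b12: "btw d1 (fst x) (fst (r n)) (fst y)" "btw d2 (snd x) (snd (r n)) (snd y)" for n
    using r(2)[of n] btw_D_iff[OF P(1) rP P(2)] by auto
  have ab: "a n + b n = D x (r n)" for n unfolding a_def b_def D_def by simp
  have "\<bar>a n - a m\<bar> \<le> \<bar>D x (r n) - D x (r m)\<bar>" for n m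
  proof -
    have "\<bar>a n - a m\<bar> = d1 (fst (r n)) (fst (r m))"
      unfolding a_def using A.btw_dist[OF b12(1) b12(1)] P rP P_fst_snd by simp
    also have "\<dots> \<le> D (r n) (r m)" unfolding D_def by simp
    also have "\<dots> = \<bar>D x (r n) - D x (r m)\<bar>" using S.btw_dist[OF r(2) r(2)] xy r(1) by simp
    finally show ?thesis .
  qed
  moreover have "Cauchy (\<lambda>n. D x (r n))" using lim0 LIMSEQ_imp_Cauchy by blast
  ultimately have "Cauchy a" unfolding Cauchy_def dist_real_def by (meson order_le_less_trans)
  then obtain a0 where a0: "a \<longlonglongrightarrow> a0" using real_Cauchy_convergent unfolding convergent_def by blast
  have "(\<lambda>n. D x (r n) - a n) \<longlonglongrightarrow> v - a0" using tendsto_diff[OF lim0 a0] .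
  moreover have "(\<lambda>n. D x (r n) - a n) = b" by (rule ext) (simp add: ab[symmetric])
  ultimately have b0: "b \<longlonglongrightarrow> v - a0" by simp
  have an: "0 \<le> a n" "a n \<le> d1 (fst x) (fst y)" "0 \<le> b n" "b n \<le> d2 (snd x) (snd y)" for n
    using b12[of n] A.nonneg[of "fst (r n)" "fst y"] B.nonneg[of "snd (r n)" "snd y"]
      A.nonneg[of "fst x" "fst (r n)"] B.nonneg[of "snd x" "snd (r n)"]
    unfolding a_def b_def btw_def by linarith+
  have ra: "a0 \<in> {0..d1 (fst x) (fst y)}"
    using LIMSEQ_le_const[OF a0] LIMSEQ_le_const2[OF a0] an by auto
  have rb: "v - a0 \<in> {0..d2 (snd x) (snd y)}"
    using LIMSEQ_le_const[OF b0, of 0] LIMSEQ_le_const2[OF b0, of "d2 (snd x) (snd y)"] an by auto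
  obtain p1 where p1: "p1 \<in> T1" "d1 (fst x) p1 = a0" "d1 p1 (fst y) = d1 (fst x) (fst y) - a0"
    using A.geod[of "fst x" "fst y" a0] ra P P_fst_snd by auto
  obtain p2 where p2: "p2 \<in> T2" "d2 (snd x) p2 = v - a0" "d2 p2 (snd y) = d2 (snd x) (snd y) - (v - a0)"
    using B.geod[of "snd x" "snd y" "v - a0"] rb P P_fst_snd by auto
  let ?p = "(p1, p2)"
  have pP: "?p \<in> P" unfolding P_def using p1 p2 by simp
  have bp: "btw d1 (fst x) p1 (fst y)" "btw d2 (snd x) p2 (snd y)" using p1 p2 unfolding btw_def by auto
  have Dp: "D ?p (r n) = \<bar>a0 - a n\<bar> + \<bar>(v - a0) - b n\<bar>" for n
    using A.btw_dist[OF bp(1) b12(1)[of n]] B.btw_dist[OF bp(2) b12(2)[of n]] P rP P_fst_snd p1 p2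
    unfolding D_def a_def b_def by simp
  have "(\<lambda>n. \<bar>a0 - a n\<bar> + \<bar>(v - a0) - b n\<bar>) \<longlonglongrightarrow> \<bar>a0 - a0\<bar> + \<bar>(v - a0) - (v - a0)\<bar>"
    by (intro tendsto_intros a0 b0)
  then have lim: "(\<lambda>n. D ?p (r n)) \<longlonglongrightarrow> 0" using Dp by simp
  have "?p \<in> limits S"
    unfolding limits_def
  proof (intro CollectI conjI allI impI pP)
    fix e :: real assume "e > 0"
    then obtain N where "\<forall>n\<ge>N. norm (D ?p (r n) - 0) < e" using LIMSEQ_D[OF lim] by blast
    then have "D ?p (r N) < e" by auto
    then show "\<exists>r\<in>S. D ?p r < e" using r(1) by blast
  qed
  then have "?p \<in> S" using X(3) by blast
  moreover have "btw D x ?p y" using btw_D_iff[OF P(1) pP P(2)] bp by simp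
  moreover have "D x ?p = v" unfolding D_def using p1 p2 by simp
  ultimately show ?thesis by blast
qed

text \<open>The distances from \<open>x\<close> at which \<open>S\<close> meets the segment form a
  closed set. If \<open>t\<close> is missing, the points at the last value below and the first value
  above it bound a gap.\<close>

lemma geodesic_of_closed:
  assumes X: "four_point S D" "S \<subseteq> P" "limits S \<subseteq> S" and ng: "\<And>s t. \<not> gap S s t"
  shows "geodesic_four_point S D"
proof -
  interpret S: four_point S D by (rule X)
  show ?thesis
  proof unfold_locales
    fix x y t assume x: "x \<in> S" "y \<in> S" and t: "0 \<le> t" "t \<le> D x y"
    define V where "V = {D x r | r. r \<in> S \<and> btw D x r y}"
    have V: "0 \<in> V" "D x y \<in> V" unfolding V_def using x S.mdist_zero[of x] S.btw_refl by (metis (mono_tags, lifting) mem_Collect_eq)+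
    have cl: "v \<in> V" if "\<And>e. e > 0 \<Longrightarrow> \<exists>w\<in>V. \<bar>w - v\<bar> < e" for v
    proof -
      have "\<exists>r\<in>S. btw D x r y \<and> D x r = v"
        by (rule segment_closed[OF X x]) (use that in \<open>unfold V_def, blast\<close>)
      then show ?thesis unfolding V_def by blast
    qed
    then have "closure V \<subseteq> V" by (auto simp: closure_approachable dist_real_def)
    then have "closed V" by (simp add: closure_subset_eq)
    then have "compact (V \<inter> {0..t})" "compact (V \<inter> {t..D x y})" by (simp_all add: closed_Int_compact)
    moreover have "0 \<in> V \<inter> {0..t}" "D x y \<in> V \<inter> {t..D x y}" using V t by auto
    ultimately obtain \<alpha> \<beta> where ab: "\<alpha> \<in> V \<inter> {0..t}" "\<And>w. w \<in> V \<inter> {0..t} \<Longrightarrow> w \<le> \<alpha>"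
        "\<beta> \<in> V \<inter> {t..D x y}" "\<And>w. w \<in> V \<inter> {t..D x y} \<Longrightarrow> \<beta> \<le> w"
      using compact_attains_sup[of "V \<inter> {0..t}"] compact_attains_inf[of "V \<inter> {t..D x y}"] by (metis empty_iff)
    have V_bd: "0 \<le> w \<and> w \<le> D x y" if w: "w \<in> V" for w
    proof -
      obtain r where "w = D x r" "D x r + D r y = D x y" using w unfolding V_def btw_def by blast
      then show ?thesis using S.nonneg[of x r] S.nonneg[of r y] by linarith
    qed
    have \<alpha>: "\<alpha> \<in> V" "\<alpha> \<le> t" "\<And>w. w \<in> V \<Longrightarrow> w \<le> t \<Longrightarrow> w \<le> \<alpha>" using ab(1,2) V_bd by auto
    have \<beta>: "\<beta> \<in> V" "t \<le> \<beta>" "\<And>w. w \<in> V \<Longrightarrow> t \<le> w \<Longrightarrow> \<beta> \<le> w" using ab(3,4) V_bd by auto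
    obtain s where s: "s \<in> S" "btw D x s y" "D x s = \<alpha>" using \<alpha>(1) unfolding V_def by blast
    obtain s' where s': "s' \<in> S" "btw D x s' y" "D x s' = \<beta>" using \<beta>(1) unfolding V_def by blast
    have "\<alpha> = \<beta>"
    proof (rule ccontr)
      assume "\<alpha> \<noteq> \<beta>"
      then have lt: "\<alpha> < \<beta>" using \<alpha>(2) \<beta>(2) by simp
      have "D s s' = \<beta> - \<alpha>" using S.btw_dist[OF s(2) s'(2)] s s' x lt by simp
      then have b: "btw D x s s'" using s s' unfolding btw_def by simp
      have "gap S s s'" unfolding gap_def
      proof (intro conjI ballI impI)
        show "s \<noteq> s'" using s s' lt by blast
        fix r assume r: "r \<in> S" "btw D s r s'"
        have 1: "btw D x r s'" "btw D x s r" using S.btw_trans1[OF b r(2)] x s s' r by auto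
        have 2: "btw D x r y" using S.btw_trans2(1)[OF s'(2) 1(1)] x s' r by blast
        then have rV: "D x r \<in> V" unfolding V_def using r by blast
        have ge: "\<alpha> \<le> D x r" "D x r \<le> \<beta>" using 1 s s' S.nonneg[of s r] S.nonneg[of r s'] unfolding btw_def by linarith+
        show "r = s \<or> r = s'"
        proof (cases "D x r \<le> t")
          case True
          then have "D x r = D x s" using \<alpha>(3)[OF rV] ge s by simp
          then show ?thesis using S.btw_unique[OF 2 s(2)] x r s by blast
        next
          case False
          then have "D x r = D x s'" using \<beta>(3)[OF rV] ge s' by simp
          then show ?thesis using S.btw_unique[OF 2 s'(2)] x r s' by blast
        qed
      qed (use s s' in auto)
      then show False using ng by blast
    qed
    then have "D x s = t" using s \<alpha>(2) \<beta>(2) by simp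
    then show "\<exists>p\<in>S. D x p = t \<and> D p y = D x y - t" using s unfolding btw_def by (intro bexI[of _ s]) auto
  qed
qed

text \<open>A maximal invariant set satisfying the four-point condition is a tree: it contains the medians
  and the limits of its points, and the midpoints of its gaps.\<close>

theorem exists_geodesic_extension:
  assumes Z: "Z \<subseteq> P" "invariant Z" "four_point Z D"
  shows "\<exists>S. Z \<subseteq> S \<and> S \<subseteq> P \<and> invariant S \<and> geodesic_four_point S D"
proof -
  define \<A> where "\<A> = {S. Z \<subseteq> S \<and> S \<subseteq> P \<and> invariant S \<and> four_point S D}"
  have "\<exists>M\<in>\<A>. \<forall>X\<in>\<A>. M \<subseteq> X \<longrightarrow> X = M"
  proof (rule subset_Zorn_nonempty)
    show "\<A> \<noteq> {}" using Z unfolding \<A>_def by blast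
    fix \<C> assume \<C>: "\<C> \<noteq> {}" "subset.chain \<A> \<C>"
    then have sub: "\<C> \<subseteq> \<A>" unfolding subset.chain_def by blast
    have "four_point (\<Union>\<C>) D"
    proof (rule four_point_PI)
      show "\<Union>\<C> \<subseteq> P" using sub unfolding \<A>_def by blast
      fix x y z w assume x: "x \<in> \<Union>\<C>" "y \<in> \<Union>\<C>" "z \<in> \<Union>\<C>" "w \<in> \<Union>\<C>"
      then have "finite {x, y, z, w}" "{x, y, z, w} \<subseteq> \<Union>\<C>" by auto
      then obtain X where X: "X \<in> \<C>" "{x, y, z, w} \<subseteq> X"
        using finite_subset_Union_chain[OF _ _ \<C>] by metis
      interpret X: four_point X D using X sub unfolding \<A>_def by blast
      show "D x y + D z w \<le> max (D x z + D y w) (D x w + D y z)" using X.four_point X by blast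
    qed
    moreover have "invariant (\<Union>\<C>)" using sub unfolding \<A>_def invariant_def by blast
    moreover have "Z \<subseteq> \<Union>\<C>" "\<Union>\<C> \<subseteq> P" using sub \<C>(1) unfolding \<A>_def by blast+
    ultimately show "\<Union>\<C> \<in> \<A>" unfolding \<A>_def by blast
  qed
  then obtain S where S: "S \<in> \<A>" and max: "\<And>X. X \<in> \<A> \<Longrightarrow> S \<subseteq> X \<Longrightarrow> X = S" by blast
  have S': "Z \<subseteq> S" "S \<subseteq> P" "invariant S" "four_point S D" using S unfolding \<A>_def by auto
  have ext: "N \<subseteq> S" if "N \<subseteq> P" "invariant N" "four_point (S \<union> N) D" for N
  proof -
    have "S \<union> N \<in> \<A>" using S' that unfolding \<A>_def invariant_def by blast
    then show ?thesis using max[of "S \<union> N"] by blast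
  qed
  have med: "medians S \<subseteq> S"
    using ext[OF _ invariant_medians[OF S'(3,2)] four_point_medians[OF S'(4,2)]] unfolding medians_def by blast
  have lim: "limits S \<subseteq> S"
    using ext[OF _ invariant_limits[OF S'(3,2)] four_point_limits[OF S'(4,2)]] unfolding limits_def by blast
  have mid: "gap_midpoints S \<subseteq> S"
    using ext[OF _ invariant_gap_midpoints[OF S'(3,2)] four_point_gap_midpoints[OF S'(4,2) med]]
    unfolding gap_midpoints_def midpoint_def by blast
  have "\<not> gap S s t" for s t
  proof
    assume g: "gap S s t"
    have st: "s \<in> S" "t \<in> S" "s \<noteq> t" using g unfolding gap_def by auto
    have P: "s \<in> P" "t \<in> P" using st S' by auto
    obtain p where p: "midpoint s t p" using exists_midpoint P by blast
    then have pS: "p \<in> S" using mid g unfolding gap_midpoints_def by blast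
    have b: "btw D s p t" using midpoint_btw p P by blast
    then have "p = s \<or> p = t" using g pS unfolding gap_def by blast
    moreover have "D s p = D p t" using p unfolding midpoint_def D_def by simp
    ultimately have "D s t = 0" using P b unfolding btw_def by auto
    then show False using st P by simp
  qed
  then show ?thesis using geodesic_of_closed[OF S'(4,2) lim] S' by blast
qed

end

section \<open>Common hyperbolic elements and the orbit of the base points\<close>

context tree_action
begin

lemma len_pow:
  fixes n :: nat
  assumes g: "g \<in> carrier G" shows "len (g [^] n) = n * len g"
proof -
  obtain x where x: "x \<in> min_set g" using min_set_nonempty[OF g] by blast
  have xT: "x \<in> T" using x min_set_in by blast
  have e: "\<phi> (g [^] n) (\<phi> (g [^] n) x) = \<phi> (g [^] (n + n)) x"
    using act_mult[of "g [^] n" "g [^] n" x] xT g by (simp add: nat_pow_mult)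
  have "btw d x (\<phi> (g [^] n) x) (\<phi> (g [^] n) (\<phi> (g [^] n) x))"
    unfolding e btw_def using dist_pow_min_set[OF g x, of 0 n] dist_pow_min_set[OF g x, of n "n + n"]
      dist_pow_min_set[OF g x, of 0 "n + n"] xT by (simp add: algebra_simps)
  then have "len (g [^] n) = d x (\<phi> (g [^] n) x)" using len_eq xT g by simp
  then show ?thesis using dist_pow_min_set[OF g x, of 0 n] xT by simp
qed

lemma not_hyperbolic_fixes:
  assumes "g \<in> carrier G" "\<not> 0 < len g" shows "\<exists>p\<in>T. \<phi> g p = p"
  using hyperbolic_iff assms unfolding hyperbolic_def by blast

end

text \<open>The values are picked one after the other, since the bound for a later one depends on
  the earlier ones; \<open>B i\<close> provides in advance for what all later indices ask of
  \<open>n i\<close>.\<close>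

lemma exists_spaced_sequence:
  fixes Q :: "nat \<Rightarrow> nat \<Rightarrow> nat \<Rightarrow> nat \<Rightarrow> bool"
  assumes Q: "\<And>i j. \<forall>\<^sub>F n in sequentially. \<forall>\<^sub>F m in sequentially. Q i n j m"
  shows "\<exists>n :: nat \<Rightarrow> nat. \<forall>j<r. \<forall>i<j. Q i (n i) j (n j)"
proof -
  from Q[unfolded eventually_sequentially] obtain N where N: "\<And>i j n. n \<ge> N i j \<Longrightarrow> \<exists>M. \<forall>m\<ge>M. Q i n j m" by metis
  define B where "B i = Max ((\<lambda>j. N i j) ` {..r})" for i
  have B: "N i j \<le> B i" if "j \<le> r" for i j unfolding B_def using that by simp
  have "\<exists>n :: nat \<Rightarrow> nat. (\<forall>i<k. B i \<le> n i) \<and> (\<forall>j<k. \<forall>i<j. Q i (n i) j (n j))" if "k \<le> r" for k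
    using that
  proof (induction k)
    case (Suc k)
    then obtain n where n: "\<forall>i<k. B i \<le> n i" "\<forall>j<k. \<forall>i<j. Q i (n i) j (n j)" by auto
    have "\<exists>M. \<forall>m\<ge>M. Q i (n i) k m" if "i < k" for i
      using N[of i k "n i"] B[of k i] n(1) that Suc.prems by (meson Suc_leD le_trans)
    then obtain M where M: "\<And>i m. i < k \<Longrightarrow> m \<ge> M i \<Longrightarrow> Q i (n i) k m" by metis
    define m where "m = B k + (\<Sum>i<k. M i)"
    have "M i \<le> m" if "i < k" for i
      using member_le_sum[of i "{..<k}" M] that unfolding m_def by simp
    then show ?case using n M by (intro exI[of _ "n(k := m)"]) (auto simp: less_Suc_eq m_def)
  qed auto
  then show ?thesis by blast
qed

context two_trees
begin

text \<open>In the remaining case each of \<open>g\<close>, \<open>h\<close> is elliptic where the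
  other is hyperbolic. The first tree determines \<open>i\<close> for all \<open>j\<close>, then the
  second determines \<open>j\<close>; \<open>h^i g^j\<close> and \<open>g^j h^i\<close> are
  conjugate.\<close>

lemma exists_common_hyperbolic:
  assumes "irreducible_action G T1 d1 \<phi>1" "irreducible_action G T2 d2 \<phi>2"
  shows "\<exists>c\<in>carrier G. 0 < A.len c \<and> 0 < B.len c"
proof -
  obtain g where g: "g \<in> carrier G" "0 < A.len g" using A.irreducible_disjoint assms by blast
  obtain h where h: "h \<in> carrier G" "0 < B.len h" using B.irreducible_disjoint assms by blast
  show ?thesis
  proof (cases "0 < B.len g \<or> 0 < A.len h")
    case True then show ?thesis using g h by blast
  next
    case False
    obtain p where p: "p \<in> T1" "\<phi>1 h p = p" using A.not_hyperbolic_fixes[OF h(1)] False by blast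
    obtain q where q: "q \<in> T2" "\<phi>2 g q = q" using B.not_hyperbolic_fixes[OF g(1)] False by blast
    obtain i :: nat where i: "i \<in> {1, 2}" "\<And>j::nat. j \<ge> 1 \<Longrightarrow> 0 < A.len (g [^] j \<otimes> h [^] i)"
      using A.hyperbolic_mult_elliptic[OF g h(1) p] by blast
    let ?h = "h [^] i"
    have h': "?h \<in> carrier G" "0 < B.len ?h" using h i B.len_pow by auto
    obtain j :: nat where j: "j \<in> {1, 2}" "\<And>k::nat. k \<ge> 1 \<Longrightarrow> 0 < B.len (?h [^] k \<otimes> g [^] j)"
      using B.hyperbolic_mult_elliptic[OF h' g(1) q] by blast
    let ?c = "g [^] j \<otimes> ?h"
    have "?h \<otimes> g [^] j = A.conjg ?h ?c" unfolding A.conjg_def using g h by (simp add: A.m_assoc)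
    then have "B.len (?h \<otimes> g [^] j) = B.len ?c" using B.min_set_conjg(2)[of ?c ?h] g h by simp
    moreover have "?h [^] (1::nat) = ?h" using h' by simp
    ultimately have "0 < B.len ?c" using j(2)[of 1] by simp
    moreover have "0 < A.len ?c" using i j by auto
    ultimately show ?thesis using g h by blast
  qed
qed

text \<open>\<open>w1\<close> works in the first tree and \<open>w2\<close> in the second;
  \<open>w1 c^n w2\<close> works in both for almost all \<open>n\<close>. In the first,
  \<open>c^n\<close> pushes the axis of \<open>?m\<close> off that of \<open>?l\<close>, which
  misses the axis of \<open>c\<close>. In the second the roles are exchanged: \<open>c^-n\<close>
  pushes the axis of \<open>?l\<close> off that of \<open>?m\<close>.\<close>

lemma exists_common_disjoint_conjugate:
  assumes irr: "irreducible_action G T1 d1 \<phi>1" "irreducible_action G T2 d2 \<phi>2"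
    and c: "c \<in> carrier G" "0 < A.len c" "0 < B.len c"
  shows "\<exists>w\<in>carrier G. A.disjoint_axes c (A.conjg w c) \<and> B.disjoint_axes c (A.conjg w c)"
proof -
  obtain w1 where w1: "w1 \<in> carrier G" "A.disjoint_axes c (A.conjg w1 c)" using A.exists_disjoint_conjugate irr c by blast
  obtain w2 where w2: "w2 \<in> carrier G" "B.disjoint_axes c (A.conjg w2 c)" using B.exists_disjoint_conjugate irr c by blast
  let ?l = "A.conjg (inv w1) c" let ?m = "A.conjg w2 c"
  have C: "?l \<in> carrier G" "?m \<in> carrier G" "inv c \<in> carrier G" using c w1 w2 by auto
  have inv1: "A.conjg (inv w1) (A.conjg w1 c) = c"
    using A.conjg_mult[of "inv w1" w1 c] w1 c unfolding A.conjg_def by simp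
  have inv1': "A.conjg w1 ?l = c"
    using A.conjg_mult[of w1 "inv w1" c] w1 c unfolding A.conjg_def by simp
  have "A.disjoint_axes ?l c" using A.disjoint_axes_conjg[of c "A.conjg w1 c" "inv w1"] inv1 w1 c by simp
  then have 1: "finite {n::nat. \<not> A.disjoint_axes ?l (A.conjg (c [^] n) ?m)}"
    using A.finite_not_disjoint_axes[OF C(1) c(1,2) C(2)] A.min_set_conjg(2) c w2 by simp
  have "B.disjoint_axes ?m (inv c)" using w2 B.disjoint_axes_inv[OF c(1)] B.disjoint_axes_sym by blast
  then have 2: "finite {n::nat. \<not> B.disjoint_axes ?m (A.conjg (inv c [^] n) ?l)}"
    using B.finite_not_disjoint_axes[OF C(2) C(3) _ C(1)] B.min_set_conjg(2) B.min_set_inv c w1 by simp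
  have "finite ({n::nat. \<not> A.disjoint_axes ?l (A.conjg (c [^] n) ?m)} \<union> {n::nat. \<not> B.disjoint_axes ?m (A.conjg (inv c [^] n) ?l)})"
    using 1 2 by blast
  then obtain n :: nat where n: "A.disjoint_axes ?l (A.conjg (c [^] n) ?m)" "B.disjoint_axes ?m (A.conjg (inv c [^] n) ?l)"
    using ex_new_if_finite[OF infinite_UNIV_nat] by blast
  let ?w = "w1 \<otimes> (c [^] n \<otimes> w2)"
  have w: "?w \<in> carrier G" using w1 w2 c by simp
  have e1: "A.conjg w1 (A.conjg (c [^] n) ?m) = A.conjg ?w c"
    using w1 w2 c by (simp add: A.conjg_mult)
  have "A.disjoint_axes c (A.conjg ?w c)"
    using A.disjoint_axes_conjg[of ?l "A.conjg (c [^] n) ?m" w1] n(1) inv1' e1 w1 C c by simp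
  moreover have "B.disjoint_axes c (A.conjg ?w c)"
  proof -
    let ?k = "w1 \<otimes> c [^] n"
    have k: "?k \<in> carrier G" using w1 c by simp
    have "A.conjg (c [^] n) (A.conjg (inv c [^] n) ?l) = ?l"
      using A.conjg_mult[of "c [^] n" "inv c [^] n" ?l] c C by (simp add: A.nat_pow_inv) (simp add: A.conjg_def)
    then have e2: "A.conjg ?k (A.conjg (inv c [^] n) ?l) = c" using inv1' w1 c C by (simp add: A.conjg_mult)
    have e3: "A.conjg ?k ?m = A.conjg ?w c" using w1 w2 c by (simp add: A.conjg_mult)
    have "B.disjoint_axes (A.conjg ?w c) c" using B.disjoint_axes_conjg[of ?m "A.conjg (inv c [^] n) ?l" ?k] n(2) e2 e3 k C by simp
    then show ?thesis using B.disjoint_axes_sym by blast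
  qed
  ultimately show ?thesis using w by blast
qed

theorem four_point_orbit:
  assumes bA: "based_tree G T1 d1 \<phi>1 c a y1" and bB: "based_tree G T2 d2 \<phi>2 c a y2"
    and bC: "based_tree G T0 d0 \<phi>0 c a y0"
    and len: "\<And>g. g \<in> carrier G \<Longrightarrow> tree_length T0 d0 \<phi>0 g = A.len g + B.len g"
  shows "four_point ((\<lambda>g. act g (y1, y2)) ` carrier G) D"
proof -
  interpret bA: based_tree G T1 d1 \<phi>1 c a y1 by (rule bA)
  interpret bB: based_tree G T2 d2 \<phi>2 c a y2 by (rule bB)
  interpret bC: based_tree G T0 d0 \<phi>0 c a y0 by (rule bC)
  let ?y = "(y1, y2)"
  have yP: "?y \<in> P" unfolding P_def using bA.y bB.y by simp
  note ca = bA.c bA.a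
  show ?thesis
  proof (rule four_point_PI)
    show "(\<lambda>g. act g ?y) ` carrier G \<subseteq> P" using act_P yP by blast
    fix x0 x1 x2 x3
    assume "x0 \<in> (\<lambda>g. act g ?y) ` carrier G" "x1 \<in> (\<lambda>g. act g ?y) ` carrier G"
      "x2 \<in> (\<lambda>g. act g ?y) ` carrier G" "x3 \<in> (\<lambda>g. act g ?y) ` carrier G"
    then obtain g0 g1 g2 g3 where g: "g0 \<in> carrier G" "g1 \<in> carrier G" "g2 \<in> carrier G" "g3 \<in> carrier G"
      and x: "x0 = act g0 ?y" "x1 = act g1 ?y" "x2 = act g2 ?y" "x3 = act g3 ?y" by blast
    \<comment> \<open>Twelve indices, three for each of the four orbit points:
      \<open>i div 3\<close> selects the point, and \<open>i mod 3\<close> selects which of the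
      three far points of \<open>base_median\<close> is used.\<close>
    define k where "k i = (if i div 3 = 0 then g0 else if i div 3 = 1 then g1 else if i div 3 = 2 then g2 else g3)
       \<otimes> (if i mod 3 = 2 then a else \<one>)" for i :: nat
    define e where "e i = (if i mod 3 = 1 then inv c else c)" for i :: nat
    have kC: "k i \<in> carrier G" for i unfolding k_def using g ca by simp
    have e: "e i \<in> {c, inv c}" for i unfolding e_def by simp
    have eC: "e i \<in> carrier G" for i using e[of i] ca by auto
    define w where "w i n j m = inv (e i [^] n) \<otimes> (inv (k i) \<otimes> k j) \<otimes> e j [^] m" for i n j m :: nat
    have "\<forall>\<^sub>F n in sequentially. \<forall>\<^sub>F m in sequentially.
        bA.generic (w i n j m) \<and> bB.generic (w i n j m) \<and> bC.generic (w i n j m)" for i j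
    proof -
      have t: "inv (k i) \<otimes> k j \<in> carrier G" using kC by simp
      show ?thesis
        using bA.eventually_generic[OF e e t, of i j] bB.eventually_generic[OF e e t, of i j]
          bC.eventually_generic[OF e e t, of i j] unfolding w_def by (simp add: eventually_conj_iff)
    qed
    then obtain n :: "nat \<Rightarrow> nat" where
      n: "\<And>i j. i < j \<Longrightarrow> j < 12 \<Longrightarrow> bA.generic (w i (n i) j (n j)) \<and> bB.generic (w i (n i) j (n j)) \<and> bC.generic (w i (n i) j (n j))"
      using exists_spaced_sequence[of "\<lambda>i n j m. bA.generic (w i n j m) \<and> bB.generic (w i n j m) \<and> bC.generic (w i n j m)" 12]
      by blast
    define u where "u i = k i \<otimes> e i [^] n i" for i
    have uC: "u i \<in> carrier G" for i unfolding u_def using kC eC by simp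
    have uw: "inv (u i) \<otimes> u j = w i (n i) j (n j)" for i j
      unfolding u_def w_def using kC eC by (simp add: A.inv_mult_group A.m_assoc)
    define U where "U i = act (u i) ?y" for i
    have UP: "U i \<in> P" for i unfolding U_def using act_P uC yP by blast
    \<comment> \<open>Halving the length formula in each tree gives the distance plus the
      displacement of the base point by \<open>a\<close>; \<open>K\<close> collects the
      displacements.\<close>
    define K where "K = d1 y1 (\<phi>1 a y1) + d2 y2 (\<phi>2 a y2) - d0 y0 (\<phi>0 a y0)"
    have dist0: "d0 (\<phi>0 (u i) y0) (\<phi>0 (u j) y0) = D (U i) (U j) + K" if ij: "i < j" "j < 12" for i j
    proof -
      let ?w = "inv (u i) \<otimes> u j"
      have wC: "?w \<in> carrier G" using uC by simp
      have generic: "bA.generic ?w" "bB.generic ?w" "bC.generic ?w" unfolding uw using n ij by auto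
      have "d0 (\<phi>0 (u i) y0) (\<phi>0 (u j) y0) = d0 y0 (\<phi>0 ?w y0)"
        using bC.act_dist_inv[of "inv (u i)" y0 "\<phi>0 (u j) y0"] uC bC.y by (simp add: bC.act_mult)
      moreover have "d1 (\<phi>1 (u i) y1) (\<phi>1 (u j) y1) = d1 y1 (\<phi>1 ?w y1)"
        using A.act_dist_inv[of "inv (u i)" y1 "\<phi>1 (u j) y1"] uC bA.y by (simp add: A.act_mult)
      moreover have "d2 (\<phi>2 (u i) y2) (\<phi>2 (u j) y2) = d2 y2 (\<phi>2 ?w y2)"
        using B.act_dist_inv[of "inv (u i)" y2 "\<phi>2 (u j) y2"] uC bB.y by (simp add: B.act_mult)
      moreover have "tree_length T0 d0 \<phi>0 (a \<otimes> ?w \<otimes> a \<otimes> inv ?w) = A.len (a \<otimes> ?w \<otimes> a \<otimes> inv ?w) + B.len (a \<otimes> ?w \<otimes> a \<otimes> inv ?w)"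
        using len wC ca by simp
      ultimately show ?thesis
        using bA.generic_len[OF generic(1)] bB.generic_len[OF generic(2)] bC.generic_len[OF generic(3)]
        unfolding U_def D_def act_def K_def fst_conv snd_conv by argo
    qed
    then have dist: "d0 (\<phi>0 (u i) y0) (\<phi>0 (u j) y0) = D (U i) (U j) + K" if "i \<noteq> j" "i < 12" "j < 12" for i j
      using that dist0[of i j] dist0[of j i] bC.commute prod.commute by (cases "i < j") auto
    have four: "four_point (U ` {..<12}) D"
    proof (rule four_point_PI)
      show "U ` {..<12} \<subseteq> P" using UP by blast
      fix v0 v1 v2 v3 assume "v0 \<in> U ` {..<12}" "v1 \<in> U ` {..<12}" "v2 \<in> U ` {..<12}" "v3 \<in> U ` {..<12}"
      then obtain i0 i1 i2 i3 where i: "i0 < 12" "i1 < 12" "i2 < 12" "i3 < 12"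
        and v: "v0 = U i0" "v1 = U i1" "v2 = U i2" "v3 = U i3" by blast
      have tri: "D (U p) (U q) \<le> D (U p) (U r) + D (U r) (U q)" for p q r by (rule prod.triangle[OF UP UP UP])
      have com: "D (U p) (U q) = D (U q) (U p)" for p q by (rule prod.commute)
      have zero: "D (U p) (U p) = 0" for p using UP by simp
      \<comment> \<open>The comparison with \<open>d0\<close> holds for distinct indices only. If
        all four are distinct, every sum contains \<open>2 * K\<close>; coincidences reduce to the
        triangle inequality or to an equality.\<close>
      consider "i0 = i1" | "i2 = i3" | "i0 = i2" | "i0 = i3" | "i1 = i2" | "i1 = i3"
        | "i0 \<noteq> i1" "i2 \<noteq> i3" "i0 \<noteq> i2" "i0 \<noteq> i3" "i1 \<noteq> i2" "i1 \<noteq> i3" by blast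
      then show "D v0 v1 + D v2 v3 \<le> max (D v0 v2 + D v1 v3) (D v0 v3 + D v1 v2)"
      proof cases
        case 1 show ?thesis unfolding v 1 le_max_iff_disj using tri[of i2 i3 i1] com[of i2 i1] zero[of i1] by linarith
      next
        case 2 show ?thesis unfolding v 2 le_max_iff_disj using tri[of i0 i1 i3] com[of i3 i1] zero[of i3] by linarith
      next
        case 3 show ?thesis unfolding v 3 le_max_iff_disj using com[of i2 i1] by linarith
      next
        case 4 show ?thesis unfolding v 4 le_max_iff_disj using com[of i3 i1] com[of i3 i2] by linarith
      next
        case 5 show ?thesis unfolding v 5 le_max_iff_disj by linarith
      next
        case 6 show ?thesis unfolding v 6 le_max_iff_disj using com[of i2 i3] by linarith
      next
        case 7
        show ?thesis
          using bC.four_point[of "\<phi>0 (u i0) y0" "\<phi>0 (u i1) y0" "\<phi>0 (u i2) y0" "\<phi>0 (u i3) y0"] 7 i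
          unfolding v using bC.y uC by (simp add: dist max_def split: if_splits)
      qed
    qed
    have med: "act h ?y \<in> medians (U ` {..<12})"
      if h: "h \<in> carrier G" and i: "i < 4" and k: "k (3 * i) = h" "k (3 * i + 1) = h" "k (3 * i + 2) = h \<otimes> a" for h i
    proof -
      have m: "U (3 * i) \<in> U ` {..<12}" "U (3 * i + 1) \<in> U ` {..<12}" "U (3 * i + 2) \<in> U ` {..<12}"
        using i by auto
      have hP: "act h ?y \<in> P" using act_P h yP by blast
      define n0 n1 n2 where "n0 = n (3 * i)" and "n1 = n (3 * i + 1)" and "n2 = n (3 * i + 2)"
      have mods: "3 * i mod 3 = 0" "(3 * i + 1) mod 3 = 1" "(3 * i + 2) mod 3 = 2" by presburger+
      have ee: "e (3 * i) = c" "e (3 * i + 1) = inv c" "e (3 * i + 2) = c" unfolding e_def mods by simp_all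
      have uu: "u (3 * i) = h \<otimes> c [^] n0" "u (3 * i + 1) = h \<otimes> inv c [^] n1" "u (3 * i + 2) = h \<otimes> (a \<otimes> c [^] n2)"
        unfolding u_def k ee n0_def n1_def n2_def using h ca by (simp_all add: A.m_assoc)
      have actm: "act (h \<otimes> g) ?y = act h (act g ?y)" if "g \<in> carrier G" for g
        unfolding act_def using that h bA.y bB.y by (simp add: A.act_mult B.act_mult)
      have gP: "act g ?y \<in> P" if "g \<in> carrier G" for g using act_P that yP by blast
      have bt: "btw D (act (h \<otimes> g) ?y) (act h ?y) (act (h \<otimes> g') ?y)"
        if "g \<in> carrier G" "g' \<in> carrier G" "btw d1 (\<phi>1 g y1) y1 (\<phi>1 g' y1)" "btw d2 (\<phi>2 g y2) y2 (\<phi>2 g' y2)" for g g'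
      proof -
        have "btw D (act g ?y) ?y (act g' ?y)"
          unfolding btw_D_iff[OF gP[OF that(1)] yP gP[OF that(2)]] using that by (simp add: act_def)
        then show ?thesis
          unfolding actm[OF that(1)] actm[OF that(2)] using btw_D_act[OF h gP[OF that(1)] yP gP[OF that(2)]] by blast
      qed
      have C: "c [^] n0 \<in> carrier G" "inv c [^] n1 \<in> carrier G" "a \<otimes> c [^] n2 \<in> carrier G" using ca by auto
      have "btw D (U (3 * i)) (act h ?y) (U (3 * i + 1))"
        unfolding U_def uu by (rule bt[OF C(1,2) bA.base_median(1) bB.base_median(1)])
      moreover have "btw D (U (3 * i + 1)) (act h ?y) (U (3 * i + 2))"
        unfolding U_def uu by (rule bt[OF C(2,3)]) (rule bA.base_median(2) bB.base_median(2), simp)+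
      moreover have "btw D (U (3 * i)) (act h ?y) (U (3 * i + 2))"
        unfolding U_def uu by (rule bt[OF C(1,3)]) (rule bA.base_median(2) bB.base_median(2), simp)+
      ultimately show ?thesis unfolding medians_def using hP m by blast
    qed
    have "x0 \<in> medians (U ` {..<12})" unfolding x by (rule med[of _ 0]) (use g ca in \<open>simp_all add: k_def\<close>)
    moreover have "x1 \<in> medians (U ` {..<12})" unfolding x by (rule med[of _ 1]) (use g ca in \<open>simp_all add: k_def\<close>)
    moreover have "x2 \<in> medians (U ` {..<12})" unfolding x by (rule med[of _ 2]) (use g ca in \<open>simp_all add: k_def\<close>)
    moreover have "x3 \<in> medians (U ` {..<12})" unfolding x by (rule med[of _ 3]) (use g ca in \<open>simp_all add: k_def\<close>)
    moreover have "U ` {..<12} \<subseteq> P" using UP by blast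
    then have "four_point (U ` {..<12} \<union> medians (U ` {..<12})) D" using four_point_medians[OF four] by blast
    ultimately show "D x0 x1 + D x2 x3 \<le> max (D x0 x2 + D x1 x3) (D x0 x3 + D x1 x2)"
      using four_point.four_point[of "U ` {..<12} \<union> medians (U ` {..<12})" D x0 x1 x2 x3] by blast
  qed
qed

end

section \<open>Common refinements and length functions\<close>

text \<open>A monotone function can be discontinuous only by jumping over values. Continuity is not
  part of the definition of a collapse map; along segments it is obtained from here.\<close>

lemma mono_surj_continuous_on:
  fixes F :: "real \<Rightarrow> real"
  assumes mono: "\<And>s t. \<lbrakk>s \<in> {a..b}; t \<in> {a..b}; s \<le> t\<rbrakk> \<Longrightarrow> F s \<le> F t"
    and surj: "F ` {a..b} = {F a..F b}"
  shows "continuous_on {a..b} F"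
  unfolding continuous_on_iff
proof (intro ballI allI impI)
  fix x and e :: real assume x: "x \<in> {a..b}" and e: "e > 0"
  have ab: "a \<in> {a..b}" "b \<in> {a..b}" using x by auto
  have Fx: "F a \<le> F x" "F x \<le> F b" using mono[OF ab(1) x] mono[OF x ab(2)] x by auto
  have "\<exists>\<delta>>0. \<forall>t\<in>{a..b}. t < x + \<delta> \<longrightarrow> F t < F x + e"
  proof (cases "F x + e/2 \<le> F b")
    case True
    then have "F x + e/2 \<in> F ` {a..b}" unfolding surj using Fx e by simp
    then obtain s where s: "s \<in> {a..b}" "F s = F x + e/2" by (metis imageE)
    have "x < s" using mono[OF s(1) x] s e by (cases "x < s") auto
    moreover have "F t < F x + e" if "t \<in> {a..b}" "t < x + (s - x)" for t
      using mono[OF that(1) s(1)] that s e by auto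
    ultimately show ?thesis by (intro exI[of _ "s - x"]) auto
  next
    case False
    then have "F t < F x + e" if "t \<in> {a..b}" for t using mono[OF that ab(2)] that e by auto
    then show ?thesis by (intro exI[of _ 1]) auto
  qed
  then obtain \<delta>1 where 1: "\<delta>1 > 0" "\<And>t. t \<in> {a..b} \<Longrightarrow> t < x + \<delta>1 \<Longrightarrow> F t < F x + e" by blast
  have "\<exists>\<delta>>0. \<forall>t\<in>{a..b}. x - \<delta> < t \<longrightarrow> F x - e < F t"
  proof (cases "F a \<le> F x - e/2")
    case True
    then have "F x - e/2 \<in> F ` {a..b}" unfolding surj using Fx e by simp
    then obtain s where s: "s \<in> {a..b}" "F s = F x - e/2" by (metis imageE)
    have "s < x" using mono[OF x s(1)] s e by (cases "s < x") auto
    moreover have "F x - e < F t" if "t \<in> {a..b}" "x - (x - s) < t" for t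
      using mono[OF s(1) that(1)] that s e by auto
    ultimately show ?thesis by (intro exI[of _ "x - s"]) auto
  next
    case False
    then have "F x - e < F t" if "t \<in> {a..b}" for t using mono[OF ab(1) that] that e by auto
    then show ?thesis by (intro exI[of _ 1]) auto
  qed
  then obtain \<delta>2 where 2: "\<delta>2 > 0" "\<And>t. t \<in> {a..b} \<Longrightarrow> x - \<delta>2 < t \<Longrightarrow> F x - e < F t" by blast
  show "\<exists>\<delta>>0. \<forall>t\<in>{a..b}. dist t x < \<delta> \<longrightarrow> dist (F t) (F x) < e"
  proof (intro exI conjI ballI impI)
    show "min \<delta>1 \<delta>2 > 0" using 1 2 by simp
    fix t assume t: "t \<in> {a..b}" "dist t x < min \<delta>1 \<delta>2"
    then have "F t < F x + e" "F x - e < F t" using 1(2)[of t] 2(2)[of t] by (auto simp: dist_real_def)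
    then show "dist (F t) (F x) < e" by (simp add: dist_real_def abs_less_iff)
  qed
qed

lemma real_times_real_lepoll_real: "(UNIV :: (real \<times> real) set) \<lesssim> (UNIV :: real set)"
proof -
  have "infinite (UNIV :: real set)" using infinite_UNIV_char_0 by blast
  then obtain f :: "real \<times> real \<Rightarrow> real" where "bij_betw f (UNIV \<times> UNIV) UNIV"
    using card_of_Times_same_infinite[of "UNIV :: real set"] card_of_ordIso by blast
  then show ?thesis unfolding lepoll_def by (metis UNIV_Times_UNIV bij_betw_def subset_UNIV)
qed

text \<open>Arcs are segments, so a map that preserves alignment takes segments onto segments, a
  constant image being a degenerate one.\<close>

lemma (in geodesic_four_point) collapse_segment:
  assumes T': "geodesic_four_point T' d'" and f: "f \<in> T \<rightarrow> T'" and pa: "preserves_alignment T d T' d' f"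
    and x: "x \<in> T" "y \<in> T"
  shows "f ` {p \<in> T. btw d x p y} = {q \<in> T'. btw d' (f x) q (f y)}"
proof -
  interpret T': geodesic_four_point T' d' by (rule T')
  have fx: "f x \<in> T'" "f y \<in> T'" using f x by auto
  have single: "{q \<in> T'. btw d' z q z} = {z}" if "z \<in> T'" for z
    using T'.btw_unique[of z _ z z] T'.btw_refl that T'.nonneg
    by (auto simp: btw_def) (smt (verit) T'.nonneg T'.zero)
  have single': "{q \<in> T. btw d z q z} = {z}" if "z \<in> T" for z
    using that by (auto simp: btw_def) (smt (verit) nonneg zero)
  show ?thesis
  proof (cases "x = y")
    case True
    then show ?thesis using single single' x fx by simp
  next
    case False
    have "arc_between T d {p \<in> T. btw d x p y} x y" using arc_between_btw x False by blast
    then consider p where "f ` {p \<in> T. btw d x p y} = {p}"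
      | "arc_between T' d' (f ` {p \<in> T. btw d x p y}) (f x) (f y)"
      using pa x unfolding preserves_alignment_def by blast
    then show ?thesis
    proof cases
      case 1
      have "x \<in> {p \<in> T. btw d x p y}" "y \<in> {p \<in> T. btw d x p y}" using x by auto
      then have "f x = p" "f y = p" using 1 by blast+
      then show ?thesis using 1 single fx by simp
    next
      case 2
      then show ?thesis using T'.arc_between_eq fx by blast
    qed
  qed
qed

lemma (in geodesic_four_point) dist_image_segment:
  assumes "x \<in> T" "y \<in> T"
  shows "d x ` {p \<in> T. btw d x p y} = {0..d x y}"
proof (intro equalityI subsetI)
  fix t assume "t \<in> d x ` {p \<in> T. btw d x p y}"
  then obtain p where "t = d x p" "d x p + d p y = d x y" unfolding btw_def by blast
  then show "t \<in> {0..d x y}" using nonneg[of x p] nonneg[of p y] unfolding atLeastAtMost_iff by linarith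
next
  fix t assume "t \<in> {0..d x y}"
  then obtain p where p: "p \<in> T" "d x p = t" "d p y = d x y - t" using geod[of x y t] assms by auto
  then have "p \<in> {p \<in> T. btw d x p y}" unfolding btw_def by simp
  then show "t \<in> d x ` {p \<in> T. btw d x p y}" using p(2) by blast
qed

lemma (in geodesic_four_point) collapse_dist_continuous:
  assumes T': "geodesic_four_point T' d'" and f: "f \<in> T \<rightarrow> T'" and pa: "preserves_alignment T d T' d' f"
    and x: "x \<in> T" "y \<in> T"
    and \<gamma>: "geodesic_segment T d \<gamma> x y" "\<gamma> ` {0..d x y} = {p \<in> T. btw d x p y}"
  shows "continuous_on {0..d x y} (\<lambda>s. d' (f x) (f (\<gamma> s)))"
proof (rule mono_surj_continuous_on)
  interpret T': geodesic_four_point T' d' by (rule T')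
  note \<gamma>' = geodesic_segmentD[OF \<gamma>(1)]
  have fx: "f x \<in> T'" "f y \<in> T'" using f x by auto
  show "d' (f x) (f (\<gamma> s)) \<le> d' (f x) (f (\<gamma> t))" if s: "s \<in> {0..d x y}" "t \<in> {0..d x y}" "s \<le> t" for s t
  proof -
    have "btw d x (\<gamma> s) (\<gamma> t)" unfolding btw_def using \<gamma>'(4,5) s by simp
    then have "btw d' (f x) (f (\<gamma> s)) (f (\<gamma> t))" using collapse_segment[OF T' f pa x(1), of "\<gamma> t"] \<gamma>'(3) s by blast
    then show ?thesis using T'.nonneg[of "f (\<gamma> s)" "f (\<gamma> t)"] unfolding btw_def by linarith
  qed
  have "(\<lambda>s. d' (f x) (f (\<gamma> s))) ` {0..d x y} = d' (f x) ` (f ` (\<gamma> ` {0..d x y}))" by (simp add: image_image)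
  also have "\<dots> = {0..d' (f x) (f y)}"
    unfolding \<gamma>(2) collapse_segment[OF T' f pa x] by (rule T'.dist_image_segment[OF fx])
  finally show "(\<lambda>s. d' (f x) (f (\<gamma> s))) ` {0..d x y} = {d' (f x) (f (\<gamma> 0))..d' (f x) (f (\<gamma> (d x y)))}"
    unfolding \<gamma>'(1,2) T'.mdist_zero[OF fx(1)] .
qed

text \<open>Betweenness keeps the image of a segment inside the segment of the images. The Lipschitz
  bound makes the distance from \<open>f x\<close> continuous along it, so no point is left
  out.\<close>

lemma (in geodesic_four_point) preserves_alignmentI:
  assumes T': "geodesic_four_point T' d'" and f: "f \<in> T \<rightarrow> T'"
    and b: "\<And>x p y. \<lbrakk>x \<in> T; p \<in> T; y \<in> T; btw d x p y\<rbrakk> \<Longrightarrow> btw d' (f x) (f p) (f y)"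
    and L: "\<And>x y. \<lbrakk>x \<in> T; y \<in> T\<rbrakk> \<Longrightarrow> d' (f x) (f y) \<le> d x y"
  shows "preserves_alignment T d T' d' f"
  unfolding preserves_alignment_def
proof (intro ballI allI impI)
  interpret T': geodesic_four_point T' d' by (rule T')
  fix x y A assume x: "x \<in> T" "y \<in> T" and A: "arc_between T d A x y"
  have Aeq: "A = {p \<in> T. btw d x p y}" using arc_between_eq A x by blast
  have fx: "f x \<in> T'" "f y \<in> T'" using f x by auto
  have xA: "x \<in> A" "y \<in> A" unfolding Aeq using x by auto
  show "(\<exists>p. f ` A = {p}) \<or> arc_between T' d' (f ` A) (f x) (f y)"
  proof (cases "f x = f y")
    case True
    have "f p = f x" if p: "p \<in> A" for p
    proof -
      have "btw d' (f x) (f p) (f y)" using b[of x p y] p x unfolding Aeq by blast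
      then have "btw d' (f x) (f p) (f x)" unfolding True[symmetric] .
      then have "d' (f x) (f p) = 0" using T'.nonneg[of "f x" "f p"] T'.nonneg[of "f p" "f x"] T'.mdist_zero[OF fx(1)]
        unfolding btw_def by linarith
      moreover have "f p \<in> T'" using f p unfolding Aeq by auto
      ultimately show ?thesis using fx T'.zero[of "f x" "f p"] by simp
    qed
    then have "f ` A = (\<lambda>_. f x) ` A" by (rule image_cong[OF refl])
    then have "f ` A = {f x}" using image_constant[OF xA(1)] by metis
    then show ?thesis by blast
  next
    case False
    obtain \<gamma> where \<gamma>: "geodesic_segment T d \<gamma> x y" "\<gamma> ` {0..d x y} = {p \<in> T. btw d x p y}"
      using geodesic_param[OF x] by metis
    note \<gamma>' = geodesic_segmentD[OF \<gamma>(1)]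
    define F where "F t = d' (f x) (f (\<gamma> t))" for t
    have "\<bar>F s - F t\<bar> \<le> 1 * \<bar>s - t\<bar>" if st: "s \<in> {0..d x y}" "t \<in> {0..d x y}" for s t
    proof -
      have T: "\<gamma> s \<in> T" "\<gamma> t \<in> T" using \<gamma>'(3) st by auto
      then have fT: "f (\<gamma> s) \<in> T'" "f (\<gamma> t) \<in> T'" using f by auto
      have "\<bar>F s - F t\<bar> \<le> d' (f (\<gamma> s)) (f (\<gamma> t))"
        unfolding F_def using T'.triangle[OF fx(1) fT] T'.triangle[OF fx(1) fT(2,1)] T'.commute[of "f (\<gamma> s)"] by auto
      also have "\<dots> \<le> \<bar>s - t\<bar>" using L[OF T] \<gamma>'(4)[OF st] by simp
      finally show ?thesis by simp
    qed
    then have "1-lipschitz_on {0..d x y} F" by (intro lipschitz_onI) (auto simp: dist_real_def)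
    then have cont: "continuous_on {0..d x y} F" by (rule lipschitz_on_continuous_on)
    have F0: "F 0 = 0" "F (d x y) = d' (f x) (f y)" unfolding F_def using \<gamma>'(1,2) fx by auto
    have "f ` A = {q \<in> T'. btw d' (f x) q (f y)}"
    proof (intro equalityI subsetI)
      fix q assume "q \<in> f ` A"
      then show "q \<in> {q \<in> T'. btw d' (f x) q (f y)}" using b x f unfolding Aeq by auto
    next
      fix q assume q: "q \<in> {q \<in> T'. btw d' (f x) q (f y)}"
      then have "d' (f x) q + d' q (f y) = d' (f x) (f y)" unfolding btw_def by blast
      then have "0 \<le> d' (f x) q" "d' (f x) q \<le> d' (f x) (f y)"
        using T'.nonneg[of "f x" q] T'.nonneg[of q "f y"] by linarith+
      then obtain s where s: "s \<in> {0..d x y}" "F s = d' (f x) q"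
        using IVT'[of F 0 "d' (f x) q" "d x y"] cont F0 by auto
      have sA: "\<gamma> s \<in> A" unfolding Aeq using \<gamma>(2) s by blast
      then have "btw d' (f x) (f (\<gamma> s)) (f y)" "f (\<gamma> s) \<in> T'" using b x f unfolding Aeq by auto
      then have "f (\<gamma> s) = q" using T'.btw_unique[of "f x" "f (\<gamma> s)" "f y" q] q s fx unfolding F_def by auto
      then show "q \<in> f ` A" using sA by blast
    qed
    then show ?thesis using T'.arc_between_btw[OF fx False] by simp
  qed
qed

section \<open>The cardinality of a minimal tree\<close>

context tree_action
begin

text \<open>The segments \<open>[o', g o']\<close> cover an invariant subtree, hence everything.
  There are countably many of them, and a point is determined by \<open>g\<close> and its distance
  from \<open>o'\<close>.\<close>

lemma minimal_lepoll_real: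
  assumes "minimal_action G T d \<phi>" "countable (carrier G)"
  shows "T \<lesssim> (UNIV :: real set)"
proof -
  obtain o' where o: "o' \<in> T" using T_nonempty by blast
  define S where "S = {p \<in> T. \<exists>g\<in>carrier G. btw d o' p (\<phi> g o')}"
  have ST: "S \<subseteq> T" unfolding S_def by blast
  have seg: "p \<in> S" if "x \<in> S" "y \<in> S" "p \<in> T" "btw d x p y" for x y p
  proof -
    obtain g h where gh: "g \<in> carrier G" "h \<in> carrier G" "btw d o' x (\<phi> g o')" "btw d o' y (\<phi> h o')" "x \<in> T" "y \<in> T"
      using \<open>x \<in> S\<close> \<open>y \<in> S\<close> unfolding S_def by blast
    have "btw d o' p x \<or> btw d o' p y" using btw_split[OF \<open>btw d x p y\<close> o] gh \<open>p \<in> T\<close> by blast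
    then have "btw d o' p (\<phi> g o') \<or> btw d o' p (\<phi> h o')"
      using btw_trans2(1)[OF gh(3), of p] btw_trans2(1)[OF gh(4), of p] gh o \<open>p \<in> T\<close> by auto
    then show ?thesis unfolding S_def using gh \<open>p \<in> T\<close> by blast
  qed
  have "o' \<in> S" unfolding S_def using o by (auto intro!: bexI[of _ \<one>])
  have sub: "\<phi> h p \<in> S" if h: "h \<in> carrier G" and p: "p \<in> S" for h p
  proof -
    obtain g where g: "g \<in> carrier G" "btw d o' p (\<phi> g o')" "p \<in> T" using p unfolding S_def by blast
    have "btw d (\<phi> h o') (\<phi> h p) (\<phi> (h \<otimes> g) o')" using g h o by (simp add: act_mult)
    then have "btw d o' (\<phi> h p) (\<phi> h o') \<or> btw d o' (\<phi> h p) (\<phi> (h \<otimes> g) o')"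
      using btw_split o g h by simp
    then show ?thesis unfolding S_def using g h by auto
  qed
  have S_metric: "Metric_space S d" using subspace[OF ST] .
  interpret S: geodesic_four_point S d
  proof (intro geodesic_four_point.intro four_point.intro S_metric)
    show "four_point_axioms S d" using four_point ST by unfold_locales blast
    show "geodesic_four_point_axioms S d"
    proof
      fix x y t assume x: "x \<in> S" "y \<in> S" and t: "0 \<le> t" "t \<le> d x y"
      obtain p where p: "p \<in> T" "d x p = t" "d p y = d x y - t" using geod[of x y t] x ST t by blast
      then have "btw d x p y" unfolding btw_def by simp
      then show "\<exists>p\<in>S. d x p = t \<and> d p y = d x y - t" using seg[OF x] p by blast
    qed
  qed
  have "real_tree S d" using S.real_treeI \<open>o' \<in> S\<close> by blast
  moreover have "\<phi> h ` S = S" if h: "h \<in> carrier G" for h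
  proof (intro equalityI subsetI)
    show "x \<in> S" if "x \<in> \<phi> h ` S" for x using that sub h by blast
    show "x \<in> \<phi> h ` S" if "x \<in> S" for x
      using sub[of "inv h" x] act_inv(2)[of h x] that h ST by (metis image_eqI inv_closed subsetD)
  qed
  ultimately have "S = T" using assms(1)[unfolded minimal_action_def, rule_format, of S] ST by simp
  then have "\<forall>p\<in>T. \<exists>g\<in>carrier G. btw d o' p (\<phi> g o')" unfolding S_def by blast
  then obtain \<kappa> where \<kappa>: "\<And>p. p \<in> T \<Longrightarrow> \<kappa> p \<in> carrier G \<and> btw d o' p (\<phi> (\<kappa> p) o')" by metis
  define h where "h p = (to_nat_on (carrier G) (\<kappa> p), d o' p)" for p
  have "inj_on h T"
  proof (rule inj_onI)
    fix p q assume pq: "p \<in> T" "q \<in> T" "h p = h q"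
    then have "\<kappa> p = \<kappa> q" "d o' p = d o' q" using inj_on_to_nat_on[OF assms(2)] \<kappa>
      unfolding h_def inj_on_def by auto
    then show "p = q" using btw_unique[of o' p "\<phi> (\<kappa> p) o'" q] \<kappa>[OF pq(1)] \<kappa>[OF pq(2)] pq o by simp
  qed
  then have "T \<lesssim> (UNIV :: (nat \<times> real) set)" unfolding lepoll_def by blast
  also have "(UNIV :: (nat \<times> real) set) \<lesssim> (UNIV :: (real \<times> real) set)"
    unfolding lepoll_def by (intro exI[of _ "\<lambda>(n, x). (real n, x)"]) (auto intro!: injI)
  also have "(UNIV :: (real \<times> real) set) \<lesssim> (UNIV :: real set)" by (rule real_times_real_lepoll_real)
  finally show ?thesis .
qed

end

section \<open>Realising an invariant subtree in a given type\<close>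

locale invariant_subtree = two_trees G T1 d1 \<phi>1 T2 d2 \<phi>2
  for G :: "('g, 'm) monoid_scheme" (structure)
    and T1 :: "'a set" and d1 :: "'a \<Rightarrow> 'a \<Rightarrow> real" and \<phi>1 :: "'g \<Rightarrow> 'a \<Rightarrow> 'a"
    and T2 :: "'b set" and d2 :: "'b \<Rightarrow> 'b \<Rightarrow> real" and \<phi>2 :: "'g \<Rightarrow> 'b \<Rightarrow> 'b" +
  fixes S :: "('a \<times> 'b) set"
  assumes S: "S \<subseteq> P" "S \<noteq> {}" "invariant S" "geodesic_four_point S D"
begin

text \<open>The trees in \<^const>\<open>compatible\<close> and \<^const>\<open>is_length_function\<close> live in a given type, so
  \<open>S\<close> is transported along an injection.\<close>

context
  fixes \<iota> :: "'a \<times> 'b \<Rightarrow> 'c"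
  assumes inj: "inj_on \<iota> S"
begin

definition "copy = \<iota> ` S"
definition "copy_inv = inv_into S \<iota>"
definition "copy_dist u v = D (copy_inv u) (copy_inv v)"
definition "copy_act g = (\<lambda>u\<in>copy. \<iota> (act g (copy_inv u)))"

lemma copy_inv [simp]: "u \<in> S \<Longrightarrow> copy_inv (\<iota> u) = u"
  unfolding copy_inv_def using inj by simp

lemma copy_inv_in: "u \<in> copy \<Longrightarrow> copy_inv u \<in> S" "u \<in> copy \<Longrightarrow> \<iota> (copy_inv u) = u"
  unfolding copy_def by auto

lemma act_S: "\<lbrakk>g \<in> carrier G; u \<in> S\<rbrakk> \<Longrightarrow> act g u \<in> S"
  using S(3) unfolding invariant_def by blast

lemma copy_act_inv: "\<lbrakk>g \<in> carrier G; u \<in> copy\<rbrakk> \<Longrightarrow> copy_inv (copy_act g u) = act g (copy_inv u)"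
  unfolding copy_act_def using act_S copy_inv_in by simp

lemma copy_act_in: "\<lbrakk>g \<in> carrier G; u \<in> copy\<rbrakk> \<Longrightarrow> copy_act g u \<in> copy"
  unfolding copy_act_def using act_S copy_inv_in unfolding copy_def by simp

lemma copy_eqI: "\<lbrakk>u \<in> copy; v \<in> copy; copy_inv u = copy_inv v\<rbrakk> \<Longrightarrow> u = v"
  using copy_inv_in by metis

lemma geodesic_four_point_copy: "geodesic_four_point copy copy_dist"
proof -
  interpret S: geodesic_four_point S D by (rule S(4))
  show ?thesis
  proof
    show "0 \<le> copy_dist x y" for x y unfolding copy_dist_def by simp
    show "copy_dist x y = copy_dist y x" for x y unfolding copy_dist_def by (rule S.commute)
    show "copy_dist x y = 0 \<longleftrightarrow> x = y" if "x \<in> copy" "y \<in> copy" for x y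
      using that copy_inv_in(1) copy_eqI unfolding copy_dist_def by auto
    show "copy_dist x z \<le> copy_dist x y + copy_dist y z" if "x \<in> copy" "y \<in> copy" "z \<in> copy" for x y z
      using that copy_inv_in(1) S.triangle unfolding copy_dist_def by blast
    show "copy_dist x y + copy_dist z w \<le> max (copy_dist x z + copy_dist y w) (copy_dist x w + copy_dist y z)"
      if "x \<in> copy" "y \<in> copy" "z \<in> copy" "w \<in> copy" for x y z w
      using that copy_inv_in(1) S.four_point unfolding copy_dist_def by blast
    fix x y t assume x: "x \<in> copy" "y \<in> copy" and t: "0 \<le> t" "t \<le> copy_dist x y"
    then obtain p where p: "p \<in> S" "D (copy_inv x) p = t" "D p (copy_inv y) = copy_dist x y - t"
      using S.geod[of "copy_inv x" "copy_inv y" t] copy_inv_in(1) unfolding copy_dist_def by blast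
    then show "\<exists>p\<in>copy. copy_dist x p = t \<and> copy_dist p y = copy_dist x y - t"
      by (intro bexI[of _ "\<iota> p"]) (auto simp: copy_dist_def copy_def)
  qed
qed

lemma copy_act_mult:
  assumes "g \<in> carrier G" "h \<in> carrier G" "u \<in> copy"
  shows "copy_act (g \<otimes> h) u = copy_act g (copy_act h u)"
proof (rule copy_eqI)
  have "copy_inv u \<in> P" using assms copy_inv_in S by blast
  then show "copy_inv (copy_act (g \<otimes> h) u) = copy_inv (copy_act g (copy_act h u))"
    using assms copy_act_inv copy_act_in unfolding act_def P_def by (auto simp: A.act_mult B.act_mult)
qed (use assms copy_act_in in auto)

lemma copy_act_one: "u \<in> copy \<Longrightarrow> copy_act \<one> u = u"
proof (rule copy_eqI)
  assume u: "u \<in> copy"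
  then have "copy_inv u \<in> P" using copy_inv_in S by blast
  then show "copy_inv (copy_act \<one> u) = copy_inv u"
    using u copy_act_inv unfolding act_def P_def by auto
qed (use copy_act_in in auto)

lemma copy_act_Bij: "g \<in> carrier G \<Longrightarrow> copy_act g \<in> Bij copy"
proof -
  assume g: "g \<in> carrier G"
  have 1: "copy_act (inv g) (copy_act g u) = u" "copy_act g (copy_act (inv g) u) = u" if "u \<in> copy" for u
    using that g copy_act_mult[of "inv g" g u] copy_act_mult[of g "inv g" u] copy_act_one by auto
  have "bij_betw (copy_act g) copy copy"
    by (rule bij_betwI[of _ _ _ "copy_act (inv g)"]) (use 1 g copy_act_in in auto)
  then show ?thesis unfolding Bij_def copy_act_def by auto
qed

lemma real_tree_action_copy: "real_tree_action G copy copy_dist copy_act"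
proof -
  interpret C: geodesic_four_point copy copy_dist by (rule geodesic_four_point_copy)
  have rt: "real_tree copy copy_dist" using C.real_treeI S(2) unfolding copy_def by blast
  have "copy_act \<in> hom G (BijGroup copy)"
  proof (rule homI)
    show "copy_act g \<in> carrier (BijGroup copy)" if "g \<in> carrier G" for g
      using copy_act_Bij[OF that] by (simp add: BijGroup_def)
    show "copy_act (g \<otimes> h) = copy_act g \<otimes>\<^bsub>BijGroup copy\<^esub> copy_act h" if "g \<in> carrier G" "h \<in> carrier G" for g h
    proof -
      have "copy_act (g \<otimes> h) = compose copy (copy_act g) (copy_act h)"
        by (rule ext) (use copy_act_mult[OF that] in \<open>auto simp: compose_def copy_act_def\<close>)
      then show ?thesis using copy_act_Bij that by (simp add: BijGroup_def)
    qed
  qed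
  then have "group_hom G (BijGroup copy) copy_act"
    unfolding group_hom_def group_hom_axioms_def using group_BijGroup A.is_group by blast
  then have "group_action G copy copy_act" by (rule group_action.intro)
  moreover have "real_tree_action_axioms G copy copy_dist copy_act"
  proof
    show "copy_dist (copy_act g x) (copy_act g y) = copy_dist x y" if "g \<in> carrier G" "x \<in> copy" "y \<in> copy" for g x y
    proof -
      have "copy_inv x \<in> P" "copy_inv y \<in> P" using that copy_inv_in(1) S(1) by auto
      then show ?thesis using that unfolding copy_dist_def by (simp add: copy_act_inv act_D)
    qed
  qed
  ultimately show ?thesis using rt by (intro real_tree_action.intro)
qed

lemma copy_btw_iff:
  assumes "x \<in> copy" "p \<in> copy" "y \<in> copy"
  shows "btw copy_dist x p y \<longleftrightarrow> btw d1 (fst (copy_inv x)) (fst (copy_inv p)) (fst (copy_inv y)) \<and>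
     btw d2 (snd (copy_inv x)) (snd (copy_inv p)) (snd (copy_inv y))"
proof -
  have "copy_inv x \<in> P" "copy_inv p \<in> P" "copy_inv y \<in> P" using assms copy_inv_in(1) S(1) by auto
  then show ?thesis using btw_D_iff unfolding btw_def copy_dist_def by blast
qed

lemma collapse_copy:
  "collapse_map G copy copy_dist copy_act T1 d1 \<phi>1 (fst \<circ> copy_inv)"
  "collapse_map G copy copy_dist copy_act T2 d2 \<phi>2 (snd \<circ> copy_inv)"
proof -
  interpret C: geodesic_four_point copy copy_dist by (rule geodesic_four_point_copy)
  have P: "copy_inv u \<in> P" if "u \<in> copy" for u using that copy_inv_in(1) S(1) by auto
  have f: "fst \<circ> copy_inv \<in> copy \<rightarrow> T1" "snd \<circ> copy_inv \<in> copy \<rightarrow> T2" using P P_fst_snd by auto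
  have "preserves_alignment copy copy_dist T1 d1 (fst \<circ> copy_inv)"
    by (rule C.preserves_alignmentI[OF A.geodesic_four_point_axioms f(1)])
       (use copy_btw_iff in \<open>auto simp: copy_dist_def D_def\<close>)
  then show "collapse_map G copy copy_dist copy_act T1 d1 \<phi>1 (fst \<circ> copy_inv)"
    unfolding collapse_map_def using f copy_act_inv by (auto simp: act_def)
  have "preserves_alignment copy copy_dist T2 d2 (snd \<circ> copy_inv)"
    by (rule C.preserves_alignmentI[OF B.geodesic_four_point_axioms f(2)])
       (use copy_btw_iff in \<open>auto simp: copy_dist_def D_def\<close>)
  then show "collapse_map G copy copy_dist copy_act T2 d2 \<phi>2 (snd \<circ> copy_inv)"
    unfolding collapse_map_def using f copy_act_inv by (auto simp: act_def)
qed

text \<open>The coordinates of \<open>u\<close> lie in the characteristic sets of \<open>g\<close>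
  in both factors, so this one point realises both lengths at once.\<close>

lemma copy_length:
  assumes g: "g \<in> carrier G" and u: "u \<in> S"
    and b: "btw d1 (fst u) (\<phi>1 g (fst u)) (\<phi>1 g (\<phi>1 g (fst u)))" "btw d2 (snd u) (\<phi>2 g (snd u)) (\<phi>2 g (\<phi>2 g (snd u)))"
  shows "tree_length copy copy_dist copy_act g = A.len g + B.len g"
proof -
  interpret C: tree_action G copy copy_dist copy_act
    using real_tree_action.tree_action[OF real_tree_action_copy] .
  have uP: "u \<in> P" using u S by blast
  have iu: "\<iota> u \<in> copy" unfolding copy_def using u by blast
  have e: "copy_inv (copy_act g (\<iota> u)) = act g u" using copy_act_inv[OF g iu] u by simp
  have e2: "copy_inv (copy_act g (copy_act g (\<iota> u))) = act g (act g u)"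
    using copy_act_inv[OF g copy_act_in[OF g iu]] e by simp
  have "btw copy_dist (\<iota> u) (copy_act g (\<iota> u)) (copy_act g (copy_act g (\<iota> u)))"
    using copy_btw_iff[OF iu copy_act_in[OF g iu] copy_act_in[OF g copy_act_in[OF g iu]]] e e2 u b
    by (simp add: act_def)
  then have "C.len g = copy_dist (\<iota> u) (copy_act g (\<iota> u))" using C.len_eq[OF g iu] by blast
  also have "\<dots> = d1 (fst u) (\<phi>1 g (fst u)) + d2 (snd u) (\<phi>2 g (snd u))"
    unfolding copy_dist_def e using u by (simp add: D_def act_def)
  finally show ?thesis using A.len_eq[OF g _ b(1)] B.len_eq[OF g _ b(2)] uP P_fst_snd by simp
qed

end

end

section \<open>The two implications\<close>

context two_trees
begin

lemma P_lepoll_real: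
  assumes "T1 \<lesssim> (UNIV :: real set)" "T2 \<lesssim> (UNIV :: real set)" "(UNIV :: real set) \<lesssim> (UNIV :: 'c set)"
  shows "\<exists>\<iota> :: 'a \<times> 'b \<Rightarrow> 'c. inj_on \<iota> P"
proof -
  have "P \<lesssim> (UNIV :: real set) \<times> (UNIV :: real set)" unfolding P_def using times_lepoll_mono assms by blast
  also have "(UNIV :: real set) \<times> (UNIV :: real set) \<lesssim> (UNIV :: real set)"
    using real_times_real_lepoll_real by simp
  also note assms(3)
  finally show ?thesis unfolding lepoll_def by blast
qed

theorem compatible_of_length_function:
  assumes irr: "irreducible_action G T1 d1 \<phi>1" "irreducible_action G T2 d2 \<phi>2"
    and card: "T1 \<lesssim> (UNIV :: real set)" "T2 \<lesssim> (UNIV :: real set)" "(UNIV :: real set) \<lesssim> (UNIV :: 'c set)"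
    and T0: "tree_action G T0 d0 \<phi>0"
    and len: "\<And>g. g \<in> carrier G \<Longrightarrow> A.len g + B.len g = tree_length T0 d0 \<phi>0 g"
  shows "compatible TYPE('c) G T1 d1 \<phi>1 T2 d2 \<phi>2"
proof -
  interpret T0: tree_action G T0 d0 \<phi>0 by (rule T0)
  obtain c where c: "c \<in> carrier G" "0 < A.len c" "0 < B.len c" using exists_common_hyperbolic irr by blast
  obtain w where w: "w \<in> carrier G" "A.disjoint_axes c (A.conjg w c)" "B.disjoint_axes c (A.conjg w c)"
    using exists_common_disjoint_conjugate irr c by blast
  define a where "a = A.conjg w c"
  have a: "a \<in> carrier G" "A.len a = A.len c" "B.len a = B.len c"
    unfolding a_def using A.min_set_conjg(2) B.min_set_conjg(2) w c by auto
  have ac: "0 < A.len a" "0 < B.len a" "0 < T0.len c" "0 < T0.len a"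
    using a c len[OF c(1)] len[OF a(1)] by auto
  have "A.len c + A.len a < A.len (c \<otimes> a)" "B.len c + B.len a < B.len (c \<otimes> a)"
    using A.len_mult_disjoint[of c a] B.len_mult_disjoint[of c a] w a c ac unfolding a_def by auto
  then have "T0.len c + T0.len a < T0.len (c \<otimes> a)" using len[of c] len[of a] len[of "c \<otimes> a"] a c by simp
  then have "T0.disjoint_axes c a" using T0.len_mult_disjoint a c ac by blast
  then obtain y0 where y0: "based_tree G T0 d0 \<phi>0 c a y0" using T0.exists_based_tree c a ac by blast
  obtain y1 where y1: "based_tree G T1 d1 \<phi>1 c a y1" using A.exists_based_tree w c a ac unfolding a_def by blast
  obtain y2 where y2: "based_tree G T2 d2 \<phi>2 c a y2" using B.exists_based_tree w c a ac unfolding a_def by blast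
  let ?Z = "(\<lambda>g. act g (y1, y2)) ` carrier G"
  have yP: "(y1, y2) \<in> P" using based_tree.y[OF y1] based_tree.y[OF y2] unfolding P_def by simp
  have four: "four_point ?Z D" using four_point_orbit[OF y1 y2 y0] len by simp
  have ZP: "?Z \<subseteq> P" using act_P yP by blast
  have "invariant ?Z" unfolding invariant_def
  proof (intro ballI)
    fix g u assume g: "g \<in> carrier G" and "u \<in> ?Z"
    then obtain h where h: "h \<in> carrier G" "u = act h (y1, y2)" by blast
    have "act g u = act (g \<otimes> h) (y1, y2)" using g h yP unfolding act_def P_def by (simp add: A.act_mult B.act_mult)
    then show "act g u \<in> ?Z" using g h by blast
  qed
  then obtain S where S: "?Z \<subseteq> S" "S \<subseteq> P" "invariant S" "geodesic_four_point S D"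
    using exists_geodesic_extension[OF ZP _ four] by blast
  have "S \<noteq> {}" using S(1) A.one_closed by blast
  with S(2-4) interpret S: invariant_subtree G T1 d1 \<phi>1 T2 d2 \<phi>2 S
    by (intro invariant_subtree.intro two_trees_axioms invariant_subtree_axioms.intro)
  obtain \<iota> :: "'a \<times> 'b \<Rightarrow> 'c" where "inj_on \<iota> P" using P_lepoll_real[OF card] by blast
  then have inj: "inj_on \<iota> S" using S(2) inj_on_subset by blast
  show ?thesis unfolding compatible_def
    using S.real_tree_action_copy[OF inj] S.collapse_copy[OF inj] by blast
qed

text \<open>The metric of the refinement is unrelated to \<open>d1\<close> and \<open>d2\<close>, so
  \<open>T\<close> is replaced by its image in the product. The four-point condition holds there
  because branch points and betweenness survive; geodesicity holds because the
  \<open>D\<close>-distance from \<open>F x\<close> varies continuously along segments of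
  \<open>T\<close>.\<close>

theorem length_function_of_compatible:
  assumes card: "T1 \<lesssim> (UNIV :: real set)" "T2 \<lesssim> (UNIV :: real set)" "(UNIV :: real set) \<lesssim> (UNIV :: 'd set)"
    and T: "tree_action G T d \<phi>"
    and f: "collapse_map G T d \<phi> T1 d1 \<phi>1 f1" "collapse_map G T d \<phi> T2 d2 \<phi>2 f2"
  shows "is_length_function TYPE('d) G (\<lambda>g. A.len g + B.len g)"
proof -
  interpret T: tree_action G T d \<phi> by (rule T)
  define F where "F z = (f1 z, f2 z)" for z
  have fT: "f1 \<in> T \<rightarrow> T1" "f2 \<in> T \<rightarrow> T2" using f unfolding collapse_map_def by auto
  have FP: "F z \<in> P" if "z \<in> T" for z unfolding F_def P_def using fT that by auto
  have Fact: "F (\<phi> g z) = act g (F z)" if "g \<in> carrier G" "z \<in> T" for g z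
    using f that unfolding F_def act_def collapse_map_def by simp
  have pa: "preserves_alignment T d T1 d1 f1" "preserves_alignment T d T2 d2 f2"
    using f unfolding collapse_map_def by auto
  have b1: "btw d1 (f1 x) (f1 p) (f1 y)" and b2: "btw d2 (f2 x) (f2 p) (f2 y)"
    if "x \<in> T" "p \<in> T" "y \<in> T" "btw d x p y" for x p y
    using T.collapse_segment[OF A.geodesic_four_point_axioms fT(1) pa(1), of x y]
      T.collapse_segment[OF B.geodesic_four_point_axioms fT(2) pa(2), of x y] that by blast+
  have FD: "btw D (F x) (F p) (F y)" if "x \<in> T" "p \<in> T" "y \<in> T" "btw d x p y" for x p y
    using btw_D_iff[OF FP FP FP] b1[OF that] b2[OF that] that unfolding F_def by simp
  have four: "D (F x) (F y) + D (F z) (F w) \<le> max (D (F x) (F z) + D (F y) (F w)) (D (F x) (F w) + D (F y) (F z))"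
    if x: "x \<in> T" "y \<in> T" "z \<in> T" "w \<in> T" for x y z w
  proof -
    text \<open>\<open>m\<close> and \<open>n\<close> are the branch points on \<open>[x, y]\<close> towards \<open>z\<close> and \<open>w\<close>.\<close>
    have *: "D (F x) (F y) + D (F z) (F w) \<le> D (F x) (F w) + D (F y) (F z)"
      if x: "x \<in> T" "y \<in> T" "z \<in> T" "w \<in> T"
        and m: "m \<in> T" "btw d x m y" "btw d y m z" "btw d x m z"
        and n: "n \<in> T" "btw d x n y" "btw d y n w" "btw d x n w" and le: "d x m \<le> d x n" for x y z w m n
    proof -
      have "d m n = d x n - d x m" using T.btw_dist[OF m(2) n(2)] x m n le by simp
      then have xn: "btw d x m n" unfolding btw_def by simp
      have my: "btw d m n y" using T.btw_trans2(2)[OF n(2) xn] x m n by blast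
      have "D (F x) (F y) = D (F x) (F m) + D (F m) (F n) + D (F n) (F y)"
        "D (F x) (F w) = D (F x) (F m) + D (F m) (F n) + D (F n) (F w)"
        "D (F y) (F z) = D (F y) (F m) + D (F m) (F z)"
        "D (F m) (F y) = D (F m) (F n) + D (F n) (F y)"
        using FD[OF _ _ _ n(2)] FD[OF _ _ _ xn] FD[OF _ _ _ n(4)] FD[OF _ _ _ m(3)] FD[OF _ _ _ my] x m n
        unfolding btw_def by auto
      moreover have "D (F z) (F w) \<le> D (F z) (F m) + D (F m) (F n) + D (F n) (F w)"
        using prod.triangle[OF FP FP FP, of z m w] prod.triangle[OF FP FP FP, of m n w]
          prod.triangle[of "F z" "F m" "F w"] prod.triangle[of "F m" "F n" "F w"] FP x m n by auto
      moreover have "D (F z) (F m) = D (F m) (F z)" "D (F y) (F m) = D (F m) (F y)" by (rule prod.commute)+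
      ultimately show ?thesis by linarith
    qed
    obtain m where m: "m \<in> T" "btw d x m y" "btw d y m z" "btw d x m z" using T.median x by blast
    obtain n where n: "n \<in> T" "btw d x n y" "btw d y n w" "btw d x n w" using T.median x by blast
    show ?thesis
    proof (cases "d x m \<le> d x n")
      case True
      then show ?thesis using *[OF x m n] by simp
    next
      case False
      then have "D (F x) (F y) + D (F w) (F z) \<le> D (F x) (F z) + D (F y) (F w)" using *[OF x(1,2,4,3) n m] by simp
      then show ?thesis using prod.commute[of "F w" "F z"] by simp
    qed
  qed
  have geod: "\<exists>p\<in>T. D (F x) (F p) = t \<and> D (F p) (F y) = D (F x) (F y) - t"
    if x: "x \<in> T" "y \<in> T" and t: "0 \<le> t" "t \<le> D (F x) (F y)" for x y t
  proof -
    obtain \<gamma> where \<gamma>: "geodesic_segment T d \<gamma> x y" "\<gamma> ` {0..d x y} = {p \<in> T. btw d x p y}"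
      using T.geodesic_param[OF x] by metis
    note \<gamma>' = T.geodesic_segmentD[OF \<gamma>(1)]
    have "continuous_on {0..d x y} (\<lambda>s. d1 (f1 x) (f1 (\<gamma> s)) + d2 (f2 x) (f2 (\<gamma> s)))"
      by (intro continuous_on_add T.collapse_dist_continuous[OF A.geodesic_four_point_axioms fT(1) pa(1) x \<gamma>]
        T.collapse_dist_continuous[OF B.geodesic_four_point_axioms fT(2) pa(2) x \<gamma>])
    then have cont: "continuous_on {0..d x y} (\<lambda>s. D (F x) (F (\<gamma> s)))"
      unfolding D_def F_def fst_conv snd_conv .
    have "D (F x) (F (\<gamma> 0)) = 0" "D (F x) (F (\<gamma> (d x y))) = D (F x) (F y)" using \<gamma>'(1,2) FP x by auto
    then obtain s where s: "s \<in> {0..d x y}" "D (F x) (F (\<gamma> s)) = t"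
      using IVT'[of "\<lambda>s. D (F x) (F (\<gamma> s))" 0 t "d x y"] cont t by auto
    have "\<gamma> s \<in> T" "btw d x (\<gamma> s) y" using \<gamma>(2) s by blast+
    then show ?thesis using FD[of x "\<gamma> s" y] x s unfolding btw_def by (intro bexI[of _ "\<gamma> s"]) auto
  qed
  let ?S = "F ` T"
  have SP: "?S \<subseteq> P" using FP by blast
  have "geodesic_four_point ?S D"
  proof (intro geodesic_four_point.intro four_point_PI[OF SP])
    show "D x y + D z w \<le> max (D x z + D y w) (D x w + D y z)" if "x \<in> ?S" "y \<in> ?S" "z \<in> ?S" "w \<in> ?S" for x y z w
      using that four by blast
    show "geodesic_four_point_axioms ?S D"
    proof
      fix x y t assume "x \<in> ?S" "y \<in> ?S" and t: "0 \<le> t" "t \<le> D x y"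
      then obtain x' y' where x': "x' \<in> T" "y' \<in> T" "x = F x'" "y = F y'" by blast
      then show "\<exists>p\<in>?S. D x p = t \<and> D p y = D x y - t" using geod[of x' y' t] t by blast
    qed
  qed
  moreover have "?S \<noteq> {}" using T.T_nonempty by blast
  moreover have "invariant ?S" unfolding invariant_def using Fact T.act_closed by (metis (no_types, lifting) imageE imageI)
  ultimately interpret S: invariant_subtree G T1 d1 \<phi>1 T2 d2 \<phi>2 ?S
    using SP by (intro invariant_subtree.intro two_trees_axioms invariant_subtree_axioms.intro)
  obtain \<iota> :: "'a \<times> 'b \<Rightarrow> 'd" where "inj_on \<iota> P" using P_lepoll_real[OF card] by blast
  then have inj: "inj_on \<iota> ?S" using SP inj_on_subset by blast
  have "A.len g + B.len g = tree_length (S.copy \<iota>) (S.copy_dist \<iota>) (S.copy_act \<iota>) g" if g: "g \<in> carrier G" for g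
  proof -
    obtain z where z: "z \<in> T" "btw d z (\<phi> g z) (\<phi> g (\<phi> g z))" using T.exists_min_displacement[OF g] by blast
    have e: "f1 (\<phi> g z) = \<phi>1 g (f1 z)" "f2 (\<phi> g z) = \<phi>2 g (f2 z)" if "z \<in> T" for z
      using f g that unfolding collapse_map_def by auto
    have "btw d1 (f1 z) (\<phi>1 g (f1 z)) (\<phi>1 g (\<phi>1 g (f1 z)))"
      using b1[of z "\<phi> g z" "\<phi> g (\<phi> g z)"] z g e by simp
    moreover have "btw d2 (f2 z) (\<phi>2 g (f2 z)) (\<phi>2 g (\<phi>2 g (f2 z)))"
      using b2[of z "\<phi> g z" "\<phi> g (\<phi> g z)"] z g e by simp
    ultimately show ?thesis using S.copy_length[OF inj g, of "F z"] z unfolding F_def by simp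
  qed
  then show ?thesis unfolding is_length_function_def using S.real_tree_action_copy[OF inj] by blast
qed

end

text \<open>The two type arguments are independent: either implication builds its tree on a subset
  of the product, which injects into the reals and from there into either type.\<close>

theorem theorem1p4:
  fixes G :: "('g, 'm) monoid_scheme"
    and T\<^sub>1 :: "'a set" and d\<^sub>1 :: "'a \<Rightarrow> 'a \<Rightarrow> real" and \<phi>\<^sub>1 :: "'g \<Rightarrow> 'a \<Rightarrow> 'a"
    and T\<^sub>2 :: "'b set" and d\<^sub>2 :: "'b \<Rightarrow> 'b \<Rightarrow> real" and \<phi>\<^sub>2 :: "'g \<Rightarrow> 'b \<Rightarrow> 'b"
  assumes "group G" and "countable (carrier G)"
    and "real_tree_action G T\<^sub>1 d\<^sub>1 \<phi>\<^sub>1"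
    and "minimal_action G T\<^sub>1 d\<^sub>1 \<phi>\<^sub>1" and "irreducible_action G T\<^sub>1 d\<^sub>1 \<phi>\<^sub>1"
    and "real_tree_action G T\<^sub>2 d\<^sub>2 \<phi>\<^sub>2"
    and "minimal_action G T\<^sub>2 d\<^sub>2 \<phi>\<^sub>2" and "irreducible_action G T\<^sub>2 d\<^sub>2 \<phi>\<^sub>2"
    and "(UNIV :: real set) \<lesssim> (UNIV :: 'c set)"
    and "(UNIV :: real set) \<lesssim> (UNIV :: 'd set)"
  shows "compatible TYPE('c) G T\<^sub>1 d\<^sub>1 \<phi>\<^sub>1 T\<^sub>2 d\<^sub>2 \<phi>\<^sub>2 \<longleftrightarrow>
    is_length_function TYPE('d) G (\<lambda>g. tree_length T\<^sub>1 d\<^sub>1 \<phi>\<^sub>1 g + tree_length T\<^sub>2 d\<^sub>2 \<phi>\<^sub>2 g)"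
proof -
  interpret A: tree_action G T\<^sub>1 d\<^sub>1 \<phi>\<^sub>1 using assms(3) by (rule real_tree_action.tree_action)
  interpret B: tree_action G T\<^sub>2 d\<^sub>2 \<phi>\<^sub>2 using assms(6) by (rule real_tree_action.tree_action)
  interpret two_trees G T\<^sub>1 d\<^sub>1 \<phi>\<^sub>1 T\<^sub>2 d\<^sub>2 \<phi>\<^sub>2 by unfold_locales
  have card: "T\<^sub>1 \<lesssim> (UNIV :: real set)" "T\<^sub>2 \<lesssim> (UNIV :: real set)"
    using A.minimal_lepoll_real B.minimal_lepoll_real assms(2,4,7) by blast+
  show ?thesis
  proof
    assume "compatible TYPE('c) G T\<^sub>1 d\<^sub>1 \<phi>\<^sub>1 T\<^sub>2 d\<^sub>2 \<phi>\<^sub>2"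
    then show "is_length_function TYPE('d) G (\<lambda>g. tree_length T\<^sub>1 d\<^sub>1 \<phi>\<^sub>1 g + tree_length T\<^sub>2 d\<^sub>2 \<phi>\<^sub>2 g)"
      unfolding compatible_def
      using length_function_of_compatible[OF card assms(10) real_tree_action.tree_action] by blast
  next
    assume "is_length_function TYPE('d) G (\<lambda>g. tree_length T\<^sub>1 d\<^sub>1 \<phi>\<^sub>1 g + tree_length T\<^sub>2 d\<^sub>2 \<phi>\<^sub>2 g)"
    then show "compatible TYPE('c) G T\<^sub>1 d\<^sub>1 \<phi>\<^sub>1 T\<^sub>2 d\<^sub>2 \<phi>\<^sub>2"
      unfolding is_length_function_def
      using compatible_of_length_function[OF assms(5,8) card assms(9) real_tree_action.tree_action] by blast
  qed
qed

end
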